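(* Let $(V, \mathfrak{m}, \mathbb{K})$ be a commutative artinian local ring with residue field $\mathbb{K}$ of characteristic $p>0$, and suppose given a bijective ring homomorphism $F : V \to V$ inducing the Frobenius morphism on $\mathbb{K}$. Let $R = V[x_1,\dots,x_n]$ be a polynomial ring over $V$, let $f \in R$ be a nonzerodivisor, and let $f_0 \in \mathbb{K}[x_1,\dots,x_n]$ be its reduction mod $\mathfrak{m}$. Let $\alpha \in \mathbb{Z}_{(p)}$ be a negative rational number whose denominator is not divisible by $p$. Then $\alpha$ is a Bernstein--Sato root of $f$ if and only if it is a Bernstein--Sato root of $f_0$.
   Context: $\mathbb{Z}_{(p)}$ is the ring of rational numbers whose denominator is not divisible by $p$, viewed as a subring of $\mathbb{Z}_p$. Since $f$ is a nonzerodivisor, $f_0 \ne 0$. Bernstein--Sato roots of $f_0$ are defined by the definition below applied with $V$ replaced by the field $\mathbb{K}$ (perfect, with its Frobenius), i.e. with $\mathfrak{m} = 0$. For a commutative $V$-algebra $S$, let $\mathcal{D}_S \subseteq \operatorname{End}_V(S)$ be the ring of $V$-linear differential operators on $S$ in Grothendieck's sense: with $S \otimes_V S$ acting on $\operatorname{End}_V(S)$ by $((r\otimes s)\cdot\varphi)(x) = r\varphi(sx)$ and $J = \ker(S\otimes_V S \to S)$ the kernel of multiplication, $\mathcal{D}_S = \{\varphi : J^n\cdot \varphi = 0 \text{ for some } n \gg 0\}$. Let $C(\mathbb{Z}_p, V)$ be the ring (pointwise operations) of continuous functions $\mathbb{Z}_p \to V$, with $V$ discrete. For $\alpha \in \mathbb{Z}_p$,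 $(\mathfrak{m}:\alpha) = \{\varphi \in C(\mathbb{Z}_p,V) : \varphi(\alpha) \in \mathfrak{m}\}$ is a maximal ideal. Grade $R[t]$ by $\deg R = 0$, $\deg t = 1$, inducing a $\mathbb{Z}$-grading on $\mathcal{D}_{R[t]}$ with degree-zero subring $(\mathcal{D}_{R[t]})_0$. Each $\varphi \in C(\mathbb{Z}_p, V)$ defines an operator $\tilde\varphi \in (\mathcal{D}_{R[t]})_0$ by $\tilde\varphi(r t^a) = \varphi(-1-a) r t^a$ ($r \in R$, $a \ge 0$), so every $(\mathcal{D}_{R[t]})_0$-module is a $C(\mathbb{Z}_p,V)$-module. Localizations of $R[t]$ carry the unique $\mathcal{D}_{R[t]}$-module structures extending that on $R[t]$. Let $H_f = R[t,f^{-1},(f-t)^{-1}]/R[t,f^{-1}]$, $\delta_0 = [(f-t)^{-1}] \in H_f$, and $N_f = \big((\mathcal{D}_{R[t]})_0\cdot\delta_0\big)/\big((\mathcal{D}_{R[t]})_0\cdot f\delta_0\big)$. A $p$-adic integer $\alpha \in \mathbb{Z}_p$ is a Bernstein--Sato root of $f$ if the localization $(N_f)_\alpha$ of the $C(\mathbb{Z}_p,V)$-module $N_f$ at $(\mathfrak{m}:\alpha)$ is nonzero. *)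

theory Defs
  imports
    "HOL-Analysis.Analysis"
    "HOL-Computational_Algebra.Computational_Algebra"
    "HOL-Library.Poly_Mapping"
    "HOL-Library.Set_Algebras"
begin

section \<open>Commutative rings\<close>

definition is_ring_hom :: "('a::comm_ring_1 \<Rightarrow> 'b::comm_ring_1) \<Rightarrow> bool" where
  "is_ring_hom h \<longleftrightarrow>
     h 1 = 1 \<and> (\<forall>a b. h (a + b) = h a + h b) \<and> (\<forall>a b. h (a * b) = h a * h b)"

definition ring_ideal :: "'a::comm_ring_1 set \<Rightarrow> bool" where
  "ring_ideal I \<longleftrightarrow> module.subspace (*) I"

definition maximal_ideal :: "'a::comm_ring_1 set \<Rightarrow> bool" where
  "maximal_ideal I \<longleftrightarrow>
     ring_ideal I \<and> I \<noteq> UNIV \<and> (\<forall>J. ring_ideal J \<and> I \<subseteq> J \<longrightarrow> J = I \<or> J = UNIV)"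

text \<open>The whole type \<open>'a\<close> is a local ring with maximal ideal \<open>m\<close>.\<close>
definition local_ring :: "'a::comm_ring_1 set \<Rightarrow> bool" where
  "local_ring m \<longleftrightarrow> (\<forall>I. maximal_ideal I \<longleftrightarrow> I = m)"

definition artinian_ring :: "'a::comm_ring_1 itself \<Rightarrow> bool" where
  "artinian_ring _ \<longleftrightarrow>
     \<not> (\<exists>I :: nat \<Rightarrow> 'a set. \<forall>k. ring_ideal (I k) \<and> I (Suc k) \<subset> I k)"

definition nonzerodivisor :: "'a::comm_ring_1 \<Rightarrow> bool" where
  "nonzerodivisor a \<longleftrightarrow> (\<forall>b. a * b = 0 \<longrightarrow> b = 0)"

text \<open>
  \<open>(nat \<Rightarrow>\<^sub>0 nat) \<Rightarrow>\<^sub>0 'v\<close> is the library's ring of polynomials in the variables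
  \<open>X\<^sub>0, X\<^sub>1, \<dots>\<close>; \<open>mpolys n\<close> are those in which only \<open>X\<^sub>i\<close> with \<open>i < n\<close> occur.
  A \<open>'v\<close>-algebra \<open>'r\<close> with structure map \<open>c\<close> is the polynomial ring in \<open>x 0, \<dots>, x (n - 1)\<close>
  when evaluation \<open>X\<^sub>i \<mapsto> x i\<close> is a bijection from \<open>mpolys n\<close>; in this form \<open>n\<close> is an
  ordinary natural number, with \<open>n = 0\<close> included.
\<close>
definition mpolys :: "nat \<Rightarrow> ((nat \<Rightarrow>\<^sub>0 nat) \<Rightarrow>\<^sub>0 'v::comm_ring_1) set" where
  "mpolys n = {P. \<forall>e \<in> Poly_Mapping.keys P. Poly_Mapping.keys e \<subseteq> {..<n}}"

definition mpoly_eval ::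
    "('v::comm_ring_1 \<Rightarrow> 'r::comm_ring_1) \<Rightarrow> (nat \<Rightarrow> 'r) \<Rightarrow> ((nat \<Rightarrow>\<^sub>0 nat) \<Rightarrow>\<^sub>0 'v) \<Rightarrow> 'r" where
  "mpoly_eval c x P =
     (\<Sum>e \<in> Poly_Mapping.keys P. c (Poly_Mapping.lookup P e) *
       (\<Prod>i \<in> Poly_Mapping.keys e. x i ^ Poly_Mapping.lookup e i))"

definition polynomial_ring ::
    "('v::comm_ring_1 \<Rightarrow> 'r::comm_ring_1) \<Rightarrow> nat \<Rightarrow> (nat \<Rightarrow> 'r) \<Rightarrow> bool" where
  "polynomial_ring c n x \<longleftrightarrow> is_ring_hom c \<and> bij_betw (mpoly_eval c x) (mpolys n) UNIV"

section \<open>Total rings of fractions\<close>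

text \<open>
  Localizations at sets of nonzerodivisors are realised as subrings of the total ring of
  fractions. (\<open>'a fract\<close> is not available: \<open>R[t]\<close> need not be a domain.)
\<close>

definition tfrac_rel :: "'a::comm_ring_1 \<times> 'a \<Rightarrow> 'a \<times> 'a \<Rightarrow> bool" where
  "tfrac_rel x y \<longleftrightarrow>
     nonzerodivisor (snd x) \<and> nonzerodivisor (snd y) \<and> fst x * snd y = fst y * snd x"

lemma nonzerodivisor_1: "nonzerodivisor 1"
  by (simp add: nonzerodivisor_def)

lemma nonzerodivisor_mult:
  "nonzerodivisor a \<Longrightarrow> nonzerodivisor b \<Longrightarrow> nonzerodivisor (a * b)"
  unfolding nonzerodivisor_def mult.assoc by blast

lemma nonzerodivisor_cancel:
  assumes "nonzerodivisor a" "a * b = a * c"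
  shows "b = c"
proof -
  have "a * (b - c) = 0"
    using assms(2) by (simp add: algebra_simps)
  with assms(1) have "b - c = 0"
    unfolding nonzerodivisor_def by blast
  then show ?thesis
    by simp
qed

lemma tfrac_rel_part_equivp: "part_equivp (tfrac_rel :: 'a::comm_ring_1 \<times> 'a \<Rightarrow> _)"
proof (rule part_equivpI)
  show "\<exists>x. tfrac_rel x (x :: 'a \<times> 'a)"
    by (rule exI[of _ "(0, 1)"]) (simp add: tfrac_rel_def nonzerodivisor_1)
  show "symp (tfrac_rel :: 'a \<times> 'a \<Rightarrow> _)"
    by (auto simp: symp_def tfrac_rel_def)
  show "transp (tfrac_rel :: 'a \<times> 'a \<Rightarrow> _)"
  proof (rule transpI)
    fix x y z :: "'a \<times> 'a"
    assume xy: "tfrac_rel x y" and yz: "tfrac_rel y z"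
    have 1: "fst x * snd y = fst y * snd x" and 2: "fst y * snd z = fst z * snd y"
      using xy yz by (simp_all add: tfrac_rel_def)
    have "snd y * (fst x * snd z) = (fst x * snd y) * snd z"
      by (simp add: algebra_simps)
    also have "\<dots> = (fst y * snd z) * snd x"
      by (simp only: 1) (simp add: algebra_simps)
    also have "\<dots> = snd y * (fst z * snd x)"
      by (simp only: 2) (simp add: algebra_simps)
    finally have eq: "snd y * (fst x * snd z) = snd y * (fst z * snd x)" .
    have "nonzerodivisor (snd y)"
      using xy by (simp add: tfrac_rel_def)
    from this eq have "fst x * snd z = fst z * snd x"
      by (rule nonzerodivisor_cancel)
    with xy yz show "tfrac_rel x z"
      by (simp add: tfrac_rel_def)
  qed
qed

quotient_type (overloaded) 'a tfrac = "'a::comm_ring_1 \<times> 'a" / partial: tfrac_rel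
  by (rule tfrac_rel_part_equivp)

text \<open>\<open>tfrac a b\<close> is the fraction \<open>a / b\<close>; the value is junk if \<open>b\<close> is a zero divisor.\<close>
lift_definition tfrac :: "'a::comm_ring_1 \<Rightarrow> 'a \<Rightarrow> 'a tfrac" is
  "\<lambda>a b. (a, if nonzerodivisor b then b else 1)"
  by (simp add: tfrac_rel_def nonzerodivisor_1)

instantiation tfrac :: (comm_ring_1) comm_ring_1
begin

lift_definition zero_tfrac :: "'a tfrac" is "(0, 1)"
  by (simp add: tfrac_rel_def nonzerodivisor_1)

lift_definition one_tfrac :: "'a tfrac" is "(1, 1)"
  by (simp add: tfrac_rel_def nonzerodivisor_1)

lift_definition plus_tfrac :: "'a tfrac \<Rightarrow> 'a tfrac \<Rightarrow> 'a tfrac" is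
  "\<lambda>x y. (fst x * snd y + fst y * snd x, snd x * snd y)"
proof -
  fix x x' y y' :: "'a \<times> 'a"
  assume x: "tfrac_rel x x'" and y: "tfrac_rel y y'"
  then have eqs: "fst x * snd x' = fst x' * snd x" "fst y * snd y' = fst y' * snd y"
    and nz: "nonzerodivisor (snd x)" "nonzerodivisor (snd x')"
      "nonzerodivisor (snd y)" "nonzerodivisor (snd y')"
    by (simp_all add: tfrac_rel_def)
  have "(fst x * snd y + fst y * snd x) * (snd x' * snd y') =
      (fst x * snd x') * (snd y * snd y') + (fst y * snd y') * (snd x * snd x')"
    by (simp add: algebra_simps)
  also have "\<dots> = (fst x' * snd x) * (snd y * snd y') + (fst y' * snd y) * (snd x * snd x')"
    by (simp only: eqs)
  also have "\<dots> = (fst x' * snd y' + fst y' * snd x') * (snd x * snd y)"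
    by (simp add: algebra_simps)
  finally show "tfrac_rel (fst x * snd y + fst y * snd x, snd x * snd y)
      (fst x' * snd y' + fst y' * snd x', snd x' * snd y')"
    using nz by (simp add: tfrac_rel_def nonzerodivisor_mult)
qed

lift_definition uminus_tfrac :: "'a tfrac \<Rightarrow> 'a tfrac" is "\<lambda>x. (- fst x, snd x)"
  by (simp add: tfrac_rel_def)

lift_definition times_tfrac :: "'a tfrac \<Rightarrow> 'a tfrac \<Rightarrow> 'a tfrac" is
  "\<lambda>x y. (fst x * fst y, snd x * snd y)"
proof -
  fix x x' y y' :: "'a \<times> 'a"
  assume x: "tfrac_rel x x'" and y: "tfrac_rel y y'"
  then have eqs: "fst x * snd x' = fst x' * snd x" "fst y * snd y' = fst y' * snd y"
    and nz: "nonzerodivisor (snd x)" "nonzerodivisor (snd x')"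
      "nonzerodivisor (snd y)" "nonzerodivisor (snd y')"
    by (simp_all add: tfrac_rel_def)
  have "(fst x * fst y) * (snd x' * snd y') = (fst x * snd x') * (fst y * snd y')"
    by (simp add: algebra_simps)
  also have "\<dots> = (fst x' * snd x) * (fst y' * snd y)"
    by (simp only: eqs)
  also have "\<dots> = (fst x' * fst y') * (snd x * snd y)"
    by (simp add: algebra_simps)
  finally show "tfrac_rel (fst x * fst y, snd x * snd y) (fst x' * fst y', snd x' * snd y')"
    using nz by (simp add: tfrac_rel_def nonzerodivisor_mult)
qed

definition minus_tfrac :: "'a tfrac \<Rightarrow> 'a tfrac \<Rightarrow> 'a tfrac" where
  "minus_tfrac x y = x + - y"

instance
proof
  fix a b c :: "'a tfrac"
  show "a + b + c = a + (b + c)"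
    by transfer (simp add: tfrac_rel_def nonzerodivisor_mult algebra_simps)
  show "a + b = b + a"
    by transfer (simp add: tfrac_rel_def nonzerodivisor_mult algebra_simps)
  show "0 + a = a"
    by transfer (simp add: tfrac_rel_def)
  show "- a + a = 0"
    by transfer (simp add: tfrac_rel_def nonzerodivisor_1 nonzerodivisor_mult)
  show "a - b = a + - b"
    by (rule minus_tfrac_def)
  show "a * b * c = a * (b * c)"
    by transfer (simp add: tfrac_rel_def nonzerodivisor_mult algebra_simps)
  show "a * b = b * a"
    by transfer (simp add: tfrac_rel_def nonzerodivisor_mult algebra_simps)
  show "1 * a = a"
    by transfer (simp add: tfrac_rel_def)
  show "(a + b) * c = a * c + b * c"
    by transfer (simp add: tfrac_rel_def nonzerodivisor_mult algebra_simps)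
  show "(0 :: 'a tfrac) \<noteq> 1"
    by transfer (simp add: tfrac_rel_def)
qed

end

lemma tfrac_eq_iff:
  assumes "nonzerodivisor b" "nonzerodivisor d"
  shows "tfrac a b = tfrac c d \<longleftrightarrow> a * d = c * b"
  using assms by transfer (simp add: tfrac_rel_def)

lemma tfrac_add:
  assumes "nonzerodivisor b" "nonzerodivisor d"
  shows "tfrac a b + tfrac c d = tfrac (a * d + c * b) (b * d)"
  using assms by transfer (simp add: tfrac_rel_def nonzerodivisor_mult)

lemma tfrac_mult:
  assumes "nonzerodivisor b" "nonzerodivisor d"
  shows "tfrac a b * tfrac c d = tfrac (a * c) (b * d)"
  using assms by transfer (simp add: tfrac_rel_def nonzerodivisor_mult)

section \<open>Differential operators\<close>

text \<open>
  Throughout, \<open>c\<close> is the structure map of a \<open>'v\<close>-algebra. A list \<open>[(r\<^sub>1, s\<^sub>1), \<dots>]\<close> stands for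
  the tensor \<open>r\<^sub>1 \<otimes> s\<^sub>1 + \<dots>\<close> in \<open>S \<otimes>\<^sub>V S\<close>; every tensor is of this form, and on \<open>'v\<close>-linear
  maps the action depends only on the tensor.
\<close>
definition tensor_act :: "('s \<times> 's) list \<Rightarrow> ('s \<Rightarrow> 's) \<Rightarrow> ('s \<Rightarrow> 's::comm_ring_1)" where
  "tensor_act w \<phi> = (\<lambda>x. \<Sum>(r, s) \<leftarrow> w. r * \<phi> (s * x))"

definition mult_kernel :: "('s::comm_ring_1 \<times> 's) list set" where
  "mult_kernel = {w. (\<Sum>(r, s) \<leftarrow> w. r * s) = 0}"

text \<open>\<open>J\<^sup>n\<close> is additively generated by the \<open>n\<close>-fold products of elements of \<open>J\<close>.\<close>
definition diff_ops :: "('v::comm_ring_1 \<Rightarrow> 's::comm_ring_1) \<Rightarrow> ('s \<Rightarrow> 's) set" where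
  "diff_ops c =
     {\<phi>. module_hom (\<lambda>v s. c v * s) (\<lambda>v s. c v * s) \<phi> \<and>
         (\<exists>n. \<forall>ws. length ws = n \<and> set ws \<subseteq> mult_kernel \<longrightarrow> foldr tensor_act ws \<phi> = (\<lambda>_. 0))}"

text \<open>\<open>R[t]\<close> is the type \<open>'r poly\<close>, a \<open>'v\<close>-algebra via constant polynomials.\<close>
definition D_Rt :: "('v::comm_ring_1 \<Rightarrow> 'r::comm_ring_1) \<Rightarrow> ('r poly \<Rightarrow> 'r poly) set" where
  "D_Rt c = diff_ops (\<lambda>v. [:c v:])"

definition D_Rt_0 :: "('v::comm_ring_1 \<Rightarrow> 'r::comm_ring_1) \<Rightarrow> ('r poly \<Rightarrow> 'r poly) set" where
  "D_Rt_0 c = {P \<in> D_Rt c. \<forall>a r. \<exists>r'. P (monom r a) = monom r' a}"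

section \<open>Localizations of \<open>R[t]\<close> and their \<open>D\<close>-module structure\<close>

text \<open>For a nonzerodivisor \<open>f\<close> of \<open>R\<close>, both \<open>[:f:]\<close> (that is \<open>f\<close>) and \<open>[:f, -1:]\<close> (that is
  \<open>f - t\<close>) are nonzerodivisors of \<open>R[t]\<close>.\<close>

definition loc_f :: "'r::comm_ring_1 \<Rightarrow> 'r poly tfrac set" where
  "loc_f f = {tfrac g ([:f:] ^ k) | g k. True}"

definition loc_f_ft :: "'r::comm_ring_1 \<Rightarrow> 'r poly tfrac set" where
  "loc_f_ft f = {tfrac g ([:f:] ^ k * [:f, -1:] ^ l) | g k l. True}"

text \<open>\<open>\<rho>\<close> is a module structure over the ring of operators \<open>D\<close> on the localization \<open>A\<close>,
  compatible with the \<open>S\<close>-module structure of \<open>A\<close> and extending the action of \<open>D\<close> on \<open>S\<close>.\<close>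
definition loc_module_structure ::
    "('s \<Rightarrow> 's) set \<Rightarrow> 's tfrac set \<Rightarrow> (('s \<Rightarrow> 's) \<Rightarrow> 's tfrac \<Rightarrow> 's::comm_ring_1 tfrac) \<Rightarrow> bool" where
  "loc_module_structure D A \<rho> \<longleftrightarrow>
     (\<forall>P \<in> D. \<forall>x \<in> A. \<rho> P x \<in> A) \<and>
     (\<forall>P \<in> D. \<forall>x \<in> A. \<forall>y \<in> A. \<rho> P (x + y) = \<rho> P x + \<rho> P y) \<and>
     (\<forall>P \<in> D. \<forall>Q \<in> D. \<forall>x \<in> A. \<rho> (\<lambda>a. P a + Q a) x = \<rho> P x + \<rho> Q x) \<and>
     (\<forall>P \<in> D. \<forall>Q \<in> D. \<forall>x \<in> A. \<rho> (P \<circ> Q) x = \<rho> P (\<rho> Q x)) \<and>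
     (\<forall>s. \<forall>x \<in> A. \<rho> ((*) s) x = tfrac s 1 * x) \<and>
     (\<forall>P \<in> D. \<forall>a. \<rho> P (tfrac a 1) = tfrac (P a) 1)"

text \<open>Such a structure exists and is unique on \<open>D\<close> and \<open>A\<close>, so the choice is harmless.\<close>
definition loc_act ::
    "('v::comm_ring_1 \<Rightarrow> 'r::comm_ring_1) \<Rightarrow> 'r \<Rightarrow> ('r poly \<Rightarrow> 'r poly) \<Rightarrow> 'r poly tfrac \<Rightarrow> 'r poly tfrac"
  where "loc_act c f = (SOME \<rho>. loc_module_structure (D_Rt c) (loc_f_ft f) \<rho>)"

section \<open>The module \<open>N\<^sub>f\<close>\<close>

text \<open>Elements of a quotient by \<open>B\<close> are cosets. Below this is used with addition of ring elements
  for \<open>H\<^sub>f\<close>, and with addition of cosets (\<open>Set_Algebras\<close>) for \<open>N\<^sub>f\<close>.\<close>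
definition add_coset :: "'a::plus set \<Rightarrow> 'a \<Rightarrow> 'a set" where
  "add_coset B a = (+) a ` B"

text \<open>The map on cosets of \<open>B\<close> induced by a map \<open>g\<close> which preserves \<open>B\<close>.\<close>
definition add_coset_map :: "'a::plus set \<Rightarrow> ('a \<Rightarrow> 'a) \<Rightarrow> 'a set \<Rightarrow> 'a set" where
  "add_coset_map B g h = (\<Union>x \<in> h. add_coset B (g x))"

text \<open>The action on \<open>H\<^sub>f\<close>, whose elements are the cosets in \<open>loc_f_ft f\<close> of \<open>loc_f f\<close>.\<close>
definition H_act ::
    "('v::comm_ring_1 \<Rightarrow> 'r::comm_ring_1) \<Rightarrow> 'r \<Rightarrow> ('r poly \<Rightarrow> 'r poly) \<Rightarrow>
      'r poly tfrac set \<Rightarrow> 'r poly tfrac set" where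
  "H_act c f P = add_coset_map (loc_f f) (loc_act c f P)"

definition delta0 :: "'r::comm_ring_1 \<Rightarrow> 'r poly tfrac set" where
  "delta0 f = add_coset (loc_f f) (tfrac 1 [:f, -1:])"

definition D0_span ::
    "('v::comm_ring_1 \<Rightarrow> 'r::comm_ring_1) \<Rightarrow> 'r \<Rightarrow> 'r poly tfrac set \<Rightarrow> 'r poly tfrac set set" where
  "D0_span c f h = {H_act c f P h | P. P \<in> D_Rt_0 c}"

definition N_numer :: "('v::comm_ring_1 \<Rightarrow> 'r::comm_ring_1) \<Rightarrow> 'r \<Rightarrow> 'r poly tfrac set set" where
  "N_numer c f = D0_span c f (delta0 f)"

definition N_denom :: "('v::comm_ring_1 \<Rightarrow> 'r::comm_ring_1) \<Rightarrow> 'r \<Rightarrow> 'r poly tfrac set set" where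
  "N_denom c f = D0_span c f (H_act c f ((*) [:f:]) (delta0 f))"

definition N_module :: "('v::comm_ring_1 \<Rightarrow> 'r::comm_ring_1) \<Rightarrow> 'r \<Rightarrow> 'r poly tfrac set set set" where
  "N_module c f = add_coset (N_denom c f) ` N_numer c f"

section \<open>\<open>p\<close>-adic integers and \<open>C(\<int>\<^sub>p, V)\<close>\<close>

text \<open>\<open>\<int>\<^sub>p\<close> is the inverse limit of the discrete rings \<open>\<int>/p\<^sup>k\<close>: coherent sequences of residues
  \<open>\<alpha> k \<in> {0..<p\<^sup>k}\<close>.\<close>
definition Zp :: "nat \<Rightarrow> (nat \<Rightarrow> int) set" where
  "Zp p = {\<alpha>. \<forall>k. \<alpha> k \<in> {0..<int p ^ k} \<and> \<alpha> (Suc k) mod int p ^ k = \<alpha> k}"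

definition Zp_topology :: "nat \<Rightarrow> (nat \<Rightarrow> int) topology" where
  "Zp_topology p =
     subtopology (product_topology (\<lambda>k. discrete_topology {0..<int p ^ k}) UNIV) (Zp p)"

definition Zp_of_int :: "nat \<Rightarrow> int \<Rightarrow> nat \<Rightarrow> int" where
  "Zp_of_int p z = (\<lambda>k. z mod int p ^ k)"

text \<open>The inclusion of \<open>\<int>\<^bsub>(p)\<^esub>\<close>; \<open>quotient_of\<close> gives numerator and denominator in lowest terms.\<close>
definition Zp_of_rat :: "nat \<Rightarrow> rat \<Rightarrow> nat \<Rightarrow> int" where
  "Zp_of_rat p q = (\<lambda>k. THE z. z \<in> {0..<int p ^ k} \<and>
     (z * snd (quotient_of q)) mod int p ^ k = fst (quotient_of q) mod int p ^ k)"

definition C_Zp :: "nat \<Rightarrow> ((nat \<Rightarrow> int) \<Rightarrow> 'v::comm_ring_1) set" where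
  "C_Zp p = {\<phi> \<in> extensional (Zp p). continuous_map (Zp_topology p) (discrete_topology UNIV) \<phi>}"

definition C_Zp_one :: "nat \<Rightarrow> (nat \<Rightarrow> int) \<Rightarrow> 'v::comm_ring_1" where
  "C_Zp_one p = restrict (\<lambda>_. 1) (Zp p)"

definition C_Zp_maximal :: "nat \<Rightarrow> 'v::comm_ring_1 set \<Rightarrow> (nat \<Rightarrow> int) \<Rightarrow> ((nat \<Rightarrow> int) \<Rightarrow> 'v) set" where
  "C_Zp_maximal p m \<alpha> = {\<phi> \<in> C_Zp p. \<phi> \<alpha> \<in> m}"

text \<open>The operator \<open>r t\<^sup>a \<mapsto> \<phi>(-1-a) r t\<^sup>a\<close>, extended additively.\<close>
definition C_Zp_op ::
    "nat \<Rightarrow> ('v::comm_ring_1 \<Rightarrow> 'r::comm_ring_1) \<Rightarrow> ((nat \<Rightarrow> int) \<Rightarrow> 'v) \<Rightarrow> 'r poly \<Rightarrow> 'r poly" where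
  "C_Zp_op p c \<phi> q =
     (\<Sum>a \<le> degree q. monom (c (\<phi> (Zp_of_int p (- 1 - int a))) * coeff q a) a)"

definition N_act ::
    "nat \<Rightarrow> ('v::comm_ring_1 \<Rightarrow> 'r::comm_ring_1) \<Rightarrow> 'r \<Rightarrow> ((nat \<Rightarrow> int) \<Rightarrow> 'v) \<Rightarrow>
      'r poly tfrac set set \<Rightarrow> 'r poly tfrac set set" where
  "N_act p c f \<phi> = add_coset_map (N_denom c f) (H_act c f (C_Zp_op p c \<phi>))"

section \<open>Bernstein--Sato roots\<close>

text \<open>The localization of a module \<open>M\<close>, with scalars acting through \<open>act\<close>, at a
  multiplicative set \<open>S\<close> of scalars: classes of fractions \<open>u/s\<close>.\<close>
definition module_loc_rel ::
    "'c set \<Rightarrow> ('c \<Rightarrow> 'm \<Rightarrow> 'm) \<Rightarrow> 'm set \<Rightarrow> (('m \<times> 'c) \<times> ('m \<times> 'c)) set" where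
  "module_loc_rel S act M =
     {((u, s), (v, t)). u \<in> M \<and> s \<in> S \<and> v \<in> M \<and> t \<in> S \<and>
        (\<exists>w \<in> S. act w (act t u) = act w (act s v))}"

definition module_loc :: "'c set \<Rightarrow> ('c \<Rightarrow> 'm \<Rightarrow> 'm) \<Rightarrow> 'm set \<Rightarrow> ('m \<times> 'c) set set" where
  "module_loc S act M = (M \<times> S) // module_loc_rel S act M"

definition N_localized ::
    "nat \<Rightarrow> 'v::comm_ring_1 set \<Rightarrow> ('v \<Rightarrow> 'r::comm_ring_1) \<Rightarrow> 'r \<Rightarrow> (nat \<Rightarrow> int) \<Rightarrow>
      ('r poly tfrac set set \<times> ((nat \<Rightarrow> int) \<Rightarrow> 'v)) set set" where
  "N_localized p m c f \<alpha> =
     module_loc (C_Zp p - C_Zp_maximal p m \<alpha>) (N_act p c f) (N_module c f)"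

text \<open>The class of \<open>0/1\<close>; the zero element of \<open>N\<^sub>f\<close> is the coset \<open>N_denom c f\<close>.\<close>
definition N_localized_zero ::
    "nat \<Rightarrow> 'v::comm_ring_1 set \<Rightarrow> ('v \<Rightarrow> 'r::comm_ring_1) \<Rightarrow> 'r \<Rightarrow> (nat \<Rightarrow> int) \<Rightarrow>
      ('r poly tfrac set set \<times> ((nat \<Rightarrow> int) \<Rightarrow> 'v)) set" where
  "N_localized_zero p m c f \<alpha> =
     module_loc_rel (C_Zp p - C_Zp_maximal p m \<alpha>) (N_act p c f) (N_module c f)
       `` {(N_denom c f, C_Zp_one p)}"

definition bernstein_sato_root ::
    "nat \<Rightarrow> 'v::comm_ring_1 set \<Rightarrow> ('v \<Rightarrow> 'r::comm_ring_1) \<Rightarrow> 'r \<Rightarrow> (nat \<Rightarrow> int) \<Rightarrow> bool" where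
  "bernstein_sato_root p m c f \<alpha> \<longleftrightarrow>
     \<alpha> \<in> Zp p \<and> (\<exists>\<xi> \<in> N_localized p m c f \<alpha>. \<xi> \<noteq> N_localized_zero p m c f \<alpha>)"

end

(*
  A differential operator commutes with multiplication by p^e-th powers for large e. Hence a
  degree-zero operator on R[t] is a family of operators on R indexed by the exponent of t and
  periodic modulo p^e, and alpha fails to be a root of f if and only if a single differential
  operator Q on R satisfies Q(f^(nu+1)) = f^nu for all natural numbers nu close to alpha.
  Such a Q reduces modulo m, so roots of f_0 are roots of f.

  Conversely, over the perfect field K, the ideals of Cartier coordinates of f_0^nu, for truncations
  nu of the negative rational alpha, stabilize because they are generated in bounded degree. This
  is left-continuity of test ideals: every j admits an operator P with P(f_0^nu) = f_0^(nu-j) for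
  all nu >= j close to alpha. Starting from Q = 0, errors Q(f^(nu+1)) - f^nu = r f^(nu-j) are then
  pushed into ever smaller ideals of V: a lift P of the operator with f_0^(nu+1) |-> f_0^(nu-j)
  replaces Q by Q - r P and the ideal I containing the coefficients of r by I m.
*)
theory Submission
  imports Defs
begin

section \<open>Linear differential operators and powers of the characteristic\<close>

text \<open>In \<open>R\<close> the prime p is nilpotent but possibly nonzero, so p^e-th powers need
  not form a subring and Frobenius is not additive. Differential operators are therefore recognized
  by commuting with p^e-th powers of finitely many algebra generators, a condition that can be
  followed through reduction modulo \<open>m\<close> and through lifting.

  The factor r of an error is the same for a whole residue class of exponents because Q commutes
  with p^e-th powers, and j is the least natural number in that class. The level e, and with it j,
  may grow at every correction; hence correcting operators are wanted for every j, each valid on a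
  residue class at once.

  The exponents come from (f^q - t^q)/(f - t), whose coefficient at t^a is f^(q-1-a): nu = q-1-a is
  -1-a modulo q, the argument at which a continuous function acts in degree a. Such a function thus
  selects residue classes of exponents.

  The bijection F makes the residue field perfect, so that coefficients have p^e-th roots and
  Cartier coordinates exist.\<close>

lemma is_ring_homD:
  assumes "is_ring_hom h"
  shows "h 1 = 1" "h (a + b) = h a + h b" "h (a * b) = h a * h b"
  using assms by (simp_all add: is_ring_hom_def)

lemma is_ring_hom_0: "is_ring_hom h \<Longrightarrow> h 0 = 0"
  using is_ring_homD(2)[of h 0 0] by simp

lemma is_ring_hom_minus: "is_ring_hom h \<Longrightarrow> h (- a) = - h a"
  using is_ring_homD(2)[of h a "- a"] by (simp add: is_ring_hom_0 eq_neg_iff_add_eq_0 add.commute)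

lemma is_ring_hom_diff: "is_ring_hom h \<Longrightarrow> h (a - b) = h a - h b"
  using is_ring_homD(2)[of h a "- b"] by (simp add: is_ring_hom_minus)

lemma is_ring_hom_sum: "is_ring_hom h \<Longrightarrow> h (sum g A) = (\<Sum>i\<in>A. h (g i))"
  by (induction A rule: infinite_finite_induct) (auto simp: is_ring_hom_0 is_ring_homD)

lemma is_ring_hom_prod: "is_ring_hom h \<Longrightarrow> h (prod g A) = (\<Prod>i\<in>A. h (g i))"
  by (induction A rule: infinite_finite_induct) (auto simp: is_ring_homD)

lemma is_ring_hom_power: "is_ring_hom h \<Longrightarrow> h (a ^ k) = h a ^ k"
  by (induction k) (auto simp: is_ring_homD)

lemma is_ring_hom_of_nat: "is_ring_hom h \<Longrightarrow> h (of_nat k) = of_nat k"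
  by (induction k) (auto simp: is_ring_homD is_ring_hom_0)

definition linear_op :: "('v::comm_ring_1 \<Rightarrow> 's::comm_ring_1) \<Rightarrow> ('s \<Rightarrow> 's) \<Rightarrow> bool" where
  "linear_op c \<phi> \<longleftrightarrow> (\<forall>x y. \<phi> (x + y) = \<phi> x + \<phi> y) \<and> (\<forall>v x. \<phi> (c v * x) = c v * \<phi> x)"

lemma linear_opI:
  "(\<And>x y. \<phi> (x + y) = \<phi> x + \<phi> y) \<Longrightarrow> (\<And>v x. \<phi> (c v * x) = c v * \<phi> x) \<Longrightarrow> linear_op c \<phi>"
  by (simp add: linear_op_def)

lemma linear_op_add: "linear_op c \<phi> \<Longrightarrow> \<phi> (x + y) = \<phi> x + \<phi> y"
  and linear_op_scale: "linear_op c \<phi> \<Longrightarrow> \<phi> (c v * x) = c v * \<phi> x"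
  by (auto simp: linear_op_def)

lemma linear_op_0: "linear_op c \<phi> \<Longrightarrow> \<phi> 0 = 0"
  using linear_op_add[of c \<phi> 0 0] by simp

lemma linear_op_minus: "linear_op c \<phi> \<Longrightarrow> \<phi> (- x) = - \<phi> x"
  using linear_op_add[of c \<phi> x "- x"] by (simp add: linear_op_0 eq_neg_iff_add_eq_0 add.commute)

lemma linear_op_diff: "linear_op c \<phi> \<Longrightarrow> \<phi> (x - y) = \<phi> x - \<phi> y"
  using linear_op_add[of c \<phi> x "- y"] by (simp add: linear_op_minus)

lemma linear_op_sum: "linear_op c \<phi> \<Longrightarrow> \<phi> (sum g A) = (\<Sum>i\<in>A. \<phi> (g i))"
  by (induction A rule: infinite_finite_induct) (auto simp: linear_op_0 linear_op_add)

lemma linear_op_comp: "linear_op c \<phi> \<Longrightarrow> linear_op c \<psi> \<Longrightarrow> linear_op c (\<lambda>x. \<phi> (\<psi> x))"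
  by (simp add: linear_op_def)

lemma linear_op_plus: "linear_op c \<phi> \<Longrightarrow> linear_op c \<psi> \<Longrightarrow> linear_op c (\<lambda>x. \<phi> x + \<psi> x)"
  by (simp add: linear_op_def algebra_simps)

lemma linear_op_times: "linear_op c ((*) s)"
  by (simp add: linear_op_def algebra_simps)

lemma linear_op_zero: "linear_op c (\<lambda>_. 0)"
  by (simp add: linear_op_def)

lemma module_ring_hom: "is_ring_hom c \<Longrightarrow> module (\<lambda>v s. c v * s)"
  by unfold_locales (auto simp: is_ring_homD algebra_simps)

lemma module_hom_iff_linear_op:
  assumes "is_ring_hom c"
  shows "module_hom (\<lambda>v s. c v * s) (\<lambda>v s. c v * s) \<phi> \<longleftrightarrow> linear_op c \<phi>"
  using module_ring_hom[OF assms]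
  by (auto simp: module_hom_def module_hom_axioms_def linear_op_def)

section \<open>Commutators with multiplications and the order filtration\<close>

definition commutator :: "'s::comm_ring_1 \<Rightarrow> ('s \<Rightarrow> 's) \<Rightarrow> 's \<Rightarrow> 's" where
  "commutator h \<phi> = (\<lambda>x. \<phi> (h * x) - h * \<phi> x)"

text \<open>This is J^k . \<phi> = 0, that is, order below \<open>k\<close>.\<close>

definition killed :: "nat \<Rightarrow> ('s \<Rightarrow> 's::comm_ring_1) \<Rightarrow> bool" where
  "killed k \<phi> \<longleftrightarrow>
     (\<forall>ws. length ws = k \<and> set ws \<subseteq> mult_kernel \<longrightarrow> foldr tensor_act ws \<phi> = (\<lambda>_. 0))"

lemma diff_ops_iff:
  assumes "is_ring_hom c"
  shows "\<phi> \<in> diff_ops c \<longleftrightarrow> linear_op c \<phi> \<and> (\<exists>k. killed k \<phi>)"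
  by (simp add: diff_ops_def module_hom_iff_linear_op[OF assms] killed_def)

lemma killed_0: "killed 0 \<phi> \<longleftrightarrow> \<phi> = (\<lambda>_. 0)"
  by (simp add: killed_def)

lemma killed_Suc: "killed (Suc k) \<phi> \<longleftrightarrow> (\<forall>w\<in>mult_kernel. killed k (tensor_act w \<phi>))"
proof
  assume K: "killed (Suc k) \<phi>"
  show "\<forall>w\<in>mult_kernel. killed k (tensor_act w \<phi>)"
    unfolding killed_def
  proof (intro ballI allI impI)
    fix w :: "('a \<times> 'a) list" and ws :: "('a \<times> 'a) list list"
    assume "w \<in> mult_kernel" "length ws = k \<and> set ws \<subseteq> mult_kernel"
    then show "foldr tensor_act ws (tensor_act w \<phi>) = (\<lambda>_. 0)"
      using K[unfolded killed_def, rule_format, of "ws @ [w]"] by simp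
  qed
next
  assume K: "\<forall>w\<in>mult_kernel. killed k (tensor_act w \<phi>)"
  show "killed (Suc k) \<phi>"
    unfolding killed_def
  proof (intro allI impI)
    fix ws :: "('a \<times> 'a) list list"
    assume ws: "length ws = Suc k \<and> set ws \<subseteq> mult_kernel"
    then obtain vs w where "ws = vs @ [w]"
      by (metis length_Suc_conv_rev)
    with ws K show "foldr tensor_act ws \<phi> = (\<lambda>_. 0)"
      by (auto simp: killed_def)
  qed
qed

lemma tensor_act_commute:
  fixes \<phi> :: "'s::comm_ring_1 \<Rightarrow> 's"
  shows "tensor_act u (tensor_act w \<phi>) = tensor_act w (tensor_act u \<phi>)"
proof
  fix x
  have *: "(\<Sum>(a, b)\<leftarrow>u. a * (\<Sum>(r, s)\<leftarrow>w. r * \<phi> (s * (b * x)))) =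
      (\<Sum>(r, s)\<leftarrow>w. r * (\<Sum>(a, b)\<leftarrow>u. a * \<phi> (b * (s * x))))" for u w :: "('s \<times> 's) list" and x
  proof (induction u)
    case Nil
    show ?case by (induction w) auto
  next
    case (Cons ab u)
    obtain a b where "ab = (a, b)" by force
    moreover have "a * (\<Sum>(r, s)\<leftarrow>w. r * \<phi> (s * (b * x))) +
        (\<Sum>(r, s)\<leftarrow>w. r * (\<Sum>(a, b)\<leftarrow>u. a * \<phi> (b * (s * x)))) =
        (\<Sum>(r, s)\<leftarrow>w. r * (a * \<phi> (b * (s * x)) + (\<Sum>(a, b)\<leftarrow>u. a * \<phi> (b * (s * x)))))"
      by (induction w) (auto simp: algebra_simps)
    ultimately show ?case using Cons.IH by simp
  qed
  show "tensor_act u (tensor_act w \<phi>) x = tensor_act w (tensor_act u \<phi>) x"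
    unfolding tensor_act_def by (rule *)
qed

lemma tensor_act_plus:
  "tensor_act w (\<lambda>x. \<phi> x + \<psi> x) = (\<lambda>x. tensor_act w \<phi> x + tensor_act w \<psi> x)"
  unfolding tensor_act_def by (induction w) (auto simp: algebra_simps fun_eq_iff)

lemma tensor_act_zero: "tensor_act w (\<lambda>_. 0) = (\<lambda>_. 0)"
  unfolding tensor_act_def by (induction w) (auto simp: fun_eq_iff)

lemma killed_plus: "killed k \<phi> \<Longrightarrow> killed k \<psi> \<Longrightarrow> killed k (\<lambda>x. \<phi> x + \<psi> x)"
  by (induction k arbitrary: \<phi> \<psi>) (auto simp: killed_0 killed_Suc tensor_act_plus)

lemma killed_zero: "killed k (\<lambda>_. 0)"
  by (induction k) (auto simp: killed_0 killed_Suc tensor_act_zero)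

lemma killed_tensor_act: "killed k \<phi> \<Longrightarrow> killed k (tensor_act w \<phi>)"
proof (induction k arbitrary: \<phi>)
  case (Suc k)
  then show ?case
    by (metis killed_Suc tensor_act_commute)
qed (simp add: killed_0 tensor_act_zero)

lemma killed_commutator: "killed (Suc k) \<phi> \<Longrightarrow> killed k (commutator h \<phi>)"
proof -
  assume "killed (Suc k) \<phi>"
  moreover have "[(1, h), (- h, 1)] \<in> mult_kernel"
    by (simp add: mult_kernel_def)
  moreover have "tensor_act [(1, h), (- h, 1)] \<phi> = commutator h \<phi>"
    by (auto simp: tensor_act_def commutator_def)
  ultimately show ?thesis
    by (metis killed_Suc)
qed

lemma killed_commutator_power: "killed k \<phi> \<Longrightarrow> k \<le> i \<Longrightarrow> (commutator h ^^ i) \<phi> = (\<lambda>_. 0)"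
proof (induction k arbitrary: \<phi> i)
  case 0
  have "(commutator h ^^ i) (\<lambda>_. 0) = (\<lambda>_. 0)"
    by (induction i) (auto simp: commutator_def)
  with 0 show ?case by (simp add: killed_0)
next
  case (Suc k)
  then obtain i' where "i = Suc i'" "k \<le> i'" by (cases i) auto
  with Suc killed_commutator[of k \<phi> h] show ?case
    by (simp only: funpow_Suc_right o_apply)
qed

text \<open>Precomposition with \<open>h\<close> is \<open>commutator h\<close> plus multiplication
  by \<open>h\<close>, and these two commute as maps on operators; this is their binomial
  theorem.\<close>

lemma power_expansion:
  "\<phi> (h ^ k * x) = (\<Sum>i\<le>k. of_nat (k choose i) * h ^ (k - i) * (commutator h ^^ i) \<phi> x)"
proof (induction k arbitrary: \<phi>)
  case (Suc k)
  let ?D = "\<lambda>i. (commutator h ^^ i) \<phi> x"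
  have "\<phi> (h ^ Suc k * x) = commutator h \<phi> (h ^ k * x) + h * \<phi> (h ^ k * x)"
    by (simp add: commutator_def algebra_simps)
  also have "\<dots> = (\<Sum>i\<le>k. of_nat (k choose i) * h ^ (k - i) * ?D (Suc i)) +
      (\<Sum>i\<le>k. of_nat (k choose i) * h ^ (Suc k - i) * ?D i)"
    unfolding Suc.IH by (simp add: funpow_swap1 sum_distrib_left Suc_diff_le algebra_simps)
  also have "(\<Sum>i\<le>k. of_nat (k choose i) * h ^ (Suc k - i) * ?D i) =
      h ^ Suc k * ?D 0 + (\<Sum>i\<le>k. of_nat (k choose Suc i) * h ^ (k - i) * ?D (Suc i))"
  proof -
    have "(\<Sum>i\<le>k. of_nat (k choose i) * h ^ (Suc k - i) * ?D i) =
        (\<Sum>i\<le>Suc k. of_nat (k choose i) * h ^ (Suc k - i) * ?D i)"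
      by (simp add: binomial_eq_0)
    then show ?thesis
      by (subst (asm) sum.atMost_Suc_shift) simp
  qed
  also have "(\<Sum>i\<le>k. of_nat (k choose i) * h ^ (k - i) * ?D (Suc i)) +
      (h ^ Suc k * ?D 0 + (\<Sum>i\<le>k. of_nat (k choose Suc i) * h ^ (k - i) * ?D (Suc i))) =
      h ^ Suc k * ?D 0 + (\<Sum>i\<le>k. of_nat (Suc k choose Suc i) * h ^ (k - i) * ?D (Suc i))"
    by (simp add: sum.distrib[symmetric] algebra_simps)
  also have "\<dots> = (\<Sum>i\<le>Suc k. of_nat (Suc k choose i) * h ^ (Suc k - i) * ?D i)"
    by (subst sum.atMost_Suc_shift) simp
  finally show ?case .
qed simp

text \<open>From i * C(p^E, i) = p^E * C(p^E - 1, i - 1): the valuation of \<open>i\<close> is below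
  \<open>n\<close>, so at least E - n + 1 >= N factors p remain in the binomial coefficient.\<close>

lemma prime_power_dvd_choose:
  fixes p :: nat
  assumes "prime p" "0 < i" "i < p ^ n" "N + n \<le> Suc E"
  shows "p ^ N dvd (p ^ E choose i)"
proof (cases "i \<le> p ^ E")
  case True
  have *: "i * (p ^ E choose i) = p ^ E * (p ^ E - 1 choose (i - 1))"
    using assms(2) by (simp add: times_binomial_minus1_eq)
  have nz: "(p ^ E choose i) \<noteq> 0"
    using True by simp
  have "multiplicity p i < n"
    by (metis assms(1-3) dvd_imp_le linorder_not_less multiplicity_dvd')
  moreover have "E \<le> multiplicity p (i * (p ^ E choose i))"
    using * nz assms(1,2) by (intro multiplicity_geI) (auto simp: prime_gt_Suc_0_nat)
  moreover have "multiplicity p (i * (p ^ E choose i)) = multiplicity p i + multiplicity p (p ^ E choose i)"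
    using nz assms(1,2) by (simp add: prime_elem_multiplicity_mult_distrib)
  ultimately have "N \<le> multiplicity p (p ^ E choose i)"
    using assms(4) by linarith
  then show ?thesis
    by (simp add: multiplicity_dvd')
next
  case False
  then show ?thesis by (simp add: binomial_eq_0)
qed

text \<open>In \<open>power_expansion\<close> the terms with i >= k vanish because \<phi> has order
  below k, and those with 0 < i < k because their binomial coefficients are divisible by p^N; only i
  = 0 is left.\<close>

lemma diff_op_commutes_power:
  fixes c :: "'v::comm_ring_1 \<Rightarrow> 's::comm_ring_1"
  assumes c: "is_ring_hom c" and p: "prime p" "of_nat p ^ N = (0 :: 's)" and \<phi>: "\<phi> \<in> diff_ops c"
  shows "\<exists>E0. \<forall>E\<ge>E0. \<forall>h x. \<phi> (h ^ (p ^ E) * x) = h ^ (p ^ E) * \<phi> x"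
proof -
  obtain k where k: "killed k \<phi>"
    using \<phi> by (auto simp: diff_ops_iff[OF c])
  have "\<phi> (h ^ (p ^ E) * x) = h ^ (p ^ E) * \<phi> x" if E: "N + k \<le> E" for E h x
  proof -
    have "(\<Sum>i\<le>p ^ E. of_nat (p ^ E choose i) * h ^ (p ^ E - i) * (commutator h ^^ i) \<phi> x) =
        (\<Sum>i\<in>{0}. of_nat (p ^ E choose i) * h ^ (p ^ E - i) * (commutator h ^^ i) \<phi> x)"
    proof (rule sum.mono_neutral_right)
      show "\<forall>i\<in>{..p ^ E} - {0}.
          of_nat (p ^ E choose i) * h ^ (p ^ E - i) * (commutator h ^^ i) \<phi> x = 0"
      proof
        fix i assume "i \<in> {..p ^ E} - {0}"
        then have "0 < i" by auto
        show "of_nat (p ^ E choose i) * h ^ (p ^ E - i) * (commutator h ^^ i) \<phi> x = 0"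
        proof (cases "i < k")
          case True
          then have "i < p ^ k"
            using power_gt_expt[of p k] prime_gt_Suc_0_nat[OF p(1)] by simp
          then obtain b where "(p ^ E choose i) = p ^ N * b"
            using prime_power_dvd_choose[OF p(1) \<open>0 < i\<close>, of k N E] E by (auto elim: dvdE)
          then show ?thesis using p(2) by simp
        next
          case False
          then show ?thesis using killed_commutator_power[OF k, of i h] by simp
        qed
      qed
    qed auto
    then show ?thesis
      by (subst power_expansion) simp
  qed
  then show ?thesis by blast
qed

text \<open>Inverse of \<open>power_expansion\<close>: the commutator is the difference of the same
  commuting maps.\<close>

lemma commutator_expansion:
  "(commutator h ^^ k) \<phi> x = (\<Sum>i\<le>k. of_nat (k choose i) * (- h) ^ (k - i) * \<phi> (h ^ i * x))"
proof (induction k arbitrary: \<phi>)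
  case (Suc k)
  let ?D = "\<lambda>i. \<phi> (h ^ i * x)"
  have "(commutator h ^^ Suc k) \<phi> x = (commutator h ^^ k) (commutator h \<phi>) x"
    by (simp add: funpow_swap1)
  also have "\<dots> = (\<Sum>i\<le>k. of_nat (k choose i) * (- h) ^ (k - i) * ?D (Suc i)) +
      (\<Sum>i\<le>k. of_nat (k choose i) * (- h) ^ (Suc k - i) * ?D i)"
    unfolding Suc.IH sum.distrib[symmetric]
  proof (rule sum.cong)
    fix i assume "i \<in> {..k}"
    then have *: "Suc k - i = Suc (k - i)" by auto
    show "of_nat (k choose i) * (- h) ^ (k - i) * commutator h \<phi> (h ^ i * x) =
        of_nat (k choose i) * (- h) ^ (k - i) * ?D (Suc i) +
        of_nat (k choose i) * (- h) ^ (Suc k - i) * ?D i"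
      unfolding * by (simp add: commutator_def algebra_simps)
  qed simp
  also have "(\<Sum>i\<le>k. of_nat (k choose i) * (- h) ^ (Suc k - i) * ?D i) =
      (- h) ^ Suc k * ?D 0 + (\<Sum>i\<le>k. of_nat (k choose Suc i) * (- h) ^ (k - i) * ?D (Suc i))"
  proof -
    have "(\<Sum>i\<le>k. of_nat (k choose i) * (- h) ^ (Suc k - i) * ?D i) =
        (\<Sum>i\<le>Suc k. of_nat (k choose i) * (- h) ^ (Suc k - i) * ?D i)"
      by (simp add: binomial_eq_0)
    then show ?thesis
      by (subst (asm) sum.atMost_Suc_shift) simp
  qed
  also have "(\<Sum>i\<le>k. of_nat (k choose i) * (- h) ^ (k - i) * ?D (Suc i)) +
      ((- h) ^ Suc k * ?D 0 + (\<Sum>i\<le>k. of_nat (k choose Suc i) * (- h) ^ (k - i) * ?D (Suc i))) =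
      (- h) ^ Suc k * ?D 0 + (\<Sum>i\<le>k. of_nat (Suc k choose Suc i) * (- h) ^ (k - i) * ?D (Suc i))"
    by (simp add: sum.distrib[symmetric] algebra_simps)
  also have "\<dots> = (\<Sum>i\<le>Suc k. of_nat (Suc k choose i) * (- h) ^ (Suc k - i) * ?D i)"
    by (subst sum.atMost_Suc_shift) simp
  finally show ?case .
qed simp

text \<open>With q = p^e, the q-th iterated commutator is a binomial sum whose inner coefficients
  are divisible by p. The operator left after dividing by p again commutes with h^q, which permits
  iteration.\<close>

lemma commutator_power_divisible:
  fixes h :: "'s::comm_ring_1"
  assumes p: "prime p" and \<phi>: "\<And>x. \<phi> (h ^ (p ^ e) * x) = h ^ (p ^ e) * \<phi> x"
  shows "\<exists>\<psi>. (\<forall>x. \<psi> (h ^ (p ^ e) * x) = h ^ (p ^ e) * \<psi> x) \<and>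
    (commutator h ^^ (p ^ e)) \<phi> = (\<lambda>x. of_nat p * \<psi> x)"
proof -
  define q where "q = p ^ e"
  have q: "0 < q" using p by (simp add: q_def prime_gt_0_nat)
  have \<phi>: "\<phi> (h ^ q * x) = h ^ q * \<phi> x" for x
    using \<phi> by (simp add: q_def)
  have "\<exists>d. (q choose i) = p * d" if "i \<in> {0<..<q}" for i
    using prime_power_dvd_choose[OF p, of i e 1 e] that by (auto simp: q_def elim: dvdE)
  then obtain d where d: "\<And>i. i \<in> {0<..<q} \<Longrightarrow> (q choose i) = p * d i"
    by metis
  \<comment> \<open>The two outer terms of the sum: they cancel for odd q, while an even q forces p
    = 2 and they add up to 2 h^q.\<close>
  have "\<exists>d'::nat. (- h) ^ q + h ^ q = of_nat p * (of_nat d' * h ^ q)"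
  proof (cases "odd q")
    case True
    then show ?thesis by (intro exI[of _ 0]) simp
  next
    case False
    then have "p = 2"
      using p by (metis even_power prime_odd_nat q_def prime_ge_2_nat nat_less_le)
    with False show ?thesis by (intro exI[of _ 1]) simp
  qed
  then obtain d' :: nat where d': "(- h) ^ q + h ^ q = of_nat p * (of_nat d' * h ^ q)"
    by blast
  define \<psi> where "\<psi> x = (\<Sum>i\<in>{0<..<q}. of_nat (d i) * (- h) ^ (q - i) * \<phi> (h ^ i * x)) +
    of_nat d' * h ^ q * \<phi> x" for x
  have "\<phi> (h ^ i * (h ^ q * x)) = h ^ q * \<phi> (h ^ i * x)" for i x
    using \<phi>[of "h ^ i * x"] by (simp add: algebra_simps)
  then have "\<psi> (h ^ q * x) = h ^ q * \<psi> x" for x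
    unfolding \<psi>_def \<phi> distrib_left sum_distrib_left by (simp add: mult.left_commute)
  moreover have "(commutator h ^^ q) \<phi> x = of_nat p * \<psi> x" for x
  proof -
    let ?g = "\<lambda>i. of_nat (q choose i) * (- h) ^ (q - i) * \<phi> (h ^ i * x)"
    have "{..q} = insert 0 (insert q {0<..<q})"
      using q by auto
    then have "(commutator h ^^ q) \<phi> x = ?g 0 + ?g q + sum ?g {0<..<q}"
      using q by (simp add: commutator_expansion)
    also have "sum ?g {0<..<q} = of_nat p * (\<Sum>i\<in>{0<..<q}. of_nat (d i) * (- h) ^ (q - i) * \<phi> (h ^ i * x))"
      by (simp add: sum_distrib_left d algebra_simps)
    also have "?g 0 + ?g q = ((- h) ^ q + h ^ q) * \<phi> x"
      using q by (simp add: \<phi> distrib_right add.commute)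
    finally show ?thesis
      unfolding d' \<psi>_def by (simp add: distrib_left mult.assoc add.commute)
  qed
  ultimately show ?thesis
    by (auto simp: q_def)
qed

lemma commutator_scale:
  "(commutator h ^^ k) (\<lambda>x. s * \<psi> x) = (\<lambda>x. s * (commutator h ^^ k) \<psi> x)"
  by (induction k) (auto simp: commutator_def algebra_simps)

text \<open>Each block of p^e commutators yields a factor p, so N blocks yield p^N = 0.\<close>

lemma commutator_power_vanishes:
  fixes h :: "'s::comm_ring_1"
  assumes p: "prime p" "of_nat p ^ N = (0 :: 's)"
    and \<phi>: "\<And>x. \<phi> (h ^ (p ^ e) * x) = h ^ (p ^ e) * \<phi> x"
  shows "(commutator h ^^ (p ^ e * N)) \<phi> = (\<lambda>_. 0)"
proof -
  have "\<exists>\<psi>. (\<forall>x. \<psi> (h ^ (p ^ e) * x) = h ^ (p ^ e) * \<psi> x) \<and>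
    (commutator h ^^ (p ^ e * j)) \<phi> = (\<lambda>x. of_nat p ^ j * \<psi> x)" for j
  proof (induction j)
    case 0
    show ?case using \<phi> by auto
  next
    case (Suc j)
    then obtain \<psi> where \<psi>: "\<And>x. \<psi> (h ^ (p ^ e) * x) = h ^ (p ^ e) * \<psi> x"
      "(commutator h ^^ (p ^ e * j)) \<phi> = (\<lambda>x. of_nat p ^ j * \<psi> x)" by auto
    obtain \<psi>' where \<psi>': "\<And>x. \<psi>' (h ^ (p ^ e) * x) = h ^ (p ^ e) * \<psi>' x"
      "(commutator h ^^ (p ^ e)) \<psi> = (\<lambda>x. of_nat p * \<psi>' x)"
      using commutator_power_divisible[OF p(1), of \<psi> h e] \<psi>(1) by auto
    have "(commutator h ^^ (p ^ e * Suc j)) \<phi> = (commutator h ^^ (p ^ e)) ((commutator h ^^ (p ^ e * j)) \<phi>)"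
      unfolding mult_Suc_right funpow_add by simp
    also have "\<dots> = (\<lambda>x. of_nat p ^ Suc j * \<psi>' x)"
      unfolding \<psi>(2) commutator_scale \<psi>'(2) by (simp add: algebra_simps)
    finally show ?case using \<psi>'(1) by blast
  qed
  from this[of N] p(2) show ?thesis by auto
qed

section \<open>Finitely generated algebras in which p is nilpotent\<close>

definition generates :: "('v::comm_ring_1 \<Rightarrow> 's::comm_ring_1) \<Rightarrow> 's set \<Rightarrow> bool" where
  "generates c Y \<longleftrightarrow> (\<forall>T. range c \<subseteq> T \<and> Y \<subseteq> T \<and> (\<forall>a\<in>T. \<forall>b\<in>T. a + b \<in> T \<and> a * b \<in> T) \<longrightarrow> T = UNIV)"

lemma generates_induct [consumes 1, case_names const gen add mult]:
  assumes "generates c Y" "\<And>v. P (c v)" "\<And>y. y \<in> Y \<Longrightarrow> P y"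
    "\<And>a b. P a \<Longrightarrow> P b \<Longrightarrow> P (a + b)" "\<And>a b. P a \<Longrightarrow> P b \<Longrightarrow> P (a * b)"
  shows "P s"
proof -
  have "{s. P s} = UNIV"
    using assms(1)[unfolded generates_def, rule_format, of "{s. P s}"] assms(2-) by auto
  then show ?thesis by auto
qed

text \<open>The ideal \<open>J\<close> is generated by the elements \<open>y \<otimes> 1 - 1 \<otimes> y\<close>, \<open>y\<close> a generator.\<close>
lemma killed_SucI:
  assumes Y: "generates c Y" and \<phi>: "linear_op c \<phi>"
    and k: "\<And>y. y \<in> Y \<Longrightarrow> killed k (commutator y \<phi>)"
  shows "killed (Suc k) \<phi>"
  unfolding killed_Suc
proof
  have comm: "killed k (commutator s \<phi>)" for s
    using Y
  proof (induction s rule: generates_induct)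
    case (const v)
    have "commutator (c v) \<phi> = (\<lambda>_. 0)"
      using \<phi> by (simp add: commutator_def linear_op_scale)
    then show ?case by (simp add: killed_zero)
  next
    case (gen y)
    then show ?case by (rule k)
  next
    case (add a b)
    have "commutator (a + b) \<phi> = (\<lambda>x. commutator a \<phi> x + commutator b \<phi> x)"
      using \<phi> by (simp add: commutator_def linear_op_add algebra_simps)
    with add show ?case by (simp add: killed_plus)
  next
    case (mult a b)
    \<comment> \<open>Leibniz rule; both summands arise from commutators by operations that preserve
      \<open>killed k\<close>.\<close>
    have "commutator (a * b) \<phi> =
        (\<lambda>x. tensor_act [(1, b)] (commutator a \<phi>) x + tensor_act [(a, 1)] (commutator b \<phi>) x)"
      by (auto simp: commutator_def tensor_act_def algebra_simps)
    then show ?case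
      by (simp only: killed_plus killed_tensor_act mult)
  qed
  fix w :: "('b \<times> 'b) list"
  assume w: "w \<in> mult_kernel"
  \<comment> \<open>A tensor r \<otimes> s differs from rs \<otimes> 1 by a multiple of 1 \<otimes>
    s - s \<otimes> 1, whose action is the commutator with s. For a tensor in J the terms rs add up
    to zero.\<close>
  have "killed k (\<lambda>x. tensor_act u \<phi> x - (\<Sum>(r, s)\<leftarrow>u. r * s) * \<phi> x)" for u
  proof (induction u)
    case Nil
    show ?case by (simp add: tensor_act_def killed_zero)
  next
    case (Cons rs u)
    obtain r s where rs: "rs = (r, s)" by force
    have "(\<lambda>x. tensor_act (rs # u) \<phi> x - (\<Sum>(r, s)\<leftarrow>rs # u. r * s) * \<phi> x) =
        (\<lambda>x. tensor_act [(r, 1)] (commutator s \<phi>) x + (tensor_act u \<phi> x - (\<Sum>(r, s)\<leftarrow>u. r * s) * \<phi> x))"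
      by (auto simp: rs tensor_act_def commutator_def algebra_simps)
    then show ?case
      by (simp only: killed_plus killed_tensor_act comm Cons)
  qed
  from this[of w] w show "killed k (tensor_act w \<phi>)"
    by (simp add: mult_kernel_def)
qed

lemma commutator_commute: "commutator y (commutator z \<phi>) = commutator z (commutator y \<phi>)"
  by (auto simp: commutator_def algebra_simps fun_eq_iff)

lemma commutator_power_commute:
  "(commutator y ^^ k) (commutator z \<phi>) = commutator z ((commutator y ^^ k) \<phi>)"
  by (induction k) (auto simp: commutator_commute)

lemma commutator_linear: "linear_op c \<phi> \<Longrightarrow> linear_op c (commutator y \<phi>)"
proof (rule linear_opI)
  assume \<phi>: "linear_op c \<phi>"
  show "commutator y \<phi> (u + x) = commutator y \<phi> u + commutator y \<phi> x" for u x
    using \<phi> by (simp add: commutator_def linear_op_add algebra_simps)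
  show "commutator y \<phi> (c v * x) = c v * commutator y \<phi> x" for v x
    using linear_op_scale[OF \<phi>, of v x] linear_op_scale[OF \<phi>, of v "y * x"]
    by (simp add: commutator_def algebra_simps)
qed

text \<open>Pigeonhole: a product of \<open>sum b Y\<close> commutators with generators contains
  some y at least \<open>b y\<close> times. The extra \<open>Suc\<close> covers an empty
  \<open>Y\<close>, where \<phi> need not vanish.\<close>

lemma killed_of_commutator_powers:
  assumes Y: "generates c Y" "finite Y" and "linear_op c \<phi>"
    and "\<And>y. y \<in> Y \<Longrightarrow> (commutator y ^^ b y) \<phi> = (\<lambda>_. 0)" and "sum b Y = B"
  shows "killed (Suc B) \<phi>"
  using assms(3-5)
proof (induction B arbitrary: b \<phi>)
  case 0
  have "\<phi> = (\<lambda>_. 0)" if "y \<in> Y" for y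
  proof -
    have "b y = 0"
      using 0(3) that Y(2) by simp
    with 0(2)[OF that] show ?thesis by simp
  qed
  moreover have "commutator y (\<lambda>_. 0) = (\<lambda>_. 0)" for y :: 'b
    by (simp add: commutator_def)
  ultimately show ?case
    by (intro killed_SucI[OF Y(1) 0(1)]) (metis killed_0)
next
  case (Suc B)
  show ?case
  proof (rule killed_SucI[OF Y(1) Suc.prems(1)])
    fix y assume y: "y \<in> Y"
    have z: "commutator z (\<lambda>_. 0) = (\<lambda>_. 0)" for z :: 'b
      by (simp add: commutator_def)
    show "killed (Suc B) (commutator y \<phi>)"
    proof (cases "b y = 0")
      case True
      with Suc.prems(2)[OF y] show ?thesis by (simp add: z killed_zero)
    next
      case False
      show ?thesis
      proof (rule Suc.IH[of _ "b(y := b y - 1)"])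
        show "linear_op c (commutator y \<phi>)"
          by (rule commutator_linear[OF Suc.prems(1)])
        show "(commutator u ^^ (b(y := b y - 1)) u) (commutator y \<phi>) = (\<lambda>_. 0)" if u: "u \<in> Y" for u
        proof (cases "u = y")
          case True
          have "(commutator y ^^ (b y - 1)) (commutator y \<phi>) = (commutator y ^^ Suc (b y - 1)) \<phi>"
            by (simp add: funpow_swap1)
          with False Suc.prems(2)[OF y] True show ?thesis by simp
        next
          case False
          with Suc.prems(2)[OF u] show ?thesis by (simp add: commutator_power_commute z)
        qed
        have "sum b Y = b y + sum b (Y - {y})"
          by (rule sum.remove[OF Y(2) y])
        moreover have "sum (b(y := b y - 1)) Y = b y - 1 + sum (b(y := b y - 1)) (Y - {y})"
          using sum.remove[OF Y(2) y, of "b(y := b y - 1)"] by simp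
        moreover have "sum (b(y := b y - 1)) (Y - {y}) = sum b (Y - {y})"
          by (rule sum.cong) auto
        ultimately show "sum (b(y := b y - 1)) Y = B"
          using False Suc.prems(3) by simp
      qed
    qed
  qed
qed

text \<open>Instantiated by R, by R[t] and, with N = 1, by the polynomial ring over the residue
  field.\<close>

locale p_nilpotent_algebra =
  fixes c :: "'v::comm_ring_1 \<Rightarrow> 's::comm_ring_1" and p N :: nat and Y :: "'s set"
  assumes ring_hom: "is_ring_hom c" and prime: "prime p" and nilpotent: "of_nat p ^ N = (0 :: 's)"
    and finite_gen: "finite Y" and gen: "generates c Y"
begin

lemma diff_opD: "\<phi> \<in> diff_ops c \<Longrightarrow> linear_op c \<phi>"
  using diff_ops_iff[OF ring_hom] by blast

lemma diff_op_power: "\<phi> \<in> diff_ops c \<Longrightarrow> \<exists>E0. \<forall>E\<ge>E0. \<forall>h x. \<phi> (h ^ (p ^ E) * x) = h ^ (p ^ E) * \<phi> x"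
  by (rule diff_op_commutes_power[OF ring_hom prime nilpotent])

text \<open>Converse to \<open>diff_op_power\<close>, asking for commutation with powers of the
  generators only. This turns being a differential operator into a condition easily checked for
  sums, composites, reductions and lifts.\<close>

lemma diff_opI:
  assumes "linear_op c \<phi>" "\<And>y x. y \<in> Y \<Longrightarrow> \<phi> (y ^ (p ^ e) * x) = y ^ (p ^ e) * \<phi> x"
  shows "\<phi> \<in> diff_ops c"
proof -
  have "killed (Suc (\<Sum>y\<in>Y. p ^ e * N)) \<phi>"
    by (rule killed_of_commutator_powers[OF gen finite_gen assms(1) _ refl])
       (rule commutator_power_vanishes[OF prime nilpotent], rule assms(2))
  with assms(1) show ?thesis
    using diff_ops_iff[OF ring_hom] by blast
qed

lemma diff_op_power_common:
  assumes "\<phi> \<in> diff_ops c" "\<psi> \<in> diff_ops c"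
  shows "\<exists>E0. \<forall>E\<ge>E0. \<forall>h x. \<phi> (h ^ (p ^ E) * x) = h ^ (p ^ E) * \<phi> x \<and>
    \<psi> (h ^ (p ^ E) * x) = h ^ (p ^ E) * \<psi> x"
proof -
  obtain E1 where 1: "\<forall>E\<ge>E1. \<forall>h x. \<phi> (h ^ (p ^ E) * x) = h ^ (p ^ E) * \<phi> x"
    using diff_op_power[OF assms(1)] by (elim exE)
  obtain E2 where 2: "\<forall>E\<ge>E2. \<forall>h x. \<psi> (h ^ (p ^ E) * x) = h ^ (p ^ E) * \<psi> x"
    using diff_op_power[OF assms(2)] by (elim exE)
  show ?thesis
  proof (intro exI[of _ "max E1 E2"] allI impI)
    fix E h x assume "max E1 E2 \<le> E"
    then have "E1 \<le> E" "E2 \<le> E" by auto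
    with 1 2 show "\<phi> (h ^ (p ^ E) * x) = h ^ (p ^ E) * \<phi> x \<and>
        \<psi> (h ^ (p ^ E) * x) = h ^ (p ^ E) * \<psi> x"
      by blast
  qed
qed

lemma diff_op_comp:
  assumes "\<phi> \<in> diff_ops c" "\<psi> \<in> diff_ops c"
  shows "(\<lambda>x. \<phi> (\<psi> x)) \<in> diff_ops c"
proof -
  obtain E where E: "\<forall>h x. \<phi> (h ^ (p ^ E) * x) = h ^ (p ^ E) * \<phi> x \<and>
      \<psi> (h ^ (p ^ E) * x) = h ^ (p ^ E) * \<psi> x"
    using diff_op_power_common[OF assms] order_refl by (elim exE) blast
  show ?thesis
    by (rule diff_opI[where e = E, OF linear_op_comp[OF diff_opD[OF assms(1)] diff_opD[OF assms(2)]]])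
       (simp only: E)
qed

lemma diff_op_plus:
  assumes "\<phi> \<in> diff_ops c" "\<psi> \<in> diff_ops c"
  shows "(\<lambda>x. \<phi> x + \<psi> x) \<in> diff_ops c"
proof -
  obtain E where E: "\<forall>h x. \<phi> (h ^ (p ^ E) * x) = h ^ (p ^ E) * \<phi> x \<and>
      \<psi> (h ^ (p ^ E) * x) = h ^ (p ^ E) * \<psi> x"
    using diff_op_power_common[OF assms] order_refl by (elim exE) blast
  show ?thesis
    by (rule diff_opI[where e = E, OF linear_op_plus[OF diff_opD[OF assms(1)] diff_opD[OF assms(2)]]])
       (simp only: E distrib_left)
qed

lemma diff_op_times: "(*) s \<in> diff_ops c"
  by (rule diff_opI[where e = 0, OF linear_op_times]) (simp only: mult.left_commute)

lemma diff_op_zero: "(\<lambda>_. 0) \<in> diff_ops c"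
  by (rule diff_opI[where e = 0, OF linear_op_zero]) simp

end

section \<open>Artinian local rings\<close>

lemma ring_ideal_iff:
  "ring_ideal I \<longleftrightarrow> 0 \<in> I \<and> (\<forall>a\<in>I. \<forall>b\<in>I. a + b \<in> I) \<and> (\<forall>r. \<forall>a\<in>I. r * a \<in> I)"
proof -
  have "module ((*) :: 'a \<Rightarrow> 'a \<Rightarrow> 'a)"
    by unfold_locales (auto simp: algebra_simps)
  then show ?thesis
    by (simp add: ring_ideal_def module.subspace_def)
qed

lemma ring_ideal_principal: "ring_ideal {a * r | r. True}"
  unfolding ring_ideal_iff
proof (intro conjI ballI allI)
  show "0 \<in> {a * r | r. True}"
    by (auto intro: exI[of _ 0])
  show "u + v \<in> {a * r | r. True}" if "u \<in> {a * r | r. True}" "v \<in> {a * r | r. True}" for u v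
    using that by (auto simp: distrib_left[symmetric])
  show "s * u \<in> {a * r | r. True}" if "u \<in> {a * r | r. True}" for s u
    using that by (auto simp: mult.left_commute)
qed

lemma artinian_minimal_ideal:
  fixes \<A> :: "'a::comm_ring_1 set set"
  assumes "artinian_ring TYPE('a)" "\<A> \<noteq> {}" "\<And>I. I \<in> \<A> \<Longrightarrow> ring_ideal I"
  shows "\<exists>I\<in>\<A>. \<forall>J\<in>\<A>. J \<subseteq> I \<longrightarrow> J = I"
proof (rule ccontr)
  assume "\<not> ?thesis"
  then have "\<forall>I\<in>\<A>. \<exists>J. J \<in> \<A> \<and> J \<subset> I"
    by blast
  then obtain g where g: "\<And>I. I \<in> \<A> \<Longrightarrow> g I \<in> \<A> \<and> g I \<subset> I"
    by metis
  obtain I where I: "I \<in> \<A>"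
    using assms(2) by auto
  have mem: "(g ^^ k) I \<in> \<A>" for k
    by (induction k) (auto simp: I g)
  then have "\<forall>k. ring_ideal ((g ^^ k) I) \<and> (g ^^ Suc k) I \<subset> (g ^^ k) I"
    using assms(3) g by simp
  with assms(1) show False
    unfolding artinian_ring_def by (elim notE) (rule exI)
qed

text \<open>Among the ideals generated by single elements of \<open>X\<close> there is a minimal
  one, expressed by divisibility. With \<open>one_minus_cancel\<close> this is how the chain
  condition gives the socle, nilpotence and Nakayama.\<close>

lemma artinian_minimal_element:
  fixes X :: "'a::comm_ring_1 set"
  assumes "artinian_ring TYPE('a)" "X \<noteq> {}"
  shows "\<exists>d\<in>X. \<forall>r. d * r \<in> X \<longrightarrow> (\<exists>s. d = d * r * s)"
proof -
  define P where "P d = {d * r | r. True}" for d :: 'a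
  have "\<exists>I\<in>P ` X. \<forall>J\<in>P ` X. J \<subseteq> I \<longrightarrow> J = I"
    using assms(2) by (intro artinian_minimal_ideal[OF assms(1)]) (auto simp: P_def ring_ideal_principal[simplified])
  then obtain I where I: "I \<in> P ` X" "\<forall>J\<in>P ` X. J \<subseteq> I \<longrightarrow> J = I"
    by blast
  then obtain d where d: "d \<in> X" "I = P d"
    by auto
  have "\<exists>s. d = d * r * s" if "d * r \<in> X" for r
  proof -
    have "P (d * r) \<subseteq> P d"
      by (auto simp: P_def mult.assoc)
    then have "P (d * r) = P d"
      using I(2) d that by auto
    moreover have "d \<in> P d"
      by (auto simp: P_def intro: exI[of _ 1])
    ultimately show ?thesis
      by (auto simp: P_def)
  qed
  with d(1) show ?thesis by blast
qed

text \<open>Krull's theorem; it makes every element outside the unique maximal ideal a unit.\<close>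

lemma maximal_ideal_above:
  fixes I :: "'a::comm_ring_1 set"
  assumes "ring_ideal I" "1 \<notin> I"
  shows "\<exists>M. maximal_ideal M \<and> I \<subseteq> M"
proof -
  let ?\<A> = "{J. ring_ideal J \<and> I \<subseteq> J \<and> 1 \<notin> J}"
  have "\<exists>M\<in>?\<A>. \<forall>X\<in>?\<A>. M \<subseteq> X \<longrightarrow> X = M"
  proof (rule subset_Zorn_nonempty)
    show "?\<A> \<noteq> {}" using assms by auto
  next
    fix \<C> assume C: "\<C> \<noteq> {}" "subset.chain ?\<A> \<C>"
    then have sub: "\<C> \<subseteq> ?\<A>" and tot: "\<And>X Y. X \<in> \<C> \<Longrightarrow> Y \<in> \<C> \<Longrightarrow> X \<subseteq> Y \<or> Y \<subseteq> X"
      by (auto simp: subset_chain_def)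
    have "a + b \<in> \<Union>\<C>" if ab: "a \<in> \<Union>\<C>" "b \<in> \<Union>\<C>" for a b
    proof -
      obtain X where X: "a \<in> X" "X \<in> \<C>"
        using ab(1) by blast
      obtain Y where Y: "b \<in> Y" "Y \<in> \<C>"
        using ab(2) by blast
      note XY = X Y
      with tot[of X Y] obtain Z where "a \<in> Z" "b \<in> Z" "Z \<in> \<C>"
        by auto
      moreover have "a + b \<in> Z"
        using calculation sub by (auto simp: ring_ideal_iff)
      ultimately show ?thesis
        by blast
    qed
    moreover have "r * a \<in> \<Union>\<C>" if a: "a \<in> \<Union>\<C>" for r a
    proof -
      obtain X where X: "a \<in> X" "X \<in> \<C>"
        using a by blast
      then have "r * a \<in> X"
        using sub by (auto simp: ring_ideal_iff)
      with X(2) show ?thesis by blast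
    qed
    moreover have "0 \<in> \<Union>\<C>"
      using C(1) sub by (auto simp: ring_ideal_iff)
    ultimately have "ring_ideal (\<Union>\<C>)"
      unfolding ring_ideal_iff by blast
    with C(1) sub show "\<Union>\<C> \<in> ?\<A>"
      by auto
  qed
  then obtain M where M: "ring_ideal M" "I \<subseteq> M" "1 \<notin> M"
    "\<And>X. ring_ideal X \<Longrightarrow> 1 \<notin> X \<Longrightarrow> M \<subseteq> X \<Longrightarrow> X = M"
    by auto
  have "X = UNIV" if "ring_ideal X" "1 \<in> X" for X :: "'a set"
    using that unfolding ring_ideal_iff by (metis UNIV_eq_I mult.right_neutral)
  then have "maximal_ideal M"
    using M unfolding maximal_ideal_def by blast
  with M show ?thesis by blast
qed

locale artinian_local =
  fixes m :: "'v::comm_ring_1 set"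
  assumes artinian: "artinian_ring TYPE('v)" and local: "local_ring m"
begin

lemma maximal: "maximal_ideal m"
  using local by (simp add: local_ring_def)

lemma ideal: "ring_ideal m"
  using maximal by (simp add: maximal_ideal_def)

lemma m_zero: "0 \<in> m"
  and m_add: "a \<in> m \<Longrightarrow> b \<in> m \<Longrightarrow> a + b \<in> m"
  and m_mult: "a \<in> m \<Longrightarrow> r * a \<in> m"
  using ideal by (auto simp: ring_ideal_iff)

lemma one_notin: "1 \<notin> m"
proof
  assume 1: "1 \<in> m"
  have "r \<in> m" for r
    using m_mult[OF 1, of r] by simp
  then have "m = UNIV" by auto
  with maximal show False
    by (simp add: maximal_ideal_def)
qed

lemma unit:
  assumes "u \<notin> m"
  shows "\<exists>w. u * w = 1"
proof (rule ccontr)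
  assume *: "\<not> ?thesis"
  then have "1 \<notin> {u * r | r. True}"
    by (auto dest: sym)
  then obtain M where M: "maximal_ideal M" "{u * r | r. True} \<subseteq> M"
    using maximal_ideal_above[OF ring_ideal_principal] by blast
  have "u * 1 \<in> M" using M(2) by blast
  moreover have "M = m" using M(1) local by (simp add: local_ring_def)
  ultimately show False using assms by simp
qed

text \<open>1 - s a is a unit for \<open>a\<close> in \<open>m\<close>, and it annihilates
  \<open>d\<close>.\<close>

lemma one_minus_cancel:
  assumes "a \<in> m" "d = d * a * s"
  shows "d = 0"
proof -
  have "1 - s * a \<notin> m"
    using m_add[OF m_mult[OF assms(1), of s], of "1 - s * a"] one_notin by auto
  then obtain w where w: "(1 - s * a) * w = 1"
    using unit by blast
  have "d * (1 - s * a) = 0"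
    using assms(2) by (simp add: algebra_simps)
  then have "d * ((1 - s * a) * w) = 0"
    by (simp add: mult.assoc[symmetric])
  with w show ?thesis by simp
qed

text \<open>Take a nonzero d with minimal principal ideal: if a d were nonzero for some a in
  \<open>m\<close>, then d would be a multiple of a d, hence zero. Such an element carries
  zero-divisor relations from the reduction back to R.\<close>

lemma socle: "\<exists>z. z \<noteq> 0 \<and> (\<forall>a\<in>m. a * z = 0)"
proof -
  obtain d :: 'v where d: "d \<in> - {0}" "\<forall>r. d * r \<in> - {0} \<longrightarrow> (\<exists>s. d = d * r * s)"
  proof -
    have "1 \<in> - {0 :: 'v}" by simp
    then have ne: "- {0 :: 'v} \<noteq> {}" by (intro notI) simp
    show ?thesis
      using artinian_minimal_element[OF artinian ne] that by blast
  qed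
  have "a * d = 0" if "a \<in> m" for a
  proof (rule ccontr)
    assume "a * d \<noteq> 0"
    then have "d * a \<in> - {0}" by (simp add: mult.commute)
    then obtain s where "d = d * a * s" using d(2) by blast
    with one_minus_cancel[OF that] d(1) show False by simp
  qed
  with d(1) show ?thesis by auto
qed

lemma nilpotent:
  assumes "a \<in> m"
  shows "\<exists>N. a ^ N = 0"
proof -
  obtain d where d: "d \<in> range (\<lambda>N. a ^ N)"
    "\<forall>r. d * r \<in> range (\<lambda>N. a ^ N) \<longrightarrow> (\<exists>s. d = d * r * s)"
    using artinian_minimal_element[OF artinian, of "range (\<lambda>N. a ^ N)"] by auto
  then obtain N where N: "d = a ^ N" by auto
  then have "d * a = a ^ Suc N" by (simp add: mult.commute)
  then have "d * a \<in> range (\<lambda>N. a ^ N)" by blast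
  then obtain s where "d = d * a * s"
    using d(2) by blast
  with one_minus_cancel[OF assms] N show ?thesis by blast
qed

text \<open>Nakayama's lemma without finite generation, via T-nilpotence of \<open>m\<close>.\<close>
lemma nakayama:
  assumes I: "\<And>d y. y \<in> I \<Longrightarrow> d * y \<noteq> 0 \<Longrightarrow> \<exists>a\<in>m. \<exists>z\<in>I. d * a * z \<noteq> 0"
  shows "I \<subseteq> {0}"
proof
  fix y assume y: "y \<in> I"
  show "y \<in> {0}"
  proof (rule ccontr)
    assume "y \<notin> {0}"
    \<comment> \<open>Multipliers that do not annihilate \<open>I\<close>. The hypothesis moves a
      minimal one d to d a with a in \<open>m\<close>, again such a multiplier, which forces d =
      0.\<close>
    define X where "X = {d. \<exists>y\<in>I. d * y \<noteq> 0}"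
    have "1 \<in> X"
      using y \<open>y \<notin> {0}\<close> by (auto simp: X_def)
    then obtain d where d: "d \<in> X" "\<forall>r. d * r \<in> X \<longrightarrow> (\<exists>s. d = d * r * s)"
      using artinian_minimal_element[OF artinian, of X] by auto
    from d(1) obtain y where "y \<in> I" "d * y \<noteq> 0"
      by (auto simp: X_def)
    from I[OF this] obtain a z where a: "a \<in> m" "z \<in> I" "d * a * z \<noteq> 0"
      by blast
    then have "d * a \<in> X" by (auto simp: X_def)
    then obtain s where "d = d * a * s" using d(2) by blast
    with one_minus_cancel[OF a(1)] have "d = 0" by blast
    with d(1) show False by (simp add: X_def)
  qed
qed

end

section \<open>Coefficients in polynomial rings\<close>

definition scale_exp :: "nat \<Rightarrow> (nat \<Rightarrow>\<^sub>0 nat) \<Rightarrow> (nat \<Rightarrow>\<^sub>0 nat)" where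
  "scale_exp q = Poly_Mapping.map (\<lambda>k. q * k)"

definition div_exp :: "nat \<Rightarrow> (nat \<Rightarrow>\<^sub>0 nat) \<Rightarrow> (nat \<Rightarrow>\<^sub>0 nat)" where
  "div_exp q = Poly_Mapping.map (\<lambda>k. k div q)"

definition mod_exp :: "nat \<Rightarrow> (nat \<Rightarrow>\<^sub>0 nat) \<Rightarrow> (nat \<Rightarrow>\<^sub>0 nat)" where
  "mod_exp q = Poly_Mapping.map (\<lambda>k. k mod q)"

lemma lookup_scale_exp: "Poly_Mapping.lookup (scale_exp q b) i = q * Poly_Mapping.lookup b i"
  by (simp add: scale_exp_def Poly_Mapping.map.rep_eq when_def)

lemma lookup_div_exp: "Poly_Mapping.lookup (div_exp q b) i = Poly_Mapping.lookup b i div q"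
  by (simp add: div_exp_def Poly_Mapping.map.rep_eq when_def)

lemma lookup_mod_exp: "Poly_Mapping.lookup (mod_exp q b) i = Poly_Mapping.lookup b i mod q"
  by (simp add: mod_exp_def Poly_Mapping.map.rep_eq when_def)

lemmas lookup_exp = lookup_scale_exp lookup_div_exp lookup_mod_exp lookup_add

lemma exp_eqI: "(\<And>i. Poly_Mapping.lookup a i = Poly_Mapping.lookup b i) \<Longrightarrow> a = b"
  by (rule poly_mapping_eqI)

lemma exp_div_mod: "scale_exp q (div_exp q b) + mod_exp q b = b"
  by (rule exp_eqI) (simp add: lookup_exp)

lemma div_exp_scale_add: "q > 0 \<Longrightarrow> div_exp q (scale_exp q a + b) = a + div_exp q b"
  by (rule exp_eqI) (simp add: lookup_exp)

lemma mod_exp_scale_add: "mod_exp q (scale_exp q a + b) = mod_exp q b"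
  by (rule exp_eqI) (simp add: lookup_exp)

lemma scale_exp_add: "scale_exp q (a + b) = scale_exp q a + scale_exp q b"
  by (rule exp_eqI) (simp add: lookup_exp algebra_simps)

locale poly_ring =
  fixes c :: "'v::comm_ring_1 \<Rightarrow> 'r::comm_ring_1" and n :: nat and x :: "nat \<Rightarrow> 'r"
  assumes polynomial_ring: "polynomial_ring c n x"
begin

definition Exps :: "(nat \<Rightarrow>\<^sub>0 nat) set" where
  "Exps = {b. \<forall>i. n \<le> i \<longrightarrow> Poly_Mapping.lookup b i = 0}"

definition mon :: "(nat \<Rightarrow>\<^sub>0 nat) \<Rightarrow> 'r" where
  "mon b = (\<Prod>i<n. x i ^ Poly_Mapping.lookup b i)"

definition coef :: "'r \<Rightarrow> (nat \<Rightarrow>\<^sub>0 nat) \<Rightarrow> 'v" where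
  "coef y b = Poly_Mapping.lookup (inv_into (mpolys n) (mpoly_eval c x) y) b"

lemma hom: "is_ring_hom c"
  using polynomial_ring by (simp add: polynomial_ring_def)

lemmas c_simps = is_ring_homD[OF hom] is_ring_hom_0[OF hom]

lemma Exps_iff_keys: "b \<in> Exps \<longleftrightarrow> Poly_Mapping.keys b \<subseteq> {..<n}"
  unfolding Exps_def by (force simp: in_keys_iff subset_iff not_less[symmetric])

lemma Exps_0: "0 \<in> Exps"
  and Exps_add: "a \<in> Exps \<Longrightarrow> b \<in> Exps \<Longrightarrow> a + b \<in> Exps"
  and Exps_scale: "b \<in> Exps \<Longrightarrow> scale_exp q b \<in> Exps"
  and Exps_mod: "b \<in> Exps \<Longrightarrow> mod_exp q b \<in> Exps"
  by (auto simp: Exps_def lookup_exp)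

lemma Exps_addD: "a + b \<in> Exps \<Longrightarrow> a \<in> Exps" "a + b \<in> Exps \<Longrightarrow> b \<in> Exps"
  by (auto simp: Exps_def lookup_add)

lemma mon_0: "mon 0 = 1"
  by (simp add: mon_def)

lemma mon_add: "mon (a + b) = mon a * mon b"
  by (simp add: mon_def lookup_add power_add prod.distrib)

lemma mon_scale: "mon (scale_exp q b) = mon b ^ q"
  by (simp add: mon_def lookup_exp prod_power_distrib power_mult[symmetric] mult.commute)

lemma eval_eq:
  assumes "P \<in> mpolys n"
  shows "mpoly_eval c x P = (\<Sum>b\<in>Poly_Mapping.keys P. c (Poly_Mapping.lookup P b) * mon b)"
  unfolding mpoly_eval_def
proof (rule sum.cong)
  fix b assume "b \<in> Poly_Mapping.keys P"
  then have "Poly_Mapping.keys b \<subseteq> {..<n}"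
    using assms by (auto simp: mpolys_def)
  then have "(\<Prod>i\<in>Poly_Mapping.keys b. x i ^ Poly_Mapping.lookup b i) = mon b"
    unfolding mon_def by (rule prod.mono_neutral_left[OF finite_lessThan]) (auto simp: in_keys_iff)
  then show "c (Poly_Mapping.lookup P b) * (\<Prod>i\<in>Poly_Mapping.keys b. x i ^ Poly_Mapping.lookup b i) =
      c (Poly_Mapping.lookup P b) * mon b" by simp
qed simp

lemma bij: "bij_betw (mpoly_eval c x) (mpolys n) UNIV"
  using polynomial_ring by (simp add: polynomial_ring_def)

lemma finite_coef: "finite {b. coef y b \<noteq> 0}"
  by (simp add: coef_def)

lemma inv_mem: "inv_into (mpolys n) (mpoly_eval c x) y \<in> mpolys n"
  using bij by (metis UNIV_I bij_betw_imp_surj_on inv_into_into)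

lemma coef_Exps: "coef y b \<noteq> 0 \<Longrightarrow> b \<in> Exps"
  using inv_mem[of y] by (auto simp: mpolys_def coef_def Exps_iff_keys in_keys_iff)

lemma coef_outside: "b \<notin> Exps \<Longrightarrow> coef y b = 0"
  using coef_Exps by blast

lemma expand_supset:
  assumes "finite A" "{b. coef y b \<noteq> 0} \<subseteq> A"
  shows "y = (\<Sum>b\<in>A. c (coef y b) * mon b)"
proof -
  let ?P = "inv_into (mpolys n) (mpoly_eval c x) y"
  have "y = mpoly_eval c x ?P"
    using bij by (metis UNIV_I bij_betw_imp_surj_on f_inv_into_f)
  also have "\<dots> = (\<Sum>b\<in>Poly_Mapping.keys ?P. c (coef y b) * mon b)"
    by (simp add: eval_eq[OF inv_mem] coef_def)
  also have "\<dots> = (\<Sum>b\<in>A. c (coef y b) * mon b)"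
    using assms by (intro sum.mono_neutral_left) (auto simp: coef_def in_keys_iff c_simps)
  finally show ?thesis .
qed

lemma expand: "y = (\<Sum>b | coef y b \<noteq> 0. c (coef y b) * mon b)"
  by (rule expand_supset[OF finite_coef]) simp

text \<open>Uniqueness of the monomial expansion, from injectivity of evaluation applied to an
  explicit polynomial.\<close>

lemma coef_sum_mon:
  assumes "finite A" "A \<subseteq> Exps"
  shows "coef (\<Sum>b\<in>A. c (g b) * mon b) a = (if a \<in> A then g a else 0)"
proof -
  define P where "P = Abs_poly_mapping (\<lambda>b. if b \<in> A then g b else 0)"
  have "finite {b. (if b \<in> A then g b else 0) \<noteq> 0}"
    by (rule finite_subset[OF _ assms(1)]) auto
  then have P: "Poly_Mapping.lookup P b = (if b \<in> A then g b else 0)" for b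
    by (simp add: P_def)
  then have "Poly_Mapping.keys P \<subseteq> A"
    by (auto simp: in_keys_iff split: if_splits)
  then have mem: "P \<in> mpolys n"
    using assms(2) by (auto simp: mpolys_def Exps_iff_keys[symmetric])
  have "mpoly_eval c x P = (\<Sum>b\<in>A. c (g b) * mon b)"
    unfolding eval_eq[OF mem]
    using assms(1) \<open>Poly_Mapping.keys P \<subseteq> A\<close>
    by (intro sum.mono_neutral_cong_left) (auto simp: in_keys_iff P c_simps)
  then have "inv_into (mpolys n) (mpoly_eval c x) (\<Sum>b\<in>A. c (g b) * mon b) = P"
    using bij mem by (metis bij_betw_inv_into_left)
  then show ?thesis
    by (simp add: coef_def P)
qed

lemma coef_eqI: "(\<And>b. b \<in> Exps \<Longrightarrow> coef y b = coef z b) \<Longrightarrow> y = z"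
proof -
  assume "\<And>b. b \<in> Exps \<Longrightarrow> coef y b = coef z b"
  then have *: "coef y = coef z"
    using coef_outside by (metis ext)
  show "y = z"
    by (subst expand[of y], subst expand[of z]) (simp add: *)
qed

lemma coef_add: "coef (y + z) a = coef y a + coef z a"
proof -
  let ?A = "{b. coef y b \<noteq> 0} \<union> {b. coef z b \<noteq> 0}"
  have fin: "finite ?A" and sub: "?A \<subseteq> Exps"
    by (auto simp: finite_coef intro: coef_Exps)
  have "y = (\<Sum>b\<in>?A. c (coef y b) * mon b)" "z = (\<Sum>b\<in>?A. c (coef z b) * mon b)"
    by (rule expand_supset[OF fin]; blast)+
  then have "y + z = (\<Sum>b\<in>?A. c (coef y b + coef z b) * mon b)"
    by (simp add: c_simps distrib_right sum.distrib)
  then show ?thesis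
    by (auto simp: coef_sum_mon[OF fin sub])
qed

lemma coef_scale: "coef (c v * y) a = v * coef y a"
proof -
  let ?A = "{b. coef y b \<noteq> 0}"
  have sub: "?A \<subseteq> Exps" by (auto intro: coef_Exps)
  have "c v * y = (\<Sum>b\<in>?A. c (v * coef y b) * mon b)"
    by (subst expand[of y]) (simp add: c_simps sum_distrib_left mult.assoc)
  then show ?thesis
    by (auto simp: coef_sum_mon[OF finite_coef sub])
qed

lemma coef_0: "coef 0 a = 0"
  using coef_scale[of 0 0 a] by (simp add: c_simps)

lemma coef_sum: "coef (sum g A) a = (\<Sum>i\<in>A. coef (g i) a)"
  by (induction A rule: infinite_finite_induct) (auto simp: coef_0 coef_add)

lemma coef_mon_mult:
  assumes "a \<in> Exps"
  shows "coef (mon a * y) (a + b) = coef y b"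
    and "(\<And>b. d \<noteq> a + b) \<Longrightarrow> coef (mon a * y) d = 0"
proof -
  let ?A = "{b. coef y b \<noteq> 0}"
  let ?B = "(\<lambda>b. a + b) ` ?A"
  let ?g = "\<lambda>d. coef y (d - a)"
  have "mon a * y = (\<Sum>b\<in>?A. c (coef y b) * mon (a + b))"
    by (subst expand[of y]) (simp add: sum_distrib_left mon_add algebra_simps)
  also have "\<dots> = (\<Sum>d\<in>?B. c (?g d) * mon d)"
    by (subst sum.reindex) (auto simp: inj_on_def)
  finally have eq: "mon a * y = (\<Sum>d\<in>?B. c (?g d) * mon d)" .
  have fin: "finite ?B" and sub: "?B \<subseteq> Exps"
    using finite_coef coef_Exps Exps_add assms by auto
  show "coef (mon a * y) (a + b) = coef y b"
    unfolding eq coef_sum_mon[OF fin sub] by auto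
  show "(\<And>b. d \<noteq> a + b) \<Longrightarrow> coef (mon a * y) d = 0"
    unfolding eq coef_sum_mon[OF fin sub] by auto
qed

lemma coef_mon: "a \<in> Exps \<Longrightarrow> coef (mon a) b = (if b = a then 1 else 0)"
  using coef_sum_mon[of "{a}" "\<lambda>_. 1" b] by (simp add: c_simps)

text \<open>Additivity alone is assumed, so that maps into another ring, such as an operator
  followed by \<open>red\<close>, are covered.\<close>

lemma additive_eqI:
  assumes "\<And>y z. \<phi> (y + z) = \<phi> y + \<phi> z" "\<And>y z. \<psi> (y + z) = \<psi> y + \<psi> z"
    and "\<And>v b. b \<in> Exps \<Longrightarrow> \<phi> (c v * mon b) = \<psi> (c v * mon b)"
  shows "\<phi> y = (\<psi> y :: 'b::ab_group_add)"
proof -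
  have 0: "\<phi> 0 = 0" "\<psi> 0 = 0"
    using assms(1)[of 0 0] assms(2)[of 0 0] by simp_all
  have sum: "\<phi> (sum g A) = (\<Sum>i\<in>A. \<phi> (g i))" "\<psi> (sum g A) = (\<Sum>i\<in>A. \<psi> (g i))" if "finite A" for g and A :: "(nat \<Rightarrow>\<^sub>0 nat) set"
    using that by (induction A rule: finite_induct) (simp_all add: assms 0)
  show ?thesis
    by (subst (1 2) expand[of y]) (simp add: sum finite_coef assms(3) coef_Exps)
qed

lemma linear_op_eqI:
  assumes "linear_op c \<phi>" "linear_op c \<psi>" "\<And>b. b \<in> Exps \<Longrightarrow> \<phi> (mon b) = \<psi> (mon b)"
  shows "\<phi> y = \<psi> y"
  by (rule additive_eqI)
     (use assms in \<open>auto simp: linear_op_add[of c \<phi>] linear_op_add[of c \<psi>] linear_op_scale[of c \<phi>] linear_op_scale[of c \<psi>]\<close>)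

definition linear_ext :: "((nat \<Rightarrow>\<^sub>0 nat) \<Rightarrow> 'r) \<Rightarrow> 'r \<Rightarrow> 'r" where
  "linear_ext G y = (\<Sum>b | coef y b \<noteq> 0. c (coef y b) * G b)"

lemma linear_ext_supset:
  assumes "finite A" "{b. coef y b \<noteq> 0} \<subseteq> A"
  shows "linear_ext G y = (\<Sum>b\<in>A. c (coef y b) * G b)"
  unfolding linear_ext_def using assms by (intro sum.mono_neutral_left) (auto simp: c_simps)

lemma linear_ext: "linear_op c (linear_ext G)"
proof (rule linear_opI)
  fix y z
  let ?A = "{b. coef y b \<noteq> 0} \<union> {b. coef z b \<noteq> 0}"
  have fin: "finite ?A" by (auto simp: finite_coef)
  have "{b. coef (y + z) b \<noteq> 0} \<subseteq> ?A"
    by (auto simp: coef_add)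
  then show "linear_ext G (y + z) = linear_ext G y + linear_ext G z"
    by (simp add: linear_ext_supset[OF fin] coef_add c_simps distrib_right sum.distrib)
next
  fix v y
  have "{b. coef (c v * y) b \<noteq> 0} \<subseteq> {b. coef y b \<noteq> 0}"
    by (auto simp: coef_scale)
  then show "linear_ext G (c v * y) = c v * linear_ext G y"
    by (simp add: linear_ext_supset[OF finite_coef[of y]] coef_scale c_simps sum_distrib_left mult.assoc)
qed

lemma linear_ext_mon: "b \<in> Exps \<Longrightarrow> linear_ext G (mon b) = G b"
  by (subst linear_ext_supset[of "{b}"]) (auto simp: coef_mon c_simps)

lemma generated_by_vars: "generates c (x ` {..<n})"
  unfolding generates_def
proof (intro allI impI, elim conjE)
  fix T
  assume c: "range c \<subseteq> T" and x: "x ` {..<n} \<subseteq> T" and ops: "\<forall>a\<in>T. \<forall>b\<in>T. a + b \<in> T \<and> a * b \<in> T"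
  have "c 0 \<in> T" "c 1 \<in> T" using c by auto
  then have 01: "0 \<in> T" "1 \<in> T" by (simp_all add: c_simps)
  have pow: "y ^ k \<in> T" if "y \<in> T" for y k
    using that 01 ops by (induction k) auto
  have "(\<Prod>i\<in>I. x i ^ Poly_Mapping.lookup b i) \<in> T" if "finite I" "I \<subseteq> {..<n}" for I b
    using that by (induction I rule: finite_induct) (use 01 ops x pow in auto)
  then have "mon b \<in> T" for b
    unfolding mon_def by blast
  then have cm: "c v * mon b \<in> T" for v b
    using ops c by blast
  have "(\<Sum>b\<in>A. c (g b) * mon b) \<in> T" if "finite A" for A g
    using that cm by (induction A rule: finite_induct) (use 01 ops in auto)
  then have "y \<in> T" for y
    using expand[of y] finite_coef[of y] by metis
  then show "T = UNIV" by auto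
qed

lemma x_eq_mon: "i < n \<Longrightarrow> x i = mon (Poly_Mapping.single i 1)"
  unfolding mon_def by (subst prod.mono_neutral_right[of _ "{i}"]) (auto simp: lookup_single when_def)

lemma single_Exps: "i < n \<Longrightarrow> Poly_Mapping.single i k \<in> Exps"
  by (auto simp: Exps_def lookup_single when_def)

end

context poly_ring
begin

lemma coef_mult_mem:
  assumes K: "ring_ideal K" "\<And>a b. a \<in> I \<Longrightarrow> b \<in> J \<Longrightarrow> a * b \<in> K"
    and "\<And>b. coef r b \<in> I" "\<And>b. coef s b \<in> J"
  shows "coef (r * s) b \<in> K"
proof -
  have sum: "(\<Sum>a\<in>A. g a) \<in> K" if "finite A" "\<And>a. a \<in> A \<Longrightarrow> g a \<in> K" for A and g :: "_ \<Rightarrow> 'v"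
    using that K(1) by (induction A rule: finite_induct) (auto simp: ring_ideal_iff)
  have "r * s = (\<Sum>a | coef r a \<noteq> 0. c (coef r a) * (mon a * s))"
    by (subst expand[of r]) (simp add: sum_distrib_right mult.assoc)
  then have eq: "coef (r * s) b = (\<Sum>a | coef r a \<noteq> 0. coef r a * coef (mon a * s) b)"
    by (simp add: coef_sum coef_scale)
  have "coef r a * coef (mon a * s) b \<in> K" if "coef r a \<noteq> 0" for a
  proof (cases "\<exists>d. b = a + d")
    case True
    then show ?thesis
      using coef_mon_mult(1)[OF coef_Exps[OF that]] assms by auto
  next
    case False
    then have "coef (mon a * s) b = 0"
      using coef_mon_mult(2)[OF coef_Exps[OF that]] by blast
    then show ?thesis
      using K(1) by (simp add: ring_ideal_iff)
  qed
  then show ?thesis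
    unfolding eq using finite_coef by (intro sum) auto
qed

end

section \<open>The functional equation characterizing non-roots\<close>

text \<open>A \<open>p\<close>-adic integer is a Bernstein--Sato root of \<open>f\<close> iff this fails.\<close>
definition has_functional_eq ::
    "nat \<Rightarrow> ('v::comm_ring_1 \<Rightarrow> 'r::comm_ring_1) \<Rightarrow> 'r \<Rightarrow> (nat \<Rightarrow> int) \<Rightarrow> bool" where
  "has_functional_eq p c f \<alpha> \<longleftrightarrow>
     (\<exists>Q\<in>diff_ops c. \<exists>e. \<forall>\<nu>. int \<nu> mod int p ^ e = \<alpha> e \<longrightarrow> Q (f ^ Suc \<nu>) = f ^ \<nu>)"

lemma Zp_range: "\<alpha> \<in> Zp p \<Longrightarrow> 0 \<le> \<alpha> k" "\<alpha> \<in> Zp p \<Longrightarrow> \<alpha> k < int p ^ k"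
  by (auto simp: Zp_def)

lemma Zp_mod: "\<alpha> \<in> Zp p \<Longrightarrow> k \<le> l \<Longrightarrow> \<alpha> l mod int p ^ k = \<alpha> k"
proof (induction l)
  case 0
  then show ?case
    using Zp_range[of \<alpha> p 0] by simp
next
  case (Suc l)
  show ?case
  proof (cases "k = Suc l")
    case True
    then show ?thesis
      using Zp_range[OF Suc.prems(1), of k] by simp
  next
    case False
    with Suc.prems have kl: "k \<le> l" by simp
    have "\<alpha> (Suc l) mod int p ^ k = \<alpha> (Suc l) mod int p ^ l mod int p ^ k"
      using kl by (simp add: mod_mod_cancel le_imp_power_dvd)
    also have "\<dots> = \<alpha> k"
      using Suc kl by (simp add: Zp_def)
    finally show ?thesis .
  qed
qed

lemma Zp_cong_le:
  assumes "\<alpha> \<in> Zp p" "k \<le> l" "z mod int p ^ l = \<alpha> l"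
  shows "z mod int p ^ k = \<alpha> k"
  using Zp_mod[OF assms(1,2)] assms(2,3) by (metis le_imp_power_dvd mod_mod_cancel)

section \<open>Reduction modulo the maximal ideal and lifting back\<close>

locale reduction = artinian_local m + R: poly_ring c n x + S: poly_ring c\<^sub>0 n x\<^sub>0
  for m :: "'v::comm_ring_1 set" and c :: "'v \<Rightarrow> 'r::comm_ring_1" and n x
    and c\<^sub>0 :: "'k::field \<Rightarrow> 's::comm_ring_1" and x\<^sub>0 +
  fixes p :: nat and \<pi> :: "'v \<Rightarrow> 'k" and red :: "'r \<Rightarrow> 's"
  assumes prime: "prime p" and char_p: "of_nat p = (0 :: 'k)"
    and \<pi>: "is_ring_hom \<pi>" "surj \<pi>" "{v. \<pi> v = 0} = m"
    and red: "is_ring_hom red" "\<And>v. red (c v) = c\<^sub>0 (\<pi> v)" "\<And>i. i < n \<Longrightarrow> red (x i) = x\<^sub>0 i"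
begin

lemma in_m: "v \<in> m \<longleftrightarrow> \<pi> v = 0"
  using \<pi>(3) by auto

lemma p_nilpotent: "\<exists>N. of_nat p ^ N = (0 :: 'r)"
proof -
  have "of_nat p \<in> m"
    using char_p by (simp add: in_m is_ring_hom_of_nat[OF \<pi>(1)])
  then obtain N where N: "of_nat p ^ N = (0 :: 'v)"
    using nilpotent by blast
  have "of_nat p ^ N = c (of_nat p ^ N)"
    by (simp add: is_ring_hom_power[OF R.hom] is_ring_hom_of_nat[OF R.hom])
  with N show ?thesis
    by (auto simp: R.c_simps)
qed

definition nilpotency where "nilpotency = (SOME N. of_nat p ^ N = (0 :: 'r))"

sublocale RD: p_nilpotent_algebra c p nilpotency "x ` {..<n}"
  by unfold_locales
     (use R.hom prime someI_ex[OF p_nilpotent] R.generated_by_vars in \<open>auto simp: nilpotency_def\<close>)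

lemma char_p_s: "of_nat p = (0 :: 's)"
  using char_p is_ring_hom_of_nat[OF S.hom, of p] by (simp add: S.c_simps)

sublocale SD: p_nilpotent_algebra c\<^sub>0 p 1 "x\<^sub>0 ` {..<n}"
  by unfold_locales (use S.hom prime char_p_s S.generated_by_vars in auto)

lemma red_mon: "red (R.mon b) = S.mon b"
  unfolding R.mon_def S.mon_def
  by (simp add: is_ring_hom_prod[OF red(1)] is_ring_hom_power[OF red(1)] red(3))

lemma coef_red: "S.coef (red y) b = \<pi> (R.coef y b)"
proof -
  have fin: "finite {b. R.coef y b \<noteq> 0}" and sub: "{b. R.coef y b \<noteq> 0} \<subseteq> S.Exps"
    using R.finite_coef R.coef_Exps by (auto simp: R.Exps_def S.Exps_def)
  have "red y = (\<Sum>b | R.coef y b \<noteq> 0. c\<^sub>0 (\<pi> (R.coef y b)) * S.mon b)"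
    by (subst R.expand[of y]) (simp add: is_ring_hom_sum[OF red(1)] is_ring_homD[OF red(1)] red(2) red_mon)
  then show ?thesis
    by (auto simp: S.coef_sum_mon[OF fin sub] is_ring_hom_0[OF \<pi>(1)])
qed

lemma red_eq_0_iff: "red y = 0 \<longleftrightarrow> (\<forall>b. R.coef y b \<in> m)"
  by (metis coef_red in_m S.coef_0 S.coef_eqI)

lemma surj_red: "\<exists>y. red y = s"
proof -
  obtain g where g: "\<And>k. \<pi> (g k) = k"
    using \<pi>(2) by (metis surjD)
  have "red (\<Sum>b | S.coef s b \<noteq> 0. c (g (S.coef s b)) * R.mon b) = s"
    by (subst (3) S.expand[of s])
       (simp add: is_ring_hom_sum[OF red(1)] is_ring_homD[OF red(1)] red(2) red_mon g)
  then show ?thesis by blast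
qed

text \<open>A V-linear operator maps m R, the kernel of \<open>red\<close>, into itself.\<close>

lemma red_linear_op:
  assumes "linear_op c Q" "red y = red z"
  shows "red (Q y) = red (Q z)"
proof -
  define d where "d = y - z"
  have "red d = 0"
    using assms(2) by (simp add: d_def is_ring_hom_diff[OF red(1)])
  then have d: "R.coef d b \<in> m" for b
    by (simp add: red_eq_0_iff)
  have "red (Q d) = red (\<Sum>b | R.coef d b \<noteq> 0. c (R.coef d b) * Q (R.mon b))"
    by (subst R.expand[of d]) (simp add: linear_op_sum[OF assms(1)] linear_op_scale[OF assms(1)])
  also have "\<dots> = 0"
    using d by (simp add: is_ring_hom_sum[OF red(1)] is_ring_homD[OF red(1)] red(2) in_m S.c_simps)
  finally show ?thesis
    by (simp add: d_def linear_op_diff[OF assms(1)] is_ring_hom_diff[OF red(1)])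
qed

text \<open>The operator induced on R/mR; commutation with p^e-th powers passes to the quotient
  because all elements there lift.\<close>

lemma reduce_diff_op:
  assumes Q: "Q \<in> diff_ops c"
  shows "\<exists>Q\<^sub>0\<in>diff_ops c\<^sub>0. \<forall>y. Q\<^sub>0 (red y) = red (Q y)"
proof -
  obtain l where l: "\<And>s. red (l s) = s"
    using surj_red by metis
  define Q0 where "Q0 s = red (Q (l s))" for s
  have lin: "linear_op c Q"
    by (rule RD.diff_opD[OF Q])
  have Q0: "Q0 (red y) = red (Q y)" for y
    unfolding Q0_def by (rule red_linear_op[OF lin]) (rule l)
  obtain e where e: "\<forall>h y. Q (h ^ (p ^ e) * y) = h ^ (p ^ e) * Q y"
    using RD.diff_op_power[OF Q] by blast
  have "Q0 \<in> diff_ops c\<^sub>0"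
  proof (rule SD.diff_opI[where e = e])
    show "linear_op c\<^sub>0 Q0"
    proof (rule linear_opI)
      fix s t
      show "Q0 (s + t) = Q0 s + Q0 t"
        using Q0[of "l s + l t"]
        by (simp add: is_ring_homD[OF red(1)] l linear_op_add[OF lin] Q0_def)
    next
      fix k s
      obtain v where "\<pi> v = k" using \<pi>(2) by (metis surjD)
      then show "Q0 (c\<^sub>0 k * s) = c\<^sub>0 k * Q0 s"
        using Q0[of "c v * l s"]
        by (simp add: is_ring_homD[OF red(1)] l linear_op_scale[OF lin] Q0_def red(2))
    qed
    fix y s assume "y \<in> x\<^sub>0 ` {..<n}"
    show "Q0 (y ^ (p ^ e) * s) = y ^ (p ^ e) * Q0 s"
      using Q0[of "l y ^ (p ^ e) * l s"] e
      by (simp add: is_ring_homD[OF red(1)] is_ring_hom_power[OF red(1)] l Q0_def)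
  qed
  with Q0 show ?thesis by blast
qed

text \<open>Monomials are a basis, and x^b = (x^(b div q))^q x^(b mod q). Lifting the values freely
  at x^(b mod q) and pulling out the q-th power makes the result commute with every x_i^q, even
  where q-th powers are not closed under addition.\<close>

lemma lift_diff_op:
  assumes P0: "P\<^sub>0 \<in> diff_ops c\<^sub>0"
  shows "\<exists>P\<in>diff_ops c. \<forall>y. red (P y) = P\<^sub>0 (red y)"
proof -
  have lin: "linear_op c\<^sub>0 P\<^sub>0"
    by (rule SD.diff_opD[OF P0])
  obtain e where e: "\<forall>h y. P\<^sub>0 (h ^ (p ^ e) * y) = h ^ (p ^ e) * P\<^sub>0 y"
    using SD.diff_op_power[OF P0] by blast
  define q where "q = p ^ e"
  have q: "0 < q" using prime by (simp add: q_def prime_gt_0_nat)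
  obtain l where l: "\<And>s. red (l s) = s"
    using surj_red by metis
  define G where "G b = R.mon (div_exp q b) ^ q * l (P\<^sub>0 (S.mon (mod_exp q b)))" for b
  define P where "P = R.linear_ext G"
  have linP: "linear_op c P"
    unfolding P_def by (rule R.linear_ext)
  have "P \<in> diff_ops c"
  proof (rule RD.diff_opI[where e = e, OF linP])
    fix y z assume "y \<in> x ` {..<n}"
    then obtain i where i: "i < n" "y = R.mon (Poly_Mapping.single i 1)"
      using R.x_eq_mon by auto
    let ?a = "Poly_Mapping.single i 1 :: nat \<Rightarrow>\<^sub>0 nat"
    have a: "?a \<in> R.Exps" by (rule R.single_Exps[OF i(1)])
    have "P (y ^ q * z) = y ^ q * P z"
    proof (rule R.linear_op_eqI[of "\<lambda>z. P (y ^ q * z)" "\<lambda>z. y ^ q * P z"])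
      show "linear_op c (\<lambda>z. P (y ^ q * z))"
        by (rule linear_op_comp[OF linP linear_op_times])
      show "linear_op c (\<lambda>z. y ^ q * P z)"
        by (rule linear_op_comp[OF linear_op_times linP])
      fix b assume b: "b \<in> R.Exps"
      have "y ^ q * R.mon b = R.mon (scale_exp q ?a + b)"
        by (simp add: i R.mon_add R.mon_scale)
      then have "P (y ^ q * R.mon b) = G (scale_exp q ?a + b)"
        unfolding P_def by (simp only: R.linear_ext_mon[OF R.Exps_add[OF R.Exps_scale[OF a] b]])
      also have "\<dots> = y ^ q * G b"
        using q by (simp add: G_def div_exp_scale_add mod_exp_scale_add R.mon_add i
            power_mult_distrib mult.assoc)
      finally show "P (y ^ q * R.mon b) = y ^ q * P (R.mon b)"
        by (simp add: P_def R.linear_ext_mon[OF b])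
    qed
    then show "P (y ^ (p ^ e) * z) = y ^ (p ^ e) * P z"
      by (simp add: q_def)
  qed
  moreover have "red (P y) = P\<^sub>0 (red y)" for y
  proof (rule R.additive_eqI[of "\<lambda>y. red (P y)" "\<lambda>y. P\<^sub>0 (red y)"])
    fix v b assume b: "b \<in> R.Exps"
    have "red (P (c v * R.mon b)) = c\<^sub>0 (\<pi> v) * (S.mon (div_exp q b) ^ q * P\<^sub>0 (S.mon (mod_exp q b)))"
      unfolding linear_op_scale[OF linP] unfolding P_def R.linear_ext_mon[OF b] G_def
      by (simp add: l red(2) red_mon is_ring_homD[OF red(1)] is_ring_hom_power[OF red(1)])
    also have "S.mon (div_exp q b) ^ q * P\<^sub>0 (S.mon (mod_exp q b)) =
        P\<^sub>0 (S.mon (div_exp q b) ^ q * S.mon (mod_exp q b))"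
      using e by (simp add: q_def)
    also have "S.mon (div_exp q b) ^ q * S.mon (mod_exp q b) = S.mon b"
      by (simp add: S.mon_scale[symmetric] S.mon_add[symmetric] exp_div_mod)
    finally show "red (P (c v * R.mon b)) = P\<^sub>0 (red (c v * R.mon b))"
      by (simp add: linear_op_scale[OF lin] is_ring_homD[OF red(1)] red(2) red_mon)
  qed (simp_all add: linear_op_add[OF lin] linear_op_add[OF linP] is_ring_homD[OF red(1)])
  ultimately show ?thesis by blast
qed

text \<open>A socle element z sees residues only: z y = 0 iff y reduces to zero. So f_0 g_0 = 0
  gives f (z g) = 0, hence z g = 0 and g_0 = 0.\<close>

lemma nonzerodivisor_red:
  assumes "nonzerodivisor f"
  shows "nonzerodivisor (red f)"
  unfolding nonzerodivisor_def
proof (intro allI impI)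
  fix s assume s: "red f * s = 0"
  obtain g where g: "red g = s" using surj_red by blast
  obtain z where z: "z \<noteq> 0" "\<forall>a\<in>m. a * z = 0" using socle by blast
  have "red (f * g) = 0"
    using s g by (simp add: is_ring_homD[OF red(1)])
  then have "R.coef (c z * (f * g)) b = R.coef 0 b" for b
    using z(2) unfolding R.coef_scale R.coef_0 red_eq_0_iff by (metis mult.commute)
  then have "f * (c z * g) = 0"
    using R.coef_eqI by (metis mult.left_commute)
  then have "c z * g = 0"
    using assms by (simp add: nonzerodivisor_def)
  then have zg: "z * R.coef g b = 0" for b
    by (metis R.coef_0 R.coef_scale)
  have "R.coef g b \<in> m" for b
  proof (rule ccontr)
    assume "R.coef g b \<notin> m"
    then obtain w where "R.coef g b * w = 1" using unit by blast
    with zg[of b] z(1) show False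
      by (metis mult.assoc mult.right_neutral mult_zero_left)
  qed
  then show "s = 0"
    using g red_eq_0_iff by blast
qed

lemma has_functional_eq_red:
  assumes "has_functional_eq p c f \<alpha>"
  shows "has_functional_eq p c\<^sub>0 (red f) \<alpha>"
proof -
  obtain Q e where Q: "Q \<in> diff_ops c" "\<forall>\<nu>. int \<nu> mod int p ^ e = \<alpha> e \<longrightarrow> Q (f ^ Suc \<nu>) = f ^ \<nu>"
    using assms by (auto simp: has_functional_eq_def)
  obtain Q0 where Q0: "Q0 \<in> diff_ops c\<^sub>0" "\<forall>y. Q0 (red y) = red (Q y)"
    using reduce_diff_op[OF Q(1)] by blast
  have "Q0 (red f ^ Suc \<nu>) = red f ^ \<nu>" if "int \<nu> mod int p ^ e = \<alpha> e" for \<nu>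
    using Q(2) Q0(2) that by (metis is_ring_hom_power[OF red(1)])
  with Q0(1) show ?thesis
    unfolding has_functional_eq_def by blast
qed

text \<open>Induction along ideals: an operator solving the equation up to an error \<open>r\<close> with coefficients
  in \<open>I\<close> is corrected to one with error in \<open>m I\<close> by subtracting \<open>r P\<close>, where \<open>P\<close> solves
  \<open>P f\<^bsup>\<nu>+1\<^esup> = f\<^bsup>\<nu>-j\<^esup>\<close> modulo \<open>m\<close>.\<close>
lemma lift_functional_eq:
  assumes \<alpha>: "\<alpha> \<in> Zp p"
    and P0: "\<And>j. \<exists>P\<^sub>0\<in>diff_ops c\<^sub>0. \<exists>e. \<forall>\<nu>. j \<le> \<nu> \<and> int \<nu> mod int p ^ e = \<alpha> e \<longrightarrow>
      P\<^sub>0 (red f ^ Suc \<nu>) = red f ^ (\<nu> - j)"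
  shows "has_functional_eq p c f \<alpha>"
proof -
  define good where "good I \<longleftrightarrow> (\<exists>Q\<in>diff_ops c. \<exists>e. \<forall>\<nu>. int \<nu> mod int p ^ e = \<alpha> e \<longrightarrow>
    (\<forall>b. R.coef (Q (f ^ Suc \<nu>) - f ^ \<nu>) b \<in> I))" for I
  have "good UNIV"
    unfolding good_def using RD.diff_op_zero by blast
  then have "{I. ring_ideal I \<and> good I} \<noteq> {}"
    using ring_ideal_iff[of UNIV] by blast
  from artinian_minimal_ideal[OF artinian this]
  obtain I where I: "ring_ideal I" "good I" "\<And>J. ring_ideal J \<Longrightarrow> good J \<Longrightarrow> J \<subseteq> I \<Longrightarrow> J = I"
    by blast
  \<comment> \<open>The ideal product I m, as the least ideal containing all products.\<close>
  define J where "J = \<Inter>{K. ring_ideal K \<and> (\<forall>a\<in>I. \<forall>b\<in>m. a * b \<in> K)}"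
  have J: "ring_ideal J" "\<And>a b. a \<in> I \<Longrightarrow> b \<in> m \<Longrightarrow> a * b \<in> J"
    unfolding J_def ring_ideal_iff by auto
  have "\<forall>a\<in>I. \<forall>b\<in>m. a * b \<in> I"
    using I(1) unfolding ring_ideal_iff by (metis mult.commute)
  with I(1) have JI: "J \<subseteq> I"
    unfolding J_def by blast
  have "good J"
  proof -
    obtain Q e where Q: "Q \<in> diff_ops c"
      "\<forall>\<nu>. int \<nu> mod int p ^ e = \<alpha> e \<longrightarrow> (\<forall>b. R.coef (Q (f ^ Suc \<nu>) - f ^ \<nu>) b \<in> I)"
      using I(2) by (auto simp: good_def)
    obtain E where E: "\<forall>E'\<ge>E. \<forall>h y. Q (h ^ (p ^ E') * y) = h ^ (p ^ E') * Q y"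
      using RD.diff_op_power[OF Q(1)] by blast
    \<comment> \<open>At level \<open>e1\<close> the operator commutes with p^e1-th powers and the
      error bound applies. With \<open>j\<close> the least natural number in the residue class of
      \<alpha>, each \<nu> of the class is j + p^e1 a.\<close>
    define e1 where "e1 = max e E"
    define j where "j = nat (\<alpha> e1)"
    define r where "r = Q (f ^ Suc j) - f ^ j"
    have jmod: "int j = \<alpha> e1"
      using Zp_range(1)[OF \<alpha>] by (simp add: j_def)
    have "int j mod int p ^ e = \<alpha> e"
      using Zp_mod[OF \<alpha>, of e e1] by (simp add: jmod e1_def)
    then have r: "R.coef r b \<in> I" for b
      using Q(2) by (simp add: r_def)
    obtain P0 e2 where P0: "P0 \<in> diff_ops c\<^sub>0"
      "\<forall>\<nu>. j \<le> \<nu> \<and> int \<nu> mod int p ^ e2 = \<alpha> e2 \<longrightarrow> P0 (red f ^ Suc \<nu>) = red f ^ (\<nu> - j)"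
      using P0[of j] by blast
    obtain P where P: "P \<in> diff_ops c" "\<forall>y. red (P y) = P0 (red y)"
      using lift_diff_op[OF P0(1)] by blast
    define Q' where "Q' y = Q y + (- r) * P y" for y
    have "Q' \<in> diff_ops c"
      unfolding Q'_def by (intro RD.diff_op_plus Q(1) RD.diff_op_comp[OF RD.diff_op_times] P(1))
    moreover have "R.coef (Q' (f ^ Suc \<nu>) - f ^ \<nu>) b \<in> J"
      if \<nu>: "int \<nu> mod int p ^ (max e1 e2) = \<alpha> (max e1 e2)" for \<nu> b
    proof -
      have 1: "int \<nu> mod int p ^ e1 = \<alpha> e1" and 2: "int \<nu> mod int p ^ e2 = \<alpha> e2"
        by (rule Zp_cong_le[OF \<alpha> _ \<nu>]; simp)+
      then have "\<nu> mod p ^ e1 = j"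
        using jmod by (metis of_nat_eq_iff of_nat_mod of_nat_power)
      then obtain a where a: "\<nu> = j + p ^ e1 * a"
        by (metis add.commute mod_mult_div_eq mult.commute)
      have "Q (f ^ Suc \<nu>) = Q ((f ^ a) ^ (p ^ e1) * f ^ Suc j)"
        by (simp add: a power_add power_mult[symmetric] mult_ac)
      also have "\<dots> = (f ^ a) ^ (p ^ e1) * Q (f ^ Suc j)"
        using E by (simp add: e1_def)
      also have "(f ^ a) ^ (p ^ e1) = f ^ (\<nu> - j)"
        by (simp add: a power_mult[symmetric] mult.commute)
      finally have "Q (f ^ Suc \<nu>) = f ^ (\<nu> - j) * (f ^ j + r)"
        by (simp add: r_def)
      also have "\<dots> = f ^ \<nu> + r * f ^ (\<nu> - j)"
        using a by (simp add: distrib_right power_add mult.commute)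
      \<comment> \<open>The new error is \<open>r\<close>, with coefficients in \<open>I\<close>,
        times an element vanishing modulo \<open>m\<close>.\<close>
      finally have eq: "Q' (f ^ Suc \<nu>) - f ^ \<nu> = r * (f ^ (\<nu> - j) - P (f ^ Suc \<nu>))"
        by (simp add: Q'_def right_diff_distrib)
      have "red (f ^ (\<nu> - j) - P (f ^ Suc \<nu>)) = 0"
        using P(2) P0(2) 2 a
        by (simp add: is_ring_hom_diff[OF red(1)] is_ring_hom_power[OF red(1)] del: power_Suc)
      then have "R.coef (f ^ (\<nu> - j) - P (f ^ Suc \<nu>)) b \<in> m" for b
        by (simp add: red_eq_0_iff)
      then show ?thesis
        unfolding eq using R.coef_mult_mem[OF J r] by blast
    qed
    ultimately show ?thesis
      unfolding good_def by blast
  qed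
  with I(3) J(1) JI have IJ: "J = I" by blast
  have "I \<subseteq> {0}"
  proof (rule nakayama)
    fix d y assume y: "y \<in> I" "d * y \<noteq> 0"
    show "\<exists>a\<in>m. \<exists>z\<in>I. d * a * z \<noteq> 0"
    proof (rule ccontr)
      assume "\<not> ?thesis"
      then have "d * a * z = 0" if "a \<in> m" "z \<in> I" for a z
        using that by blast
      \<comment> \<open>The annihilator of \<open>d\<close> contains all generators of I m, hence J
        = I, against d y \<noteq> 0.\<close>
      then have "\<forall>a\<in>I. \<forall>b\<in>m. a * b \<in> {w. d * w = 0}"
      proof (intro ballI CollectI)
        fix a b assume "a \<in> I" "b \<in> m"
        then have "d * b * a = 0"
          by (intro \<open>\<And>z a. a \<in> m \<Longrightarrow> z \<in> I \<Longrightarrow> d * a * z = 0\<close>)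
        then show "d * (a * b) = 0"
          by (simp add: mult_ac)
      qed
      moreover have "ring_ideal {w. d * w = 0}"
        by (simp add: ring_ideal_iff distrib_left mult.left_commute)
      ultimately have "J \<subseteq> {w. d * w = 0}"
        unfolding J_def by blast
      with y IJ show False by blast
    qed
  qed
  obtain Q e where Q: "Q \<in> diff_ops c"
    "\<forall>\<nu>. int \<nu> mod int p ^ e = \<alpha> e \<longrightarrow> (\<forall>b. R.coef (Q (f ^ Suc \<nu>) - f ^ \<nu>) b \<in> I)"
    using I(2) by (auto simp: good_def)
  have "Q (f ^ Suc \<nu>) = f ^ \<nu>" if "int \<nu> mod int p ^ e = \<alpha> e" for \<nu>
  proof -
    have "R.coef (Q (f ^ Suc \<nu>) - f ^ \<nu>) b = R.coef 0 b" for b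
      using Q(2) that \<open>I \<subseteq> {0}\<close> by (auto simp: R.coef_0)
    then show ?thesis
      using R.coef_eqI by (metis eq_iff_diff_eq_0)
  qed
  with Q(1) show ?thesis
    unfolding has_functional_eq_def by blast
qed

end

section \<open>Cartier operators over a perfect field\<close>

lemma freshmans_dream_power:
  fixes y z :: "'a::comm_ring_1"
  assumes "prime p" "of_nat p = (0 :: 'a)"
  shows "(y + z) ^ (p ^ e) = y ^ (p ^ e) + z ^ (p ^ e)"
proof -
  have *: "(u + w) ^ p = u ^ p + w ^ p" for u w :: 'a
  proof -
    have "(u + w) ^ p = (\<Sum>i\<le>p. of_nat (p choose i) * u ^ i * w ^ (p - i))"
      by (rule binomial_ring)
    also have "\<dots> = (\<Sum>i\<in>{0, p}. of_nat (p choose i) * u ^ i * w ^ (p - i))"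
    proof (rule sum.mono_neutral_right)
      show "\<forall>i\<in>{..p} - {0, p}. of_nat (p choose i) * u ^ i * w ^ (p - i) = 0"
      proof
        fix i assume "i \<in> {..p} - {0, p}"
        then have "p dvd (p choose i)"
          using assms(1) by (intro dvd_choose_prime) auto
        then obtain d where "(p choose i) = p * d" by (elim dvdE)
        then show "of_nat (p choose i) * u ^ i * w ^ (p - i) = 0"
          by (simp add: assms(2))
      qed
    qed auto
    also have "\<dots> = u ^ p + w ^ p"
      using prime_gt_0_nat[OF assms(1)] by (simp add: add.commute)
    finally show ?thesis .
  qed
  show ?thesis
  proof (induction e)
    case (Suc e)
    have **: "u ^ (p ^ Suc e) = (u ^ (p ^ e)) ^ p" for u :: 'a
      by (simp only: power_mult[symmetric] power_Suc2)
    show ?case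
      unfolding ** Suc by (rule *)
  qed simp
qed

lemma freshmans_dream_sum:
  fixes g :: "'b \<Rightarrow> 'a::comm_ring_1"
  assumes "prime p" "of_nat p = (0 :: 'a)"
  shows "(\<Sum>i\<in>A. g i) ^ (p ^ e) = (\<Sum>i\<in>A. g i ^ (p ^ e))"
proof -
  have "(0 :: 'a) ^ (p ^ e) = 0"
    by (rule zero_power) (simp add: prime_gt_0_nat[OF assms(1)])
  then show ?thesis
    by (induction A rule: infinite_finite_induct) (simp_all add: freshmans_dream_power[OF assms])
qed

text \<open>A basis of \<open>W'\<close> and a vector of \<open>W\<close> outside its span would
  form an independent set larger than \<open>dim W\<close>; finiteness of \<open>B\<close> makes the
  cardinalities comparable.\<close>

lemma (in vector_space) subspace_eq_of_dim_le:
  assumes "finite B" "W \<subseteq> span B" "W' \<subseteq> W" "subspace W'" "dim W \<le> dim W'"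
  shows "W' = W"
proof (rule ccontr)
  assume "W' \<noteq> W"
  obtain C where C: "C \<subseteq> W'" "independent C" "W' \<subseteq> span C" "card C = dim W'"
    using basis_exists[of W'] by blast
  have "span C \<subseteq> W'"
    using C(1) assms(4) by (simp add: span_minimal)
  with C(3) \<open>W' \<noteq> W\<close> assms(3) obtain w where w: "w \<in> W" "w \<notin> span C"
    by blast
  have ind: "independent (insert w C)"
    using C(2) w(2) by (simp add: independent_insert)
  obtain D where D: "insert w C \<subseteq> D" "D \<subseteq> W" "independent D" "W \<subseteq> span D"
    using maximal_independent_subset_extend[OF _ ind, of W] w(1) C(1) assms(3) by blast
  have "finite D"
    using independent_span_bound[OF assms(1) D(3)] D(2) assms(2) by blast
  have "card C < card (insert w C)"
    using \<open>finite D\<close> D(1) w(2) by (metis card_insert_disjoint finite_insert finite_subset lessI span_base)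
  also have "\<dots> \<le> card D"
    using \<open>finite D\<close> D(1) by (rule card_mono)
  also have "card D = dim W"
    by (intro basis_card_eq_dim D)
  finally show False
    using assms(5) C(4) by simp
qed

locale perfect_poly_ring = poly_ring c n x
  for c :: "'k::field \<Rightarrow> 's::comm_ring_1" and n x +
  fixes p :: nat
  assumes prime: "prime p" and char_p: "of_nat p = (0 :: 'k)"
    and perfect: "surj (\<lambda>k :: 'k. k ^ p)"
begin

lemma char_p_s: "of_nat p = (0 :: 's)"
  using char_p is_ring_hom_of_nat[OF hom, of p] by (simp add: c_simps)

sublocale D: p_nilpotent_algebra c p 1 "x ` {..<n}"
  by unfold_locales (use hom prime char_p_s generated_by_vars in auto)

lemma p_gt_0: "0 < p"
  using prime by (rule prime_gt_0_nat)

lemma p_pos: "0 < p ^ e"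
  using p_gt_0 by simp

lemma zero_frob: "(0 :: 'a::comm_ring_1) ^ (p ^ e) = 0"
  by (rule zero_power) (rule p_pos)

lemma frob_add: "(y + z :: 's) ^ (p ^ e) = y ^ (p ^ e) + z ^ (p ^ e)"
  by (rule freshmans_dream_power[OF prime char_p_s])

lemma frob_sum: "(\<Sum>i\<in>A. g i :: 's) ^ (p ^ e) = (\<Sum>i\<in>A. g i ^ (p ^ e))"
  by (rule freshmans_dream_sum[OF prime char_p_s])

lemma bij_frob: "bij (\<lambda>k :: 'k. k ^ (p ^ e))"
proof (rule bijI)
  show "inj (\<lambda>k :: 'k. k ^ (p ^ e))"
  proof (rule injI)
    fix a b :: 'k assume "a ^ (p ^ e) = b ^ (p ^ e)"
    moreover have "((a - b) + b) ^ (p ^ e) = (a - b) ^ (p ^ e) + b ^ (p ^ e)"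
      by (rule freshmans_dream_power[OF prime char_p])
    ultimately show "a = b"
      using p_pos by simp
  qed
  show "surj (\<lambda>k :: 'k. k ^ (p ^ e))"
  proof (induction e)
    case (Suc e)
    have "(\<lambda>k :: 'k. k ^ (p ^ Suc e)) = (\<lambda>k. k ^ p) \<circ> (\<lambda>k. k ^ (p ^ e))"
      by (simp add: fun_eq_iff power_mult[symmetric] mult.commute)
    with Suc perfect show ?case
      by (metis comp_surj)
  qed auto
qed

definition rt :: "nat \<Rightarrow> 'k \<Rightarrow> 'k" where
  "rt e = inv (\<lambda>k. k ^ (p ^ e))"

lemma rt_power: "rt e k ^ (p ^ e) = k"
  unfolding rt_def using bij_is_surj[OF bij_frob] by (rule surj_f_inv_f)

lemma rt_eqI: "h ^ (p ^ e) = k \<Longrightarrow> rt e k = h"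
  unfolding rt_def using bij_is_inj[OF bij_frob] by (metis inv_f_f)

lemma rt_0: "rt e 0 = 0" and rt_1: "rt e 1 = 1"
  using p_pos by (auto intro: rt_eqI)

lemma rt_add: "rt e (h + k) = rt e h + rt e k"
  by (rule rt_eqI) (simp add: freshmans_dream_power[OF prime char_p] rt_power)

lemma rt_mult: "rt e (h * k) = rt e h * rt e k"
  by (rule rt_eqI) (simp add: power_mult_distrib rt_power)

section \<open>Coordinates over the subring of p^e-th powers\<close>

definition box :: "nat \<Rightarrow> (nat \<Rightarrow>\<^sub>0 nat) set" where
  "box d = {b \<in> Exps. \<forall>i. Poly_Mapping.lookup b i \<le> d}"

lemma finite_box: "finite (box d)"
proof -
  have "Poly_Mapping.lookup ` box d \<subseteq>
      {g. \<forall>i. (i \<in> {..<n} \<longrightarrow> g i \<in> {..d}) \<and> (i \<notin> {..<n} \<longrightarrow> g i = 0)}"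
    by (auto simp: box_def Exps_def)
  moreover have "finite {g. \<forall>i. (i \<in> {..<n} \<longrightarrow> g i \<in> {..d}) \<and> (i \<notin> {..<n} \<longrightarrow> g i = 0)}"
    by (rule finite_set_of_finite_funs) auto
  ultimately have "finite (Poly_Mapping.lookup ` box d)"
    by (rule finite_subset)
  then show ?thesis
    by (rule finite_imageD) (rule inj_onI, rule exp_eqI, simp)
qed

text \<open>Exponents of the basis monomials of the ring over its subring of \<open>p\<^sup>e\<close>-th powers.\<close>
definition reduced :: "nat \<Rightarrow> (nat \<Rightarrow>\<^sub>0 nat) set" where
  "reduced e = box (p ^ e - 1)"

lemma finite_reduced: "finite (reduced e)"
  by (simp add: reduced_def finite_box)

lemma reduced_iff: "v \<in> reduced e \<longleftrightarrow> v \<in> Exps \<and> (\<forall>i. Poly_Mapping.lookup v i < p ^ e)"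
proof -
  have "i \<le> p ^ e - 1 \<longleftrightarrow> i < p ^ e" for i
    using p_pos[of e] by linarith
  then show ?thesis
    by (simp add: reduced_def box_def)
qed

text \<open>For \<open>v\<close> in \<open>reduced e\<close> this is the p^e-th root of the
  coordinate of \<open>y\<close> at the monomial x^v, in the basis of the ring over its p^e-th
  powers; see \<open>cartier_expand\<close>. Because of the root, a factor h^(p^e) of the argument
  comes out as h.\<close>

definition cartier :: "nat \<Rightarrow> (nat \<Rightarrow>\<^sub>0 nat) \<Rightarrow> 's \<Rightarrow> 's" where
  "cartier e v y = (\<Sum>b | coef y (scale_exp (p ^ e) b + v) \<noteq> 0.
     c (rt e (coef y (scale_exp (p ^ e) b + v))) * mon b)"

lemma scale_exp_inj: "scale_exp (p ^ e) a = scale_exp (p ^ e) b \<Longrightarrow> a = b"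
proof (rule exp_eqI)
  fix i assume "scale_exp (p ^ e) a = scale_exp (p ^ e) b"
  then have "Poly_Mapping.lookup (scale_exp (p ^ e) a) i = Poly_Mapping.lookup (scale_exp (p ^ e) b) i"
    by simp
  then show "Poly_Mapping.lookup a i = Poly_Mapping.lookup b i"
    using p_gt_0 by (simp add: lookup_exp)
qed

lemma coef_cartier: "coef (cartier e v y) b = rt e (coef y (scale_exp (p ^ e) b + v))"
proof -
  let ?A = "{b. coef y (scale_exp (p ^ e) b + v) \<noteq> 0}"
  have "inj (\<lambda>b. scale_exp (p ^ e) b + v)"
    by (rule injI) (simp add: scale_exp_inj)
  then have fin: "finite ?A"
    using finite_vimageI[OF finite_coef[of y]] by (simp add: vimage_def)
  have "b \<in> Exps" if "scale_exp (p ^ e) b \<in> Exps" for b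
    using that p_pos[of e] by (auto simp: Exps_def lookup_exp)
  then have sub: "?A \<subseteq> Exps"
    using coef_Exps Exps_addD(1) by blast
  show ?thesis
    unfolding cartier_def coef_sum_mon[OF fin sub] by (auto simp: rt_0)
qed

lemma cartier_add: "cartier e v (y + z) = cartier e v y + cartier e v z"
  by (rule coef_eqI) (simp add: coef_cartier coef_add rt_add)

lemma cartier_sum: "cartier e v (\<Sum>i\<in>A. g i) = (\<Sum>i\<in>A. cartier e v (g i))"
proof -
  have "cartier e v 0 = 0"
    using cartier_add[of e v 0 0] by simp
  then show ?thesis
    by (induction A rule: infinite_finite_induct) (auto simp: cartier_add)
qed

text \<open>Both sides are additive in \<open>h\<close>, as Frobenius is, so monomials suffice;
  there both sides shift exponents.\<close>

lemma cartier_power_mult: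
  assumes v: "v \<in> reduced e"
  shows "cartier e v (h ^ (p ^ e) * y) = h * cartier e v y"
proof (rule additive_eqI[of "\<lambda>h. cartier e v (h ^ (p ^ e) * y)" "\<lambda>h. h * cartier e v y"])
  show "cartier e v ((g + h) ^ (p ^ e) * y) =
      cartier e v (g ^ (p ^ e) * y) + cartier e v (h ^ (p ^ e) * y)" for g h
    by (simp add: frob_add distrib_right cartier_add)
  show "(g + h) * cartier e v y = g * cartier e v y + h * cartier e v y" for g h
    by (rule distrib_right)
next
  fix k a assume a: "a \<in> Exps"
  show "cartier e v ((c k * mon a) ^ (p ^ e) * y) = c k * mon a * cartier e v y"
  proof (rule coef_eqI)
    fix b assume "b \<in> Exps"
    have eq: "(c k * mon a) ^ (p ^ e) * y = c (k ^ (p ^ e)) * (mon (scale_exp (p ^ e) a) * y)"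
      by (simp add: power_mult_distrib is_ring_hom_power[OF hom] mon_scale mult.assoc)
    have L: "coef (cartier e v ((c k * mon a) ^ (p ^ e) * y)) b =
        k * rt e (coef (mon (scale_exp (p ^ e) a) * y) (scale_exp (p ^ e) b + v))"
      unfolding coef_cartier eq coef_scale rt_mult by (simp add: rt_eqI)
    have R: "coef (c k * mon a * cartier e v y) b = k * coef (mon a * cartier e v y) b"
      by (simp add: mult.assoc coef_scale)
    show "coef (cartier e v ((c k * mon a) ^ (p ^ e) * y)) b = coef (c k * mon a * cartier e v y) b"
    proof (cases "\<exists>b'. b = a + b'")
      case True
      then obtain b' where b': "b = a + b'" by blast
      have "scale_exp (p ^ e) b + v = scale_exp (p ^ e) a + (scale_exp (p ^ e) b' + v)"
        by (simp add: b' scale_exp_add add.assoc)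
      then show ?thesis
        unfolding L R by (simp add: b' coef_mon_mult(1) a Exps_scale coef_cartier)
    next
      case False
      have "\<exists>i. Poly_Mapping.lookup b i < Poly_Mapping.lookup a i"
      proof (rule ccontr)
        assume "\<not> ?thesis"
        then have "b = a + (b - a)"
          by (intro exp_eqI) (simp add: lookup_add lookup_minus not_less)
        with False show False by blast
      qed
      then obtain i where i: "Poly_Mapping.lookup b i < Poly_Mapping.lookup a i" by blast
      \<comment> \<open>With q = p^e, equality would force q b_i + v_i >= q a_i >= q (b_i + 1),
        impossible because v_i < q for reduced \<open>v\<close>.\<close>
      have "scale_exp (p ^ e) b + v \<noteq> scale_exp (p ^ e) a + d" for d
      proof
        assume "scale_exp (p ^ e) b + v = scale_exp (p ^ e) a + d"
        then have "p ^ e * Poly_Mapping.lookup b i + Poly_Mapping.lookup v i =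
            p ^ e * Poly_Mapping.lookup a i + Poly_Mapping.lookup d i"
          by (metis lookup_add lookup_scale_exp)
        moreover have "p ^ e * Suc (Poly_Mapping.lookup b i) \<le> p ^ e * Poly_Mapping.lookup a i"
          using i by (intro mult_le_mono2) simp
        moreover have "Poly_Mapping.lookup v i < p ^ e"
          using v by (simp add: reduced_iff)
        ultimately show False by simp
      qed
      then have "coef (mon (scale_exp (p ^ e) a) * y) (scale_exp (p ^ e) b + v) = 0"
        by (intro coef_mon_mult(2) Exps_scale a)
      moreover have "coef (mon a * cartier e v y) b = 0"
        using False by (intro coef_mon_mult(2) a) blast
      ultimately show ?thesis
        unfolding L R by (simp add: rt_0)
    qed
  qed
qed

lemma cartier_mon:
  assumes "u \<in> reduced e" "v \<in> reduced e"
  shows "cartier e v (mon u) = (if u = v then 1 else 0)"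
proof (rule coef_eqI)
  fix b
  have u: "u \<in> Exps" using assms by (simp add: reduced_iff)
  have "scale_exp (p ^ e) b + v = u \<longleftrightarrow> b = 0 \<and> u = v"
  proof
    assume eq: "scale_exp (p ^ e) b + v = u"
    have "Poly_Mapping.lookup b i = 0" for i
    proof (rule ccontr)
      assume "Poly_Mapping.lookup b i \<noteq> 0"
      then have "p ^ e * 1 \<le> p ^ e * Poly_Mapping.lookup b i"
        by (intro mult_le_mono2) simp
      also have "\<dots> \<le> Poly_Mapping.lookup u i"
        unfolding eq[symmetric] by (simp add: lookup_exp)
      finally show False
        using assms(1) by (auto simp: reduced_iff not_le[symmetric])
    qed
    then have b: "b = 0" by (intro exp_eqI) simp
    have "scale_exp (p ^ e) 0 = 0" by (rule exp_eqI) (simp add: lookup_exp)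
    with eq b show "b = 0 \<and> u = v" by simp
  next
    assume "b = 0 \<and> u = v"
    moreover have "scale_exp (p ^ e) 0 = 0" by (rule exp_eqI) (simp add: lookup_exp)
    ultimately show "scale_exp (p ^ e) b + v = u" by simp
  qed
  then show "coef (cartier e v (mon u)) b = coef (if u = v then 1 else 0) b"
    using coef_mon[OF Exps_0, of b]
    by (auto simp: coef_cartier coef_mon u rt_0 rt_1 coef_0 mon_0)
qed

text \<open>A monomial x^b has one nonzero coordinate, at b mod p^e; perfectness supplies the root
  of its scalar.\<close>

lemma cartier_expand: "y = (\<Sum>v\<in>reduced e. cartier e v y ^ (p ^ e) * mon v)"
proof (rule additive_eqI[of "\<lambda>y. y" "\<lambda>y. \<Sum>v\<in>reduced e. cartier e v y ^ (p ^ e) * mon v"])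
  show "(\<Sum>v\<in>reduced e. cartier e v (y + z) ^ (p ^ e) * mon v) =
      (\<Sum>v\<in>reduced e. cartier e v y ^ (p ^ e) * mon v) +
      (\<Sum>v\<in>reduced e. cartier e v z ^ (p ^ e) * mon v)" for y z
    by (simp add: cartier_add frob_add distrib_right sum.distrib)
next
  fix k b assume b: "b \<in> Exps"
  let ?u = "mod_exp (p ^ e) b" and ?h = "c (rt e k) * mon (div_exp (p ^ e) b)"
  have u: "?u \<in> reduced e"
    using b p_pos[of e] by (simp add: reduced_iff Exps_mod lookup_exp)
  have eq: "c k * mon b = ?h ^ (p ^ e) * mon ?u"
    by (simp add: power_mult_distrib is_ring_hom_power[OF hom, symmetric] rt_power mon_scale[symmetric]
        mult.assoc mon_add[symmetric] exp_div_mod)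
  have "cartier e v (c k * mon b) ^ (p ^ e) * mon v = (if v = ?u then c k * mon b else 0)"
    if v: "v \<in> reduced e" for v
    unfolding eq cartier_power_mult[OF v] cartier_mon[OF u v] by (auto simp: zero_frob)
  then have "(\<Sum>v\<in>reduced e. cartier e v (c k * mon b) ^ (p ^ e) * mon v) =
      (\<Sum>v\<in>reduced e. if v = ?u then c k * mon b else 0)"
    by (intro sum.cong) auto
  then show "c k * mon b = (\<Sum>v\<in>reduced e. cartier e v (c k * mon b) ^ (p ^ e) * mon v)"
    using u by (simp add: finite_reduced)
qed simp

text \<open>Often written I_e(y): the smallest ideal whose p^e-th Frobenius power contains
  \<open>y\<close>.\<close>

definition cartier_ideal :: "nat \<Rightarrow> 's \<Rightarrow> 's set" where
  "cartier_ideal e y = {\<Sum>v\<in>reduced e. b v * cartier e v y | b. True}"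

lemma cartier_ideal_memI: "(\<Sum>v\<in>reduced e. b v * cartier e v y) \<in> cartier_ideal e y"
  unfolding cartier_ideal_def by blast

lemma cartier_in_ideal: "v \<in> reduced e \<Longrightarrow> cartier e v y \<in> cartier_ideal e y"
  using cartier_ideal_memI[where b = "\<lambda>u. if u = v then 1 else 0" and e = e and y = y]
  by (simp add: if_distrib[of "\<lambda>z. z * _"] finite_reduced cong: if_cong)

lemma ring_ideal_cartier: "ring_ideal (cartier_ideal e y)"
  unfolding ring_ideal_iff
proof (intro conjI ballI allI)
  show "0 \<in> cartier_ideal e y"
    using cartier_ideal_memI[of "\<lambda>_. 0"] by simp
next
  fix g h assume "g \<in> cartier_ideal e y" "h \<in> cartier_ideal e y"
  then obtain a b where "g = (\<Sum>v\<in>reduced e. a v * cartier e v y)" "h = (\<Sum>v\<in>reduced e. b v * cartier e v y)"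
    unfolding cartier_ideal_def by blast
  then have "g + h = (\<Sum>v\<in>reduced e. (a v + b v) * cartier e v y)"
    by (simp add: distrib_right sum.distrib)
  then show "g + h \<in> cartier_ideal e y"
    using cartier_ideal_memI by metis
next
  fix r g assume "g \<in> cartier_ideal e y"
  then obtain a where "g = (\<Sum>v\<in>reduced e. a v * cartier e v y)"
    unfolding cartier_ideal_def by blast
  then have "r * g = (\<Sum>v\<in>reduced e. (r * a v) * cartier e v y)"
    by (simp add: sum_distrib_left mult.assoc)
  then show "r * g \<in> cartier_ideal e y"
    using cartier_ideal_memI by metis
qed

lemma cartier_ideal_least:
  assumes "ring_ideal I" "\<And>v. v \<in> reduced e \<Longrightarrow> cartier e v y \<in> I"
  shows "cartier_ideal e y \<subseteq> I"
proof
  fix z assume "z \<in> cartier_ideal e y"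
  then obtain b where z: "z = (\<Sum>v\<in>reduced e. b v * cartier e v y)"
    unfolding cartier_ideal_def by blast
  have "(\<Sum>v\<in>A. b v * cartier e v y) \<in> I" if "finite A" "A \<subseteq> reduced e" for A
    using that assms by (induction A rule: finite_induct) (auto simp: ring_ideal_iff)
  then show "z \<in> I"
    unfolding z using finite_reduced by blast
qed

text \<open>Raising the expansion of \<open>y\<close> at level \<open>e\<close> to the power p^e'
  produces p^(e+e')-th powers of its coordinates, and these come out of
  \<open>cartier (e + e') u\<close> as the coordinates themselves.\<close>

lemma cartier_in_lower_ideal:
  assumes u: "u \<in> reduced (e + e')"
  shows "cartier (e + e') u (y ^ (p ^ e') * h) \<in> cartier_ideal e y"
proof -
  have "y ^ (p ^ e') * h = (\<Sum>v\<in>reduced e. cartier e v y ^ (p ^ (e + e')) * (mon v ^ (p ^ e') * h))"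
    by (subst cartier_expand[of y e])
       (simp add: frob_sum power_mult_distrib power_mult[symmetric] power_add sum_distrib_right mult.assoc
        del: power_mult)
  then have "cartier (e + e') u (y ^ (p ^ e') * h) =
      (\<Sum>v\<in>reduced e. cartier (e + e') u (cartier e v y ^ (p ^ (e + e')) * (mon v ^ (p ^ e') * h)))"
    by (simp only: cartier_sum)
  also have "\<dots> = (\<Sum>v\<in>reduced e. cartier (e + e') u (mon v ^ (p ^ e') * h) * cartier e v y)"
    unfolding cartier_power_mult[OF u] by (rule sum.cong) (simp_all only: mult.commute)
  finally show ?thesis
    by (simp only: cartier_ideal_memI)
qed

text \<open>The Morita correspondence: the submodule generated by \<open>y\<close> over the operators linear over
  \<open>p\<^sup>e\<close>-th powers is determined by the ideal of Cartier coordinates of \<open>y\<close>.\<close>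
lemma diff_op_of_cartier_ideal:
  assumes "\<And>u. u \<in> reduced e \<Longrightarrow> cartier e u z \<in> cartier_ideal e y"
  shows "\<exists>P\<in>diff_ops c. (\<forall>h w. P (h ^ (p ^ e) * w) = h ^ (p ^ e) * P w) \<and> P y = z"
proof -
  have "\<forall>u\<in>reduced e. \<exists>b. cartier e u z = (\<Sum>v\<in>reduced e. b v * cartier e v y)"
    using assms unfolding cartier_ideal_def by blast
  then obtain b where b: "\<And>u. u \<in> reduced e \<Longrightarrow> cartier e u z = (\<Sum>v\<in>reduced e. b u v * cartier e v y)"
    by metis
  \<comment> \<open>Apply to the coordinates the matrix \<open>b\<close> carrying those of
    \<open>y\<close> to those of \<open>z\<close>.\<close>
  define P where "P w = (\<Sum>u\<in>reduced e. (\<Sum>v\<in>reduced e. b u v * cartier e v w) ^ (p ^ e) * mon u)" for w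
  have comm: "P (h ^ (p ^ e) * w) = h ^ (p ^ e) * P w" for h w
  proof -
    have "(\<Sum>v\<in>reduced e. b u v * cartier e v (h ^ (p ^ e) * w)) = h * (\<Sum>v\<in>reduced e. b u v * cartier e v w)" for u
      unfolding sum_distrib_left
      by (rule sum.cong) (simp_all add: cartier_power_mult mult.left_commute)
    then show ?thesis
      by (simp only: P_def power_mult_distrib mult.assoc sum_distrib_left[symmetric])
  qed
  have "linear_op c P"
  proof (rule linear_opI)
    show "P (w + w') = P w + P w'" for w w'
      by (simp add: P_def cartier_add distrib_left sum.distrib frob_add distrib_right)
    \<comment> \<open>Scalars are p^e-th powers of scalars, so this is a case of
      \<open>comm\<close>.\<close>
    show "P (c k * w) = c k * P w" for k w
      using comm[of "c (rt e k)" w] by (simp add: is_ring_hom_power[OF hom, symmetric] rt_power)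
  qed
  then have "P \<in> diff_ops c"
    by (rule D.diff_opI[where e = e]) (rule comm)
  moreover have "P y = z"
    by (rule trans[OF _ cartier_expand[of z e, symmetric]]) (simp add: P_def b)
  ultimately show ?thesis
    using comm by blast
qed

section \<open>Degree bounds and stabilization of ideals\<close>

definition bounded :: "nat \<Rightarrow> 's set" where
  "bounded d = {y. \<forall>b. coef y b \<noteq> 0 \<longrightarrow> b \<in> box d}"

lemma bounded_ex: "\<exists>d. y \<in> bounded d"
proof -
  let ?d = "\<Sum>b | coef y b \<noteq> 0. \<Sum>i<n. Poly_Mapping.lookup b i"
  have "Poly_Mapping.lookup b i \<le> ?d" if b: "coef y b \<noteq> 0" for b i
  proof (cases "i < n")
    case True
    then have "Poly_Mapping.lookup b i \<le> (\<Sum>i<n. Poly_Mapping.lookup b i)"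
      by (intro member_le_sum) auto
    also have "\<dots> \<le> ?d"
      using b finite_coef[of y] by (intro member_le_sum) auto
    finally show ?thesis .
  next
    case False
    then show ?thesis
      using coef_Exps[OF b] by (simp add: Exps_def)
  qed
  then show ?thesis
    unfolding bounded_def box_def using coef_Exps by blast
qed

lemma bounded_mult:
  assumes "y \<in> bounded d" "z \<in> bounded d'"
  shows "y * z \<in> bounded (d + d')"
proof -
  have eq: "coef (y * z) b = (\<Sum>a | coef y a \<noteq> 0. coef y a * coef (mon a * z) b)" for b
    by (subst expand[of y]) (simp add: sum_distrib_right mult.assoc coef_sum coef_scale)
  have "b \<in> box (d + d')" if b: "coef (y * z) b \<noteq> 0" for b
  proof -
    obtain a where a: "coef y a \<noteq> 0" "coef (mon a * z) b \<noteq> 0"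
    proof (rule ccontr)
      assume no: "\<not> thesis"
      have "coef y a * coef (mon a * z) b = 0" if "coef y a \<noteq> 0" for a
        using that no \<open>\<And>a. coef y a \<noteq> 0 \<Longrightarrow> coef (mon a * z) b \<noteq> 0 \<Longrightarrow> thesis\<close> by auto
      then have "coef (y * z) b = 0"
        unfolding eq by (intro sum.neutral) simp
      with b show False by simp
    qed
    then obtain a' where a': "b = a + a'"
      using coef_mon_mult(2)[OF coef_Exps[OF a(1)]] by blast
    then have "coef z a' \<noteq> 0"
      using a coef_mon_mult(1)[OF coef_Exps[OF a(1)]] by simp
    then have "a \<in> box d" "a' \<in> box d'"
      using a(1) assms by (auto simp: bounded_def)
    then show ?thesis
      by (auto simp: box_def a' lookup_add Exps_add add_mono)
  qed
  then show ?thesis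
    by (simp add: bounded_def)
qed

lemma bounded_power: "y \<in> bounded d \<Longrightarrow> y ^ N \<in> bounded (N * d)"
proof (induction N)
  case 0
  have "(1 :: 's) \<in> bounded 0"
    using coef_mon[OF Exps_0] by (auto simp: bounded_def mon_0 box_def Exps_0 split: if_splits)
  then show ?case by simp
next
  case (Suc N)
  then show ?case
    using bounded_mult[of y d "y ^ N" "N * d"] by simp
qed

text \<open>Passing to coordinates divides the degree in each variable by p^e. This keeps generators
  of all the ideals in one finite-dimensional space.\<close>

lemma bounded_cartier:
  assumes "y \<in> bounded (d * p ^ e)"
  shows "cartier e v y \<in> bounded d"
proof -
  have "b \<in> box d" if "coef (cartier e v y) b \<noteq> 0" for b
  proof -
    have "coef y (scale_exp (p ^ e) b + v) \<noteq> 0"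
      using that by (auto simp: coef_cartier rt_0)
    then have *: "scale_exp (p ^ e) b + v \<in> box (d * p ^ e)"
      using assms by (simp add: bounded_def)
    have "Poly_Mapping.lookup b i \<le> d" for i
    proof -
      have "p ^ e * Poly_Mapping.lookup b i + Poly_Mapping.lookup v i \<le> d * p ^ e"
        using * by (simp add: box_def lookup_exp)
      then have "p ^ e * Poly_Mapping.lookup b i \<le> d * p ^ e"
        by (rule add_leD1)
      then show ?thesis
        using p_gt_0 by (simp add: mult.commute)
    qed
    with coef_Exps[OF that] show ?thesis
      by (simp add: box_def)
  qed
  then show ?thesis
    by (simp add: bounded_def)
qed

text \<open>The usual argument showing that \<open>F\<close>-jumping numbers do not accumulate.\<close>
lemma descending_ideals_stabilize:
  fixes I :: "nat \<Rightarrow> 's set"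
  assumes I: "\<And>e. ring_ideal (I e)" and dec: "\<And>e t. I (e + t) \<subseteq> I e"
    and gen: "\<And>e J. ring_ideal J \<Longrightarrow> I e \<inter> bounded d \<subseteq> J \<Longrightarrow> I e \<subseteq> J"
  shows "\<exists>e. \<forall>t. I (e + t) = I e"
proof -
  interpret V: vector_space "\<lambda>k y. c k * y"
    by unfold_locales (auto simp: c_simps algebra_simps)
  define W where "W e = I e \<inter> bounded d" for e
  have sub: "V.subspace (W e)" for e
    unfolding V.subspace_def
  proof (intro conjI ballI allI)
    show "0 \<in> W e"
      using I[of e] by (simp add: W_def ring_ideal_iff bounded_def coef_0)
    show "y + z \<in> W e" if "y \<in> W e" "z \<in> W e" for y z
    proof -
      have "coef y b \<noteq> 0 \<or> coef z b \<noteq> 0" if "coef (y + z) b \<noteq> 0" for b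
        using that by (auto simp: coef_add)
      with that show ?thesis
        using I[of e] unfolding W_def ring_ideal_iff bounded_def by blast
    qed
    show "c k * y \<in> W e" if "y \<in> W e" for k y
      using that I[of e] by (auto simp: W_def ring_ideal_iff bounded_def coef_scale)
  qed
  have span: "W e \<subseteq> V.span (mon ` box d)" for e
  proof
    fix y assume "y \<in> W e"
    then have "{b. coef y b \<noteq> 0} \<subseteq> box d"
      by (auto simp: W_def bounded_def)
    then have y: "y = (\<Sum>b\<in>box d. c (coef y b) * mon b)"
      by (intro expand_supset finite_box)
    show "y \<in> V.span (mon ` box d)"
      by (subst y) (intro V.span_sum V.span_scale V.span_base imageI)
  qed
  \<comment> \<open>Each ideal is generated by its part in a fixed finite-dimensional space, so the
    chain is stationary from a level of least dimension on.\<close>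
  obtain e where e: "\<And>e'. V.dim (W e) \<le> V.dim (W e')"
    using ex_has_least_nat[of "\<lambda>_. True" 0 "\<lambda>e. V.dim (W e)"] by auto
  have "I (e + t) = I e" for t
  proof
    have "W (e + t) = W e"
    proof (rule V.subspace_eq_of_dim_le[OF _ span])
      show "finite (mon ` box d)"
        by (simp add: finite_box)
      show "W (e + t) \<subseteq> W e"
        using dec[of e t] by (auto simp: W_def)
    qed (use sub e in auto)
    then have "I e \<inter> bounded d \<subseteq> I (e + t)"
      by (auto simp: W_def)
    then show "I e \<subseteq> I (e + t)"
      by (rule gen[OF I])
  qed (rule dec)
  then show ?thesis by blast
qed

text \<open>The sequence \<open>N\<close> below is the sequence of truncations \<open>a (p\<^bsup>ke\<^esup> - 1) / (p\<^sup>k - 1)\<close> of the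
  negative rational \<open>-a / (p\<^sup>k - 1)\<close>. Negativity enters through \<open>a > 0\<close>, which makes \<open>N\<close> unbounded.\<close>
lemma left_continuity:
  assumes f: "nonzerodivisor f" and a: "0 < a"
    and N: "N 0 = 0" "\<And>e. N (Suc e) = p ^ k * N e + a"
    and k: "0 < k"
    and \<alpha>: "\<And>e. int (N e) mod int p ^ (k * e) = \<alpha> (k * e)"
  shows "\<exists>P\<in>diff_ops c. \<exists>E. \<forall>\<nu>. j \<le> \<nu> \<and> int \<nu> mod int p ^ E = \<alpha> E \<longrightarrow> P (f ^ \<nu>) = f ^ (\<nu> - j)"
proof -
  have N_add: "N (e + t) = p ^ (k * t) * N e + N t" for e t
    by (induction t) (simp_all add: N algebra_simps power_add)
  have N_ge: "t \<le> N t" for t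
  proof (induction t)
    case (Suc t)
    have "1 * N t \<le> p ^ k * N t"
      by (intro mult_le_mono1) (simp add: Suc_le_eq p_gt_0)
    with Suc a show ?case
      unfolding N by linarith
  qed (simp add: N)
  \<comment> \<open>With f of degree at most d in each variable, f^(N e) has degree at most a d p^(k
    e), so its coordinates have degree at most a d for every e.\<close>
  have N_le: "N e \<le> a * p ^ (k * e)" for e
  proof -
    have "2 \<le> p ^ k"
      using prime_ge_2_nat[OF prime] self_le_power[OF _ k, of p] p_gt_0 by linarith
    then have "2 * a \<le> p ^ k * a"
      by (rule mult_le_mono1)
    have "N e + a \<le> a * p ^ (k * e)"
    proof (induction e)
      case (Suc e)
      have "N (Suc e) + a = p ^ k * N e + 2 * a"
        by (simp add: N)
      also have "\<dots> \<le> p ^ k * (N e + a)"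
        using \<open>2 * a \<le> p ^ k * a\<close> unfolding distrib_left by linarith
      also have "\<dots> \<le> p ^ k * (a * p ^ (k * e))"
        using Suc by (rule mult_le_mono2)
      finally show ?case
        by (simp add: power_add mult_ac)
    qed (simp add: N)
    then show ?thesis
      by simp
  qed
  obtain d where d: "f \<in> bounded d"
    using bounded_ex by blast
  define I where "I e = cartier_ideal (k * e) (f ^ N e)" for e
  \<comment> \<open>Here f^(p^(k t) N e) is the p^(k t)-th power of f^(N e), so
    \<open>cartier_in_lower_ideal\<close> applies to all its multiples.\<close>
  have lower: "cartier (k * (e + t)) u (f ^ (p ^ (k * t) * N e) * h) \<in> I e"
    if "u \<in> reduced (k * (e + t))" for e t u h
    using cartier_in_lower_ideal[of u "k * e" "k * t" "f ^ N e" h] that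
    by (simp add: I_def power_mult[symmetric] distrib_left mult.commute[of "N e"])
  have dec: "I (e + t) \<subseteq> I e" for e t
    unfolding I_def[of "e + t"]
  proof (rule cartier_ideal_least)
    show "ring_ideal (I e)"
      by (simp add: I_def ring_ideal_cartier)
    show "cartier (k * (e + t)) v (f ^ N (e + t)) \<in> I e" if "v \<in> reduced (k * (e + t))" for v
      using lower[OF that, of "f ^ N t"] by (simp add: N_add power_add)
  qed
  have "\<exists>e. \<forall>t. I (e + t) = I e"
  proof (rule descending_ideals_stabilize[where d = "a * d", OF _ dec])
    show "ring_ideal (I e)" for e
      by (simp add: I_def ring_ideal_cartier)
    fix e J assume J: "ring_ideal J" "I e \<inter> bounded (a * d) \<subseteq> J"
    have "f ^ N e \<in> bounded (N e * d)"
      by (rule bounded_power[OF d])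
    moreover have "N e * d \<le> a * d * p ^ (k * e)"
      using mult_le_mono1[OF N_le[of e], of d] by (simp add: mult_ac)
    ultimately have "f ^ N e \<in> bounded (a * d * p ^ (k * e))"
      unfolding bounded_def box_def by (blast intro: order_trans)
    then have "cartier (k * e) v (f ^ N e) \<in> bounded (a * d)" for v
      by (rule bounded_cartier)
    with J show "I e \<subseteq> J"
      unfolding I_def by (intro cartier_ideal_least) (auto intro: cartier_in_ideal)
  qed
  then obtain e where e: "\<And>t. I (e + t) = I e" by blast
  \<comment> \<open>By \<open>N_add\<close> and N j >= j, the exponent M - j is still at least p^(k
    j) N e. Hence \<open>lower\<close> puts the coordinates of f^(M-j) into I e = I (e + j), the
    ideal of f^M at the same level.\<close>
  define M where "M = N (e + j)"
  define E where "E = k * (e + j)"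
  have M: "j \<le> M" "M - j = p ^ (k * j) * N e + (N j - j)"
    using N_ge[of j] by (simp_all add: M_def N_add)
  have "cartier E u (f ^ (M - j)) \<in> cartier_ideal E (f ^ M)" if "u \<in> reduced E" for u
    using lower[of u e j "f ^ (N j - j)"] that e[of j]
    by (simp add: E_def M(2) power_add) (simp add: I_def M_def)
  then obtain P where P: "P \<in> diff_ops c" "\<forall>h w. P (h ^ (p ^ E) * w) = h ^ (p ^ E) * P w"
    "P (f ^ M) = f ^ (M - j)"
    using diff_op_of_cartier_ideal by blast
  \<comment> \<open>Spreads the equation from \<open>M\<close> over its residue class modulo p^E:
    upwards by multiplying, downwards by cancelling a power of the nonzerodivisor f.\<close>
  have shift: "P (f ^ (i + p ^ E * b)) = f ^ (p ^ E * b) * P (f ^ i)" for i b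
    using P(2)[rule_format, of "f ^ b" "f ^ i"]
    by (simp add: power_add power_mult[symmetric] mult.commute)
  have nzd: "nonzerodivisor (f ^ i)" for i
    by (induction i) (auto simp: nonzerodivisor_1 nonzerodivisor_mult f)
  have "P (f ^ \<nu>) = f ^ (\<nu> - j)" if \<nu>: "j \<le> \<nu>" "int \<nu> mod int p ^ E = \<alpha> E" for \<nu>
  proof -
    have "int \<nu> mod int p ^ E = int M mod int p ^ E"
      using \<nu>(2) \<alpha>[of "e + j"] by (simp add: M_def E_def)
    then have cong: "\<nu> mod p ^ E = M mod p ^ E"
      by (metis of_nat_eq_iff of_nat_mod of_nat_power)
    show ?thesis
    proof (cases "M \<le> \<nu>")
      case True
      then have "p ^ E dvd \<nu> - M"
        using cong by (metis mod_eq_dvd_iff_nat)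
      then obtain b where "\<nu> - M = p ^ E * b" by (elim dvdE)
      with True have b: "\<nu> = M + p ^ E * b" by simp
      have "f ^ (p ^ E * b) * f ^ (M - j) = f ^ (\<nu> - j)"
        using M(1) by (simp add: b power_add[symmetric] add.commute)
      with shift[of M b] show ?thesis by (simp add: b P(3))
    next
      case False
      then have "p ^ E dvd M - \<nu>"
        using cong by (metis mod_eq_dvd_iff_nat nat_le_linear)
      then obtain b where "M - \<nu> = p ^ E * b" by (elim dvdE)
      with False have b: "M = \<nu> + p ^ E * b" by simp
      have "f ^ (p ^ E * b) * P (f ^ \<nu>) = f ^ (p ^ E * b) * f ^ (\<nu> - j)"
        using \<nu>(1) P(3) shift[of \<nu> b] by (simp add: b power_add[symmetric] add.commute)
      then show ?thesis
        by (rule nonzerodivisor_cancel[OF nzd])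
    qed
  qed
  with P(1) show ?thesis by blast
qed

end

section \<open>Operators on \<open>R[t]\<close>\<close>

definition graded_op :: "(nat \<Rightarrow> 'r \<Rightarrow> 'r) \<Rightarrow> 'r::comm_ring_1 poly \<Rightarrow> 'r poly" where
  "graded_op P y = (\<Sum>a\<le>degree y. monom (P a (coeff y a)) a)"

definition component :: "('r::comm_ring_1 poly \<Rightarrow> 'r poly) \<Rightarrow> nat \<Rightarrow> 'r \<Rightarrow> 'r" where
  "component P a r = coeff (P (monom r a)) a"

text \<open>The sum defining \<open>graded_op\<close> stops at the degree of \<open>y\<close>; the
  condition on \<open>P a 0\<close> gives the right coefficients beyond it.\<close>

lemma coeff_graded_op:
  assumes "\<And>a. P a 0 = 0"
  shows "coeff (graded_op P y) a = P a (coeff y a)"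
proof -
  have "coeff (graded_op P y) a = (\<Sum>b\<le>degree y. if b = a then P a (coeff y a) else 0)"
    by (auto simp: graded_op_def coeff_sum intro!: sum.cong)
  then show ?thesis
    using assms by (auto simp: coeff_eq_0 not_le)
qed

lemma graded_op_monom: "(\<And>a. P a 0 = 0) \<Longrightarrow> graded_op P (monom r a) = monom (P a r) a"
  by (rule poly_eqI) (auto simp: coeff_graded_op)

lemma component_graded_op: "(\<And>a. P a 0 = 0) \<Longrightarrow> component (graded_op P) a r = P a r"
  by (simp add: component_def graded_op_monom)

lemma coeff_const_mult: "coeff ([:h:] * y) a = h * coeff y a"
  by simp

lemma const_power: "[:h:] ^ k = [:h ^ k:]" for h :: "'a::comm_ring_1"
  by (induction k) (auto simp: one_pCons mult.commute)

lemma t_power: "[:0, 1:] ^ k = monom 1 k" for k :: nat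
  by (simp add: monom_altdef)

locale poly_ring_p = poly_ring c n x
  for c :: "'v::comm_ring_1 \<Rightarrow> 'r::comm_ring_1" and n x +
  fixes p N :: nat
  assumes prime: "prime p" and nilpotent: "of_nat p ^ N = (0 :: 'r)"
begin

sublocale RD: p_nilpotent_algebra c p N "x ` {..<n}"
  by unfold_locales (use hom prime nilpotent generated_by_vars in auto)

lemma p_gt_0: "0 < p"
  using prime by (rule prime_gt_0_nat)

lemma hom_poly: "is_ring_hom (\<lambda>v. [:c v:])"
  by (simp add: is_ring_hom_def c_simps one_pCons)

lemma generates_poly: "generates (\<lambda>v. [:c v:]) (insert [:0, 1:] ((\<lambda>i. [:x i:]) ` {..<n}))"
  unfolding generates_def
proof (intro allI impI, elim conjE)
  fix T assume T: "range (\<lambda>v. [:c v:]) \<subseteq> T" "insert [:0, 1:] ((\<lambda>i. [:x i:]) ` {..<n}) \<subseteq> T"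
    "\<forall>a\<in>T. \<forall>b\<in>T. a + b \<in> T \<and> a * b \<in> T"
  have const: "[:r:] \<in> T" for r
    using generated_by_vars
  proof (induction r rule: generates_induct)
    case (add a b)
    then have "[:a:] + [:b:] \<in> T" using T(3) by blast
    then show ?case by simp
  next
    case (mult a b)
    then have "[:a:] * [:b:] \<in> T" using T(3) by blast
    then show ?case by (simp add: mult.commute)
  qed (use T in auto)
  have "y \<in> T" for y
  proof (induction y)
    case 0
    show ?case using const[of 0] by simp
  next
    case (pCons a y)
    have "[:a:] + [:0, 1:] * y \<in> T"
      using const[of a] pCons T(2,3) by blast
    then show ?case by simp
  qed
  then show "T = UNIV" by auto
qed

lemma nilpotent_poly: "of_nat p ^ N = (0 :: 'r poly)"
proof -
  have "of_nat p ^ N = [:of_nat p ^ N :: 'r:]"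
    by (simp add: of_nat_poly const_power)
  then show ?thesis by (simp add: nilpotent)
qed

sublocale TD: p_nilpotent_algebra "\<lambda>v. [:c v:]" p N "insert [:0, 1:] ((\<lambda>i. [:x i:]) ` {..<n})"
  by unfold_locales (use hom_poly prime nilpotent_poly generates_poly in auto)

lemma D_Rt_linear: "P \<in> D_Rt c \<Longrightarrow> linear_op (\<lambda>v. [:c v:]) P"
  unfolding D_Rt_def by (rule TD.diff_opD)

lemma D_Rt_power: "P \<in> D_Rt c \<Longrightarrow> \<exists>E0. \<forall>E\<ge>E0. \<forall>h y. P (h ^ (p ^ E) * y) = h ^ (p ^ E) * P y"
  unfolding D_Rt_def by (rule TD.diff_op_power)

lemma D_Rt_power_common:
  "P \<in> D_Rt c \<Longrightarrow> Q \<in> D_Rt c \<Longrightarrow> \<exists>E0. \<forall>E\<ge>E0. \<forall>h y.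
    P (h ^ (p ^ E) * y) = h ^ (p ^ E) * P y \<and> Q (h ^ (p ^ E) * y) = h ^ (p ^ E) * Q y"
  unfolding D_Rt_def by (rule TD.diff_op_power_common)

lemma D_Rt_comp: "P \<in> D_Rt c \<Longrightarrow> Q \<in> D_Rt c \<Longrightarrow> P \<circ> Q \<in> D_Rt c"
  unfolding D_Rt_def comp_def by (rule TD.diff_op_comp)

lemma D_Rt_plus: "P \<in> D_Rt c \<Longrightarrow> Q \<in> D_Rt c \<Longrightarrow> (\<lambda>y. P y + Q y) \<in> D_Rt c"
  unfolding D_Rt_def by (rule TD.diff_op_plus)

lemma D_Rt_times: "(*) s \<in> D_Rt c"
  unfolding D_Rt_def by (rule TD.diff_op_times)

lemma D_Rt_0D: "P \<in> D_Rt_0 c \<Longrightarrow> P \<in> D_Rt c"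
  by (simp add: D_Rt_0_def)

lemma D_Rt_0_monom: "P \<in> D_Rt_0 c \<Longrightarrow> P (monom r a) = monom (component P a r) a"
  unfolding D_Rt_0_def component_def by (smt (verit) coeff_monom mem_Collect_eq)

lemma D_Rt_0I: "P \<in> D_Rt c \<Longrightarrow> (\<And>r a. P (monom r a) = monom (Q r a) a) \<Longrightarrow> P \<in> D_Rt_0 c"
  unfolding D_Rt_0_def by blast

lemma component_0: "P \<in> D_Rt c \<Longrightarrow> component P a 0 = 0"
  by (simp add: component_def linear_op_0[OF D_Rt_linear])

lemma D_Rt_0_comp:
  assumes "P \<in> D_Rt_0 c" "Q \<in> D_Rt_0 c"
  shows "P \<circ> Q \<in> D_Rt_0 c" "component (P \<circ> Q) a r = component P a (component Q a r)"
proof -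
  show "P \<circ> Q \<in> D_Rt_0 c"
    by (rule D_Rt_0I[OF D_Rt_comp[OF D_Rt_0D[OF assms(1)] D_Rt_0D[OF assms(2)]]])
       (simp add: D_Rt_0_monom assms)
  show "component (P \<circ> Q) a r = component P a (component Q a r)"
    using D_Rt_0_monom[OF assms(2), of r a] by (simp add: component_def)
qed

lemma D_Rt_0_plus: "P \<in> D_Rt_0 c \<Longrightarrow> Q \<in> D_Rt_0 c \<Longrightarrow> (\<lambda>y. P y + Q y) \<in> D_Rt_0 c"
  by (rule D_Rt_0I[OF D_Rt_plus]) (auto simp: D_Rt_0D D_Rt_0_monom add_monom)

lemma D_Rt_0_const: "(*) [:h:] \<in> D_Rt_0 c"
  by (rule D_Rt_0I[OF D_Rt_times]) (simp add: smult_monom)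

lemma D_Rt_0_coeff:
  assumes "P \<in> D_Rt_0 c"
  shows "coeff (P y) a = component P a (coeff y a)"
proof -
  have lin: "linear_op (\<lambda>v. [:c v:]) P"
    by (rule D_Rt_linear[OF D_Rt_0D[OF assms]])
  have "P y = P (\<Sum>b\<le>degree y. monom (coeff y b) b)"
    by (simp add: poly_as_sum_of_monoms)
  also have "\<dots> = graded_op (component P) y"
    by (simp add: linear_op_sum[OF lin] D_Rt_0_monom[OF assms] graded_op_def)
  finally show ?thesis
    by (simp add: coeff_graded_op component_0[OF D_Rt_0D[OF assms]])
qed

lemma component_linear:
  assumes "P \<in> D_Rt_0 c"
  shows "linear_op c (component P a)"
proof (rule linear_opI)
  have lin: "linear_op (\<lambda>v. [:c v:]) P"
    by (rule D_Rt_linear[OF D_Rt_0D[OF assms]])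
  show "component P a (r + s) = component P a r + component P a s" for r s
    by (simp add: component_def add_monom[symmetric] linear_op_add[OF lin])
  show "component P a (c v * r) = c v * component P a r" for v r
    using linear_op_scale[OF lin, of v "monom r a"]
    by (simp add: component_def smult_monom)
qed

text \<open>Commutation with p^E-th powers of constants gives all components one common level;
  commutation with t^(p^E) is periodicity of the family.\<close>

lemma component_power:
  assumes "P \<in> D_Rt_0 c"
  shows "\<exists>E0. \<forall>E\<ge>E0. \<forall>a. (\<forall>h r. component P a (h ^ (p ^ E) * r) = h ^ (p ^ E) * component P a r) \<and>
    component P (a + p ^ E) = component P a"
proof -
  obtain E0 where E0: "\<forall>E\<ge>E0. \<forall>h y. P (h ^ (p ^ E) * y) = h ^ (p ^ E) * P y"
    using D_Rt_power[OF D_Rt_0D[OF assms]] by blast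
  have "component P a (h ^ (p ^ E) * r) = h ^ (p ^ E) * component P a r"
    and "component P (a + p ^ E) r = component P a r" if "E0 \<le> E" for E a h r
  proof -
    show "component P a (h ^ (p ^ E) * r) = h ^ (p ^ E) * component P a r"
      using E0[rule_format, OF that, of "[:h:]" "monom r a"]
      by (simp add: component_def const_power smult_monom)
    have "P (monom 1 (p ^ E) * monom r a) = monom 1 (p ^ E) * P (monom r a)"
      using E0[rule_format, OF that, of "[:0, 1:]" "monom r a"] by (simp only: t_power)
    then show "component P (a + p ^ E) r = component P a r"
      by (simp add: component_def mult_monom coeff_monom_mult add.commute)
  qed
  then show ?thesis
    by blast
qed

lemma component_diff_op:
  assumes "P \<in> D_Rt_0 c"
  shows "component P a \<in> diff_ops c"
proof -
  obtain E where "\<forall>h r. component P a (h ^ (p ^ E) * r) = h ^ (p ^ E) * component P a r"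
    using component_power[OF assms] by blast
  then show ?thesis
    by (intro RD.diff_opI[where e = E, OF component_linear[OF assms]]) blast
qed

text \<open>R[t] is generated over V by t and the variables of R: \<open>periodic\<close> is
  commutation with t^(p^e), and \<open>power\<close> handles the variables.\<close>

lemma graded_op_D_Rt_0:
  assumes lin: "\<And>a. linear_op c (P a)"
    and power: "\<And>a h r. P a (h ^ (p ^ e) * r) = h ^ (p ^ e) * P a r"
    and periodic: "\<And>a. P (a + p ^ e) = P a"
  shows "graded_op P \<in> D_Rt_0 c"
proof (rule D_Rt_0I)
  have 0: "P a 0 = 0" for a
    by (rule linear_op_0[OF lin])
  note coeff = coeff_graded_op[of P, OF 0]
  show "graded_op P (monom r a) = monom (P a r) a" for r a
    by (simp only: graded_op_monom[of P] 0)
  show "graded_op P \<in> D_Rt c"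
    unfolding D_Rt_def
  proof (rule TD.diff_opI[where e = e])
    show "linear_op (\<lambda>v. [:c v:]) (graded_op P)"
      by (rule linear_opI; rule poly_eqI)
         (simp_all add: coeff linear_op_add[OF lin] linear_op_scale[OF lin])
    fix y z assume "y \<in> insert [:0, 1:] ((\<lambda>i. [:x i:]) ` {..<n})"
    then consider "y = [:0, 1:]" | i where "y = [:x i:]" by auto
    then show "graded_op P (y ^ (p ^ e) * z) = y ^ (p ^ e) * graded_op P z"
    proof cases
      case 1
      have "P a = P (a - p ^ e)" if "p ^ e \<le> a" for a
        using periodic[of "a - p ^ e"] that by simp
      then show ?thesis
        unfolding 1 t_power by (intro poly_eqI) (simp add: coeff coeff_monom_mult 0)
    next
      case 2
      show ?thesis
        unfolding 2 const_power by (intro poly_eqI) (simp add: coeff power)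
    qed
  qed
qed

end

section \<open>The module structure on fractions\<close>

lemma tfrac_cases:
  obtains a b where "z = tfrac a b" "nonzerodivisor b"
proof -
  define y where "y = rep_tfrac z"
  have "tfrac_rel y y" "abs_tfrac y = z"
    unfolding y_def by (rule Quotient3_rep_reflp[OF Quotient3_tfrac] Quotient3_abs_rep[OF Quotient3_tfrac])+
  then have "nonzerodivisor (snd y)" "z = tfrac (fst y) (snd y)"
    by (auto simp: tfrac_rel_def tfrac.abs_eq)
  with that show ?thesis by blast
qed

lemma tfrac_0: "tfrac 0 1 = 0" and tfrac_1: "tfrac 1 1 = 1"
  by (transfer; simp add: tfrac_rel_def nonzerodivisor_1)+

lemma nonzerodivisor_power: "nonzerodivisor a \<Longrightarrow> nonzerodivisor (a ^ k)"
  by (induction k) (auto simp: nonzerodivisor_1 nonzerodivisor_mult)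

lemma tfrac_zero_num: "nonzerodivisor b \<Longrightarrow> tfrac 0 b = 0"
  by (simp add: tfrac_0[symmetric] tfrac_eq_iff nonzerodivisor_1)

lemma tfrac_minus: "nonzerodivisor b \<Longrightarrow> - tfrac a b = tfrac (- a) b"
  by (transfer) (simp add: tfrac_rel_def)

text \<open>How values of the chosen module structure are computed: clear a denominator, evaluate on
  polynomials, divide back.\<close>

lemma tfrac_scale_eq_iff:
  assumes "nonzerodivisor s"
  shows "tfrac s 1 * z = tfrac a 1 \<longleftrightarrow> z = tfrac a s"
proof -
  obtain g h where z: "z = tfrac g h" "nonzerodivisor h" by (rule tfrac_cases)
  show ?thesis
    using assms z(2) unfolding z(1)
    by (simp add: tfrac_mult tfrac_eq_iff nonzerodivisor_1 nonzerodivisor_mult mult.commute)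
qed

lemma nonzerodivisor_const: "nonzerodivisor h \<Longrightarrow> nonzerodivisor [:h:]"
  unfolding nonzerodivisor_def
  by (intro allI impI poly_eqI) (metis coeff_0 coeff_const_mult)

text \<open>The polynomial h - t^q has leading coefficient -1, so its nonzero multiples have degree
  at least q.\<close>

lemma const_minus_t_power_mult:
  fixes g :: "'r::comm_ring_1 poly"
  assumes q: "0 < q" and eq: "([:h:] - monom 1 q) * g = y" and y: "\<And>a. q \<le> a \<Longrightarrow> coeff y a = 0"
  shows "g = 0"
proof (rule ccontr)
  assume "g \<noteq> 0"
  have "coeff (([:h:] - monom 1 q) * g) (degree g + q) =
      h * coeff g (degree g + q) - coeff g (degree g)"
    by (simp add: left_diff_distrib coeff_monom_mult)
  moreover have "coeff g (degree g + q) = 0"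
    using q by (intro coeff_eq_0) simp
  ultimately have "coeff g (degree g) = 0"
    using y[of "degree g + q"] by (simp add: eq)
  with \<open>g \<noteq> 0\<close> show False by simp
qed

lemma nonzerodivisor_const_minus_t_power: "0 < q \<Longrightarrow> nonzerodivisor ([:h:] - monom 1 q)"
  unfolding nonzerodivisor_def using const_minus_t_power_mult by (metis coeff_0)

lemma f_minus_t: "[:f, -1:] = [:f:] - monom 1 1" for f :: "'r::comm_ring_1"
  by (simp add: monom_altdef)

lemma nonzerodivisor_f_minus_t: "nonzerodivisor [:f, -1:]"
  unfolding f_minus_t by (rule nonzerodivisor_const_minus_t_power) simp

section \<open>Extending differential operators to fractions\<close>

context poly_ring_p
begin

text \<open>Since P commutes with h^q for large q = p^E, its value at g/h = g h^(q-1)/h^q has to be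
  P(g h^(q-1))/h^q. Demanding this for all representatives and all large E lets later proofs choose
  both freely.\<close>

definition is_ext :: "('r poly \<Rightarrow> 'r poly) \<Rightarrow> 'r poly tfrac \<Rightarrow> 'r poly tfrac \<Rightarrow> bool" where
  "is_ext P z w \<longleftrightarrow> (\<exists>E0. \<forall>E\<ge>E0. \<forall>g h. nonzerodivisor h \<and> z = tfrac g h \<longrightarrow>
     w = tfrac (P (g * h ^ (p ^ E - 1))) (h ^ (p ^ E)))"

lemma power_pred: "h * h ^ (p ^ E - 1) = h ^ (p ^ E)" for h :: "'a::comm_ring_1"
  using p_gt_0 by (metis power_eq_if not_gr_zero power_not_zero zero_less_power)

text \<open>Fact 1 below compares two levels and fact 2 two representatives; each is a commutation
  with high powers of denominators.\<close>

lemma ex_ext: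
  assumes P: "P \<in> D_Rt c"
  shows "\<exists>w. is_ext P z w"
proof -
  obtain E0 where E0: "\<And>E h y. E0 \<le> E \<Longrightarrow> P (h ^ (p ^ E) * y) = h ^ (p ^ E) * P y"
    using D_Rt_power[OF P] by blast
  obtain g h where z: "z = tfrac g h" "nonzerodivisor h" by (rule tfrac_cases)
  have "tfrac (P (g * h ^ (p ^ E0 - 1))) (h ^ (p ^ E0)) = tfrac (P (g' * h' ^ (p ^ E - 1))) (h' ^ (p ^ E))"
    if E: "E0 \<le> E" and h': "nonzerodivisor h'" "z = tfrac g' h'" for E g' h'
  proof -
    have gh: "g * h' = g' * h"
      using h' z by (simp add: tfrac_eq_iff)
    obtain s where s: "p ^ E = p ^ E0 * s"
      using E by (metis le_imp_power_dvd dvdE)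
    have "h ^ (p ^ E0) * P (g * h ^ (p ^ E - 1)) = P (h ^ (p ^ E0) * (g * h ^ (p ^ E - 1)))"
      by (rule E0[symmetric]) simp
    also have "h ^ (p ^ E0) * (g * h ^ (p ^ E - 1)) = (h ^ s) ^ (p ^ E0) * (g * h ^ (p ^ E0 - 1))"
    proof -
      have "h ^ (p ^ E0) * (g * h ^ (p ^ E - 1)) = g * (h * h ^ (p ^ E - 1)) * h ^ (p ^ E0 - 1)"
        unfolding power_pred[of h E0, symmetric] by (simp add: mult_ac)
      also have "\<dots> = (h ^ s) ^ (p ^ E0) * (g * h ^ (p ^ E0 - 1))"
        unfolding power_pred by (simp add: s power_mult[symmetric] mult_ac)
      finally show ?thesis .
    qed
    also have "P \<dots> = h ^ (p ^ E) * P (g * h ^ (p ^ E0 - 1))"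
      unfolding E0[OF order_refl] by (simp add: s power_mult[symmetric] mult.commute)
    finally have 1: "h ^ (p ^ E0) * P (g * h ^ (p ^ E - 1)) = h ^ (p ^ E) * P (g * h ^ (p ^ E0 - 1))" .
    have "h' ^ (p ^ E) * P (g * h ^ (p ^ E - 1)) = P (h' ^ (p ^ E) * (g * h ^ (p ^ E - 1)))"
      by (rule E0[OF E, symmetric])
    also have "h' ^ (p ^ E) * (g * h ^ (p ^ E - 1)) = (g * h') * h' ^ (p ^ E - 1) * h ^ (p ^ E - 1)"
      unfolding power_pred[symmetric] by (simp add: mult_ac)
    also have "\<dots> = h ^ (p ^ E) * (g' * h' ^ (p ^ E - 1))"
      unfolding gh power_pred[symmetric] by (simp add: mult_ac)
    also have "P \<dots> = h ^ (p ^ E) * P (g' * h' ^ (p ^ E - 1))"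
      by (rule E0[OF E])
    finally have 2: "h' ^ (p ^ E) * P (g * h ^ (p ^ E - 1)) = h ^ (p ^ E) * P (g' * h' ^ (p ^ E - 1))" .
    have nz: "nonzerodivisor (h ^ (p ^ E))"
      by (rule nonzerodivisor_power[OF z(2)])
    have "h ^ (p ^ E) * (P (g * h ^ (p ^ E0 - 1)) * h' ^ (p ^ E)) =
        h ^ (p ^ E0) * (h' ^ (p ^ E) * P (g * h ^ (p ^ E - 1)))"
      unfolding mult.left_commute[of "h ^ (p ^ E0)"] 1 by (simp only: mult_ac)
    also have "\<dots> = h ^ (p ^ E) * (P (g' * h' ^ (p ^ E - 1)) * h ^ (p ^ E0))"
      unfolding 2 by (simp add: mult_ac)
    finally have "P (g * h ^ (p ^ E0 - 1)) * h' ^ (p ^ E) = P (g' * h' ^ (p ^ E - 1)) * h ^ (p ^ E0)"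
      by (rule nonzerodivisor_cancel[OF nz])
    then show ?thesis
      using z(2) h'(1) by (simp add: tfrac_eq_iff nonzerodivisor_power)
  qed
  then show ?thesis
    unfolding is_ext_def by blast
qed

definition ext :: "('r poly \<Rightarrow> 'r poly) \<Rightarrow> 'r poly tfrac \<Rightarrow> 'r poly tfrac" where
  "ext P z = (SOME w. is_ext P z w)"

lemma ext_tfrac:
  assumes "P \<in> D_Rt c" "nonzerodivisor h"
  shows "\<exists>E0. \<forall>E\<ge>E0. ext P (tfrac g h) = tfrac (P (g * h ^ (p ^ E - 1))) (h ^ (p ^ E))"
proof -
  have "is_ext P (tfrac g h) (ext P (tfrac g h))"
    unfolding ext_def by (rule someI_ex[OF ex_ext[OF assms(1)]])
  with assms(2) show ?thesis
    unfolding is_ext_def by blast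
qed

lemma ext_add:
  assumes P: "P \<in> D_Rt c"
  shows "ext P (y + z) = ext P y + ext P z"
proof -
  obtain a b where y: "y = tfrac a b" "nonzerodivisor b" by (rule tfrac_cases)
  obtain g h where z: "z = tfrac g h" "nonzerodivisor h" by (rule tfrac_cases)
  have yz: "y + z = tfrac (a * h + g * b) (b * h)" "nonzerodivisor (b * h)"
    using y z by (simp_all add: tfrac_add nonzerodivisor_mult)
  obtain E1 where E1: "\<And>E. E1 \<le> E \<Longrightarrow> ext P y = tfrac (P (a * b ^ (p ^ E - 1))) (b ^ (p ^ E))"
    using ext_tfrac[OF P y(2)] y(1) by blast
  obtain E2 where E2: "\<And>E. E2 \<le> E \<Longrightarrow> ext P z = tfrac (P (g * h ^ (p ^ E - 1))) (h ^ (p ^ E))"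
    using ext_tfrac[OF P z(2)] z(1) by blast
  obtain E3 where E3: "\<And>E. E3 \<le> E \<Longrightarrow>
      ext P (y + z) = tfrac (P ((a * h + g * b) * (b * h) ^ (p ^ E - 1))) ((b * h) ^ (p ^ E))"
    using ext_tfrac[OF P yz(2)] yz(1) by metis
  obtain E4 where E4: "\<And>E h y. E4 \<le> E \<Longrightarrow> P (h ^ (p ^ E) * y) = h ^ (p ^ E) * P y"
    using D_Rt_power[OF P] by blast
  define E where "E = max (max E1 E2) (max E3 E4)"
  have E: "E1 \<le> E" "E2 \<le> E" "E3 \<le> E" "E4 \<le> E" by (auto simp: E_def)
  have "(a * h + g * b) * (b * h) ^ (p ^ E - 1) =
      h ^ (p ^ E) * (a * b ^ (p ^ E - 1)) + b ^ (p ^ E) * (g * h ^ (p ^ E - 1))"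
    unfolding power_pred[symmetric] by (simp add: power_mult_distrib algebra_simps)
  then have "P ((a * h + g * b) * (b * h) ^ (p ^ E - 1)) =
      h ^ (p ^ E) * P (a * b ^ (p ^ E - 1)) + b ^ (p ^ E) * P (g * h ^ (p ^ E - 1))"
    by (simp add: linear_op_add[OF D_Rt_linear[OF P]] E4[OF E(4)])
  then show ?thesis
    unfolding E1[OF E(1)] E2[OF E(2)] E3[OF E(3)]
    by (simp add: tfrac_add nonzerodivisor_power y(2) z(2) power_mult_distrib mult.commute)
qed

lemma ext_plus:
  assumes P: "P \<in> D_Rt c" and Q: "Q \<in> D_Rt c"
  shows "ext (\<lambda>y. P y + Q y) z = ext P z + ext Q z"
proof -
  obtain g h where z: "z = tfrac g h" "nonzerodivisor h" by (rule tfrac_cases)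
  obtain E1 where E1: "\<And>E. E1 \<le> E \<Longrightarrow> ext P z = tfrac (P (g * h ^ (p ^ E - 1))) (h ^ (p ^ E))"
    using ext_tfrac[OF P z(2)] z(1) by blast
  obtain E2 where E2: "\<And>E. E2 \<le> E \<Longrightarrow> ext Q z = tfrac (Q (g * h ^ (p ^ E - 1))) (h ^ (p ^ E))"
    using ext_tfrac[OF Q z(2)] z(1) by blast
  obtain E3 where E3: "\<And>E. E3 \<le> E \<Longrightarrow> ext (\<lambda>y. P y + Q y) z =
      tfrac (P (g * h ^ (p ^ E - 1)) + Q (g * h ^ (p ^ E - 1))) (h ^ (p ^ E))"
    using ext_tfrac[OF D_Rt_plus[OF P Q] z(2)] z(1) by blast
  define E where "E = max E1 (max E2 E3)"
  have E: "E1 \<le> E" "E2 \<le> E" "E3 \<le> E" by (auto simp: E_def)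
  have nz: "nonzerodivisor (h ^ (p ^ E))"
    by (rule nonzerodivisor_power[OF z(2)])
  show ?thesis
    unfolding E1[OF E(1)] E2[OF E(2)] E3[OF E(3)]
    using nz by (simp add: tfrac_add tfrac_eq_iff nonzerodivisor_mult algebra_simps)
qed

lemma ext_comp:
  assumes P: "P \<in> D_Rt c" and Q: "Q \<in> D_Rt c"
  shows "ext (P \<circ> Q) z = ext P (ext Q z)"
proof -
  obtain g h where z: "z = tfrac g h" "nonzerodivisor h" by (rule tfrac_cases)
  obtain E1 where E1: "\<And>E. E1 \<le> E \<Longrightarrow> ext Q z = tfrac (Q (g * h ^ (p ^ E - 1))) (h ^ (p ^ E))"
    using ext_tfrac[OF Q z(2)] z(1) by blast
  obtain E2 where E2: "\<And>E. E2 \<le> E \<Longrightarrow> ext (P \<circ> Q) z = tfrac (P (Q (g * h ^ (p ^ E - 1)))) (h ^ (p ^ E))"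
    using ext_tfrac[OF D_Rt_comp[OF P Q] z(2)] z(1) by fastforce
  obtain E3 where E3: "\<And>E h y. E3 \<le> E \<Longrightarrow> P (h ^ (p ^ E) * y) = h ^ (p ^ E) * P y"
    using D_Rt_power[OF P] by blast
  define E where "E = max E1 (max E2 E3)"
  have E: "E1 \<le> E" "E2 \<le> E" "E3 \<le> E" by (auto simp: E_def)
  have nz: "nonzerodivisor (h ^ (p ^ E))"
    by (rule nonzerodivisor_power[OF z(2)])
  obtain E4 where E4: "\<And>E'. E4 \<le> E' \<Longrightarrow> ext P (ext Q z) =
      tfrac (P (Q (g * h ^ (p ^ E - 1)) * (h ^ (p ^ E)) ^ (p ^ E' - 1))) ((h ^ (p ^ E)) ^ (p ^ E'))"
    using ext_tfrac[OF P nz] E1[OF E(1)] by metis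
  define E' where "E' = max E4 E"
  have E': "E4 \<le> E'" by (simp add: E'_def)
  have pw: "(h ^ (p ^ E)) ^ (p ^ E' - 1) = (h ^ (p ^ E' - 1)) ^ (p ^ E)"
    by (simp add: power_mult[symmetric] mult.commute)
  have "P (Q (g * h ^ (p ^ E - 1)) * (h ^ (p ^ E)) ^ (p ^ E' - 1)) =
      (h ^ (p ^ E)) ^ (p ^ E' - 1) * P (Q (g * h ^ (p ^ E - 1)))"
    unfolding pw using E3[OF E(3)] by (simp only: mult.commute)
  moreover have "(h ^ (p ^ E)) ^ (p ^ E') = h ^ (p ^ E) * (h ^ (p ^ E)) ^ (p ^ E' - 1)"
    by (simp only: power_pred)
  ultimately show ?thesis
    unfolding E2[OF E(2)] E4[OF E'] using nz
    by (simp add: tfrac_eq_iff nonzerodivisor_power nonzerodivisor_mult mult_ac)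
qed

lemma ext_times: "ext ((*) s) z = tfrac s 1 * z"
proof -
  obtain g h where z: "z = tfrac g h" "nonzerodivisor h" by (rule tfrac_cases)
  obtain E where E: "ext ((*) s) z = tfrac (s * (g * h ^ (p ^ E - 1))) (h ^ (p ^ E))"
    using ext_tfrac[OF D_Rt_times[of s] z(2)] z(1) by blast
  have nz: "nonzerodivisor (h ^ (p ^ E))"
    by (rule nonzerodivisor_power[OF z(2)])
  have "s * (g * h ^ (p ^ E - 1)) * h = s * g * h ^ (p ^ E)"
    unfolding power_pred[symmetric] by (simp add: mult_ac)
  then show ?thesis
    unfolding E unfolding z(1) using nz z(2) by (simp add: tfrac_mult nonzerodivisor_1 tfrac_eq_iff)
qed

lemma ext_const:
  assumes "P \<in> D_Rt c"
  shows "ext P (tfrac a 1) = tfrac (P a) 1"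
  using ext_tfrac[OF assms nonzerodivisor_1, of a] by auto

lemma ext_loc_f_ft:
  assumes "P \<in> D_Rt c" "nonzerodivisor f" "z \<in> loc_f_ft f"
  shows "ext P z \<in> loc_f_ft f"
proof -
  obtain g k l where z: "z = tfrac g ([:f:] ^ k * [:f, -1:] ^ l)"
    using assms(3) by (auto simp: loc_f_ft_def)
  have "nonzerodivisor ([:f:] ^ k * [:f, -1:] ^ l)"
    by (intro nonzerodivisor_mult nonzerodivisor_power nonzerodivisor_const
        nonzerodivisor_f_minus_t assms(2))
  then obtain E where E: "ext P z = tfrac (P (g * ([:f:] ^ k * [:f, -1:] ^ l) ^ (p ^ E - 1)))
      (([:f:] ^ k * [:f, -1:] ^ l) ^ (p ^ E))"
    using ext_tfrac[OF assms(1)] z by blast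
  show ?thesis
    unfolding E loc_f_ft_def power_mult_distrib power_mult[symmetric] by blast
qed

lemma loc_module_structure_ext:
  assumes "nonzerodivisor f"
  shows "loc_module_structure (D_Rt c) (loc_f_ft f) ext"
  unfolding loc_module_structure_def
  using ext_loc_f_ft[OF _ assms] ext_add ext_plus ext_comp ext_times ext_const by blast

text \<open>\<open>loc_act\<close> is an arbitrary choice: \<open>ext\<close> witnesses that one
  exists, and later computations rest on the axioms.\<close>

lemma loc_act:
  assumes "nonzerodivisor f"
  shows "loc_module_structure (D_Rt c) (loc_f_ft f) (loc_act c f)"
  unfolding loc_act_def 
  by (rule someI[where P = "loc_module_structure (D_Rt c) (loc_f_ft f)", OF loc_module_structure_ext[OF assms]])

end

section \<open>Continuous functions on the \<open>p\<close>-adic integers\<close>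

lemma Zp_of_int_Zp: "0 < p \<Longrightarrow> Zp_of_int p z \<in> Zp p"
  by (simp add: Zp_def Zp_of_int_def mod_mod_cancel le_imp_power_dvd)

definition has_level :: "nat \<Rightarrow> nat \<Rightarrow> ((nat \<Rightarrow> int) \<Rightarrow> 'v) \<Rightarrow> bool" where
  "has_level p e \<phi> \<longleftrightarrow> (\<forall>\<beta>\<in>Zp p. \<forall>\<gamma>\<in>Zp p. \<beta> e = \<gamma> e \<longrightarrow> \<phi> \<beta> = \<phi> \<gamma>)"

lemma has_levelD: "has_level p e \<phi> \<Longrightarrow> \<beta> \<in> Zp p \<Longrightarrow> \<gamma> \<in> Zp p \<Longrightarrow> \<beta> e = \<gamma> e \<Longrightarrow> \<phi> \<beta> = \<phi> \<gamma>"
  unfolding has_level_def by blast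

lemma Zp_eq_below: "\<beta> \<in> Zp p \<Longrightarrow> \<gamma> \<in> Zp p \<Longrightarrow> \<beta> l = \<gamma> l \<Longrightarrow> k \<le> l \<Longrightarrow> \<beta> k = \<gamma> k"
  using Zp_mod by metis

lemma topspace_Zp: "topspace (Zp_topology p) = Zp p"
  by (auto simp: Zp_topology_def Zp_def)

lemma openin_Zp_level: "openin (Zp_topology p) {\<gamma> \<in> Zp p. \<gamma> e = r}"
proof -
  let ?X = "product_topology (\<lambda>k. discrete_topology {0..<int p ^ k}) UNIV"
  have "openin ?X {\<gamma> \<in> topspace ?X. \<gamma> e \<in> {r} \<inter> {0..<int p ^ e}}"
    by (rule openin_continuous_map_preimage[OF continuous_map_product_projection[of e UNIV]]) auto
  moreover have "{\<gamma> \<in> Zp p. \<gamma> e = r} = Zp p \<inter> {\<gamma> \<in> topspace ?X. \<gamma> e \<in> {r} \<inter> {0..<int p ^ e}}"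
    by (auto simp: Zp_def)
  ultimately show ?thesis
    unfolding Zp_topology_def openin_subtopology by blast
qed

lemma has_level_C_Zp:
  assumes "has_level p e \<phi>" "\<phi> \<in> extensional (Zp p)"
  shows "\<phi> \<in> C_Zp p"
proof -
  have "openin (Zp_topology p) {\<beta> \<in> Zp p. \<phi> \<beta> \<in> U}" for U
  proof -
    have "{\<beta> \<in> Zp p. \<phi> \<beta> \<in> U} = (\<Union>\<beta>\<in>{\<beta> \<in> Zp p. \<phi> \<beta> \<in> U}. {\<gamma> \<in> Zp p. \<gamma> e = \<beta> e})"
    proof (intro equalityI subsetI)
      fix \<gamma> assume "\<gamma> \<in> (\<Union>\<beta>\<in>{\<beta> \<in> Zp p. \<phi> \<beta> \<in> U}. {\<gamma> \<in> Zp p. \<gamma> e = \<beta> e})"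
      then obtain \<beta> where "\<beta> \<in> Zp p" "\<phi> \<beta> \<in> U" "\<gamma> \<in> Zp p" "\<gamma> e = \<beta> e"
        by blast
      with has_levelD[OF assms(1), of \<gamma> \<beta>] show "\<gamma> \<in> {\<beta> \<in> Zp p. \<phi> \<beta> \<in> U}"
        by simp
    qed blast
    also have "openin (Zp_topology p) \<dots>"
      by (intro openin_clauses(3)) (auto simp: openin_Zp_level)
    finally show ?thesis .
  qed
  then show ?thesis
    using assms(2) by (simp add: C_Zp_def continuous_map_def topspace_Zp)
qed

text \<open>A basic open set of the product constrains finitely many residues, and by coherence a
  residue of large index determines all of them.\<close>

lemma C_Zp_locally_constant:
  assumes "\<phi> \<in> C_Zp p" "\<beta> \<in> Zp p"
  shows "\<exists>e. \<forall>\<gamma>\<in>Zp p. \<gamma> e = \<beta> e \<longrightarrow> \<phi> \<gamma> = \<phi> \<beta>"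
proof -
  let ?X = "product_topology (\<lambda>k. discrete_topology {0..<int p ^ k}) UNIV"
  have "openin (Zp_topology p) {\<gamma> \<in> topspace (Zp_topology p). \<phi> \<gamma> \<in> {\<phi> \<beta>}}"
    using assms(1) by (intro openin_continuous_map_preimage[of _ "discrete_topology UNIV"]) (auto simp: C_Zp_def)
  then obtain T where T: "openin ?X T" "{\<gamma> \<in> Zp p. \<phi> \<gamma> = \<phi> \<beta>} = T \<inter> Zp p"
    unfolding Zp_topology_def openin_subtopology topspace_Zp[unfolded Zp_topology_def] by auto
  then have "\<beta> \<in> T" using assms(2) by blast
  then obtain U where U: "finite {i. U i \<noteq> {0..<int p ^ i}}" "\<beta> \<in> Pi\<^sub>E UNIV U" "Pi\<^sub>E UNIV U \<subseteq> T"
    using T(1) unfolding openin_product_topology_alt by auto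
  obtain e where e: "\<And>i. U i \<noteq> {0..<int p ^ i} \<Longrightarrow> i \<le> e"
    using finite_nat_set_iff_bounded_le[THEN iffD1, OF U(1)] by auto
  have "\<phi> \<gamma> = \<phi> \<beta>" if \<gamma>: "\<gamma> \<in> Zp p" "\<gamma> e = \<beta> e" for \<gamma>
  proof -
    have "\<gamma> i \<in> U i" for i
    proof (cases "U i = {0..<int p ^ i}")
      case True
      then show ?thesis using Zp_range[OF \<gamma>(1)] by simp
    next
      case False
      then have "\<gamma> i = \<beta> i"
        using Zp_eq_below[OF \<gamma>(1) assms(2) \<gamma>(2)] e by blast
      with U(2) show ?thesis by (simp add: PiE_iff)
    qed
    then have "\<gamma> \<in> T" using U(3) by (auto simp: PiE_iff)
    with \<gamma>(1) T(2) show ?thesis by blast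
  qed
  then show ?thesis by blast
qed

text \<open>Compactness of \<open>\<int>\<^sub>p\<close>, in the form of Koenig's lemma for the tree of residues.\<close>
lemma C_Zp_has_level:
  assumes p: "0 < p" and \<phi>: "\<phi> \<in> C_Zp p"
  shows "\<exists>e. has_level p e \<phi>"
proof (rule ccontr)
  assume no: "\<not> ?thesis"
  \<comment> \<open>On the ball with residue \<open>r\<close> modulo p^e the function has no level.
    An infinite path of bad balls shrinks to a point, against local constancy there.\<close>
  define bad where "bad e r \<longleftrightarrow> (\<forall>e'. \<exists>\<beta>\<in>Zp p. \<exists>\<gamma>\<in>Zp p. \<beta> e = r \<and> \<gamma> e = r \<and> \<beta> e' = \<gamma> e' \<and> \<phi> \<beta> \<noteq> \<phi> \<gamma>)" for e r
  have "bad 0 0"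
  proof -
    have "\<beta> 0 = 0" if "\<beta> \<in> Zp p" for \<beta>
      using Zp_range[OF that, of 0] by simp
    with no show ?thesis
      unfolding bad_def has_level_def by metis
  qed
  have step: "\<exists>r'. bad (Suc e) r' \<and> r' mod int p ^ e = r" if bad: "bad e r" for e r
  proof (rule ccontr)
    assume "\<not> ?thesis"
    then have "\<forall>r'\<in>{0..<int p ^ Suc e}. \<exists>e'. r' mod int p ^ e = r \<longrightarrow>
        \<not> (\<exists>\<beta>\<in>Zp p. \<exists>\<gamma>\<in>Zp p. \<beta> (Suc e) = r' \<and> \<gamma> (Suc e) = r' \<and> \<beta> e' = \<gamma> e' \<and> \<phi> \<beta> \<noteq> \<phi> \<gamma>)"
      unfolding bad_def by blast
    then obtain g where g: "\<And>r' \<beta> \<gamma>. r' \<in> {0..<int p ^ Suc e} \<Longrightarrow> r' mod int p ^ e = r \<Longrightarrow>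
        \<beta> \<in> Zp p \<Longrightarrow> \<gamma> \<in> Zp p \<Longrightarrow> \<beta> (Suc e) = r' \<Longrightarrow> \<gamma> (Suc e) = r' \<Longrightarrow> \<beta> (g r') = \<gamma> (g r') \<Longrightarrow> \<phi> \<beta> = \<phi> \<gamma>"
      by metis
    \<comment> \<open>If every sub-ball had a level, the largest of these finitely many levels would
      serve the whole ball.\<close>
    define e' where "e' = max (Suc e) (Max (g ` {0..<int p ^ Suc e}))"
    have le: "g r' \<le> e'" if "r' \<in> {0..<int p ^ Suc e}" for r'
      using that by (auto simp: e'_def intro!: max.coboundedI2 Max_ge)
    obtain \<beta> \<gamma> where bg: "\<beta> \<in> Zp p" "\<gamma> \<in> Zp p" "\<beta> e = r" "\<gamma> e = r" "\<beta> e' = \<gamma> e'" "\<phi> \<beta> \<noteq> \<phi> \<gamma>"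
      using bad unfolding bad_def by blast
    have eq: "\<beta> k = \<gamma> k" if "k \<le> e'" for k
      by (rule Zp_eq_below[OF bg(1,2,5) that])
    have r': "\<beta> (Suc e) \<in> {0..<int p ^ Suc e}"
      using Zp_range[OF bg(1), of "Suc e"] by simp
    have "\<phi> \<beta> = \<phi> \<gamma>"
    proof (rule g[OF r' _ bg(1,2) refl])
      show "\<beta> (Suc e) mod int p ^ e = r"
        using Zp_mod[OF bg(1), of e "Suc e"] bg(3) by simp
      show "\<gamma> (Suc e) = \<beta> (Suc e)"
        using eq[of "Suc e"] by (simp add: e'_def)
      show "\<beta> (g (\<beta> (Suc e))) = \<gamma> (g (\<beta> (Suc e)))"
        by (rule eq[OF le[OF r']])
    qed
    with bg(6) show False by blast
  qed
  obtain \<alpha> where \<alpha>: "\<And>e. bad e (\<alpha> e)" "\<And>e. \<alpha> (Suc e) mod int p ^ e = \<alpha> e"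
    using dependent_nat_choice[of bad "\<lambda>e r r'. r' mod int p ^ e = r"] \<open>bad 0 0\<close> step by blast
  have "\<alpha> e \<in> {0..<int p ^ e}" for e
  proof -
    obtain \<beta> where "\<beta> \<in> Zp p" "\<beta> e = \<alpha> e"
      using \<alpha>(1)[of e] unfolding bad_def by blast
    then show ?thesis using Zp_range[of \<beta> p e] by simp
  qed
  with \<alpha>(2) have mem: "\<alpha> \<in> Zp p"
    by (simp add: Zp_def)
  obtain e where e: "\<And>\<gamma>. \<gamma> \<in> Zp p \<Longrightarrow> \<gamma> e = \<alpha> e \<Longrightarrow> \<phi> \<gamma> = \<phi> \<alpha>"
    using C_Zp_locally_constant[OF \<phi> mem] by blast
  have "\<exists>\<beta>\<in>Zp p. \<exists>\<gamma>\<in>Zp p. \<beta> e = \<alpha> e \<and> \<gamma> e = \<alpha> e \<and> \<phi> \<beta> \<noteq> \<phi> \<gamma>"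
    using \<alpha>(1)[of e] unfolding bad_def by blast
  with e show False by metis
qed

section \<open>The module \<open>N\<^sub>f\<close>\<close>

lemma add_coset_subgroup_eq:
  fixes z :: "'a::ab_group_add"
  assumes "0 \<in> B" "\<And>a b. a \<in> B \<Longrightarrow> b \<in> B \<Longrightarrow> a + b \<in> B" "\<And>a. a \<in> B \<Longrightarrow> - a \<in> B"
  shows "add_coset B y = add_coset B z \<longleftrightarrow> y - z \<in> B"
proof
  assume "add_coset B y = add_coset B z"
  moreover have "y \<in> add_coset B y"
    using assms(1) unfolding add_coset_def by force
  ultimately show "y - z \<in> B"
    by (auto simp: add_coset_def)
next
  assume *: "y - z \<in> B"
  have sub: "add_coset B y \<subseteq> add_coset B z" if "y - z \<in> B" for y z
  proof
    fix w assume "w \<in> add_coset B y"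
    then obtain b where b: "b \<in> B" "w = y + b" by (auto simp: add_coset_def)
    then have "w = z + ((y - z) + b)" by simp
    with assms(2)[OF that b(1)] show "w \<in> add_coset B z"
      unfolding add_coset_def by blast
  qed
  from * assms(3)[OF *] show "add_coset B y = add_coset B z"
    by (intro equalityI sub) auto
qed

section \<open>The action on H_f and N_f through representatives\<close>

locale bs_setting = poly_ring_p c n x p N
  for c :: "'v::comm_ring_1 \<Rightarrow> 'r::comm_ring_1" and n x p N +
  fixes f :: 'r
  assumes f: "nonzerodivisor f"
begin

abbreviation "B \<equiv> loc_f f"
abbreviation "A \<equiv> loc_f_ft f"
abbreviation "\<rho> \<equiv> loc_act c f"

definition \<delta> :: "'r poly tfrac" where "\<delta> = tfrac 1 [:f, -1:]"
definition f\<delta> :: "'r poly tfrac" where "f\<delta> = tfrac [:f:] 1 * \<delta>"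

lemma nzd_F: "nonzerodivisor ([:f:] ^ k)"
  by (intro nonzerodivisor_power nonzerodivisor_const f)

lemma nzd_T: "nonzerodivisor ([:f, -1:] ^ k)"
  by (intro nonzerodivisor_power nonzerodivisor_f_minus_t)

lemma nzd_FT: "nonzerodivisor ([:f:] ^ k * [:f, -1:] ^ l)"
  by (intro nonzerodivisor_mult nzd_F nzd_T)

lemmas \<rho>_structure = loc_act[OF f, unfolded loc_module_structure_def]

lemma \<rho>_mem: "P \<in> D_Rt c \<Longrightarrow> z \<in> A \<Longrightarrow> \<rho> P z \<in> A"
  and \<rho>_add: "P \<in> D_Rt c \<Longrightarrow> y \<in> A \<Longrightarrow> z \<in> A \<Longrightarrow> \<rho> P (y + z) = \<rho> P y + \<rho> P z"
  and \<rho>_plus: "P \<in> D_Rt c \<Longrightarrow> Q \<in> D_Rt c \<Longrightarrow> z \<in> A \<Longrightarrow> \<rho> (\<lambda>a. P a + Q a) z = \<rho> P z + \<rho> Q z"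
  and \<rho>_comp: "P \<in> D_Rt c \<Longrightarrow> Q \<in> D_Rt c \<Longrightarrow> z \<in> A \<Longrightarrow> \<rho> (P \<circ> Q) z = \<rho> P (\<rho> Q z)"
  and \<rho>_times: "z \<in> A \<Longrightarrow> \<rho> ((*) s) z = tfrac s 1 * z"
  and \<rho>_const: "P \<in> D_Rt c \<Longrightarrow> \<rho> P (tfrac a 1) = tfrac (P a) 1"
  using \<rho>_structure by blast+

lemma \<rho>_commute:
  assumes "P \<in> D_Rt c" "z \<in> A" "\<And>y. P (s * y) = s * P y"
  shows "\<rho> P (tfrac s 1 * z) = tfrac s 1 * \<rho> P z"
proof -
  have "P \<circ> (*) s = (*) s \<circ> P"
    using assms(3) by auto
  then show ?thesis
    using \<rho>_comp[OF assms(1) D_Rt_times assms(2), of s] \<rho>_comp[OF D_Rt_times assms(1,2), of s]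
      \<rho>_times[OF assms(2)] \<rho>_times[OF \<rho>_mem[OF assms(1,2)]] by metis
qed

lemma A_I: "tfrac g ([:f:] ^ k * [:f, -1:] ^ l) \<in> A"
  unfolding loc_f_ft_def by blast

lemma B_I: "tfrac g ([:f:] ^ k) \<in> B"
  unfolding loc_f_def by blast

lemma A_add: "y \<in> A \<Longrightarrow> z \<in> A \<Longrightarrow> y + z \<in> A"
proof -
  assume "y \<in> A" "z \<in> A"
  then obtain g k l g' k' l' where y: "y = tfrac g ([:f:] ^ k * [:f, -1:] ^ l)"
    and z: "z = tfrac g' ([:f:] ^ k' * [:f, -1:] ^ l')"
    unfolding loc_f_ft_def by blast
  have "[:f:] ^ k * [:f, -1:] ^ l * ([:f:] ^ k' * [:f, -1:] ^ l') = [:f:] ^ (k + k') * [:f, -1:] ^ (l + l')"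
    by (simp only: power_add mult_ac)
  then show ?thesis
    unfolding y z tfrac_add[OF nzd_FT nzd_FT] by (simp only: A_I)
qed

lemma B_add: "y \<in> B \<Longrightarrow> z \<in> B \<Longrightarrow> y + z \<in> B"
proof -
  assume "y \<in> B" "z \<in> B"
  then obtain g k g' k' where y: "y = tfrac g ([:f:] ^ k)" and z: "z = tfrac g' ([:f:] ^ k')"
    unfolding loc_f_def by blast
  show ?thesis
    unfolding y z tfrac_add[OF nzd_F nzd_F] power_add[symmetric] by (rule B_I)
qed

lemma B_0: "0 \<in> B"
  using B_I[of 0 0] by (simp add: tfrac_0)

lemma B_minus: "y \<in> B \<Longrightarrow> - y \<in> B"
  unfolding loc_f_def using tfrac_minus[OF nzd_F] by blast

lemma B_subset_A: "y \<in> B \<Longrightarrow> y \<in> A"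
  unfolding loc_f_def using A_I[where l = 0] by auto

lemma const_A: "tfrac a 1 \<in> A"
  using A_I[of a 0 0] by simp

lemma \<delta>_A: "\<delta> \<in> A"
  using A_I[of 1 0 1] by (simp add: \<delta>_def)

lemma f\<delta>_A: "f\<delta> \<in> A"
  using A_I[of "[:f:]" 0 1]
  by (simp add: f\<delta>_def \<delta>_def tfrac_mult nonzerodivisor_1 nonzerodivisor_f_minus_t)

text \<open>A high p^E-th power of the denominator commutes with P and reduces the claim to
  polynomials. Stability of \<open>B\<close> makes the action on H_f well defined.\<close>

lemma \<rho>_B: "P \<in> D_Rt c \<Longrightarrow> y \<in> B \<Longrightarrow> \<rho> P y \<in> B"
proof -
  assume P: "P \<in> D_Rt c" and "y \<in> B"
  then obtain g k where y: "y = tfrac g ([:f:] ^ k)"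
    unfolding loc_f_def by blast
  obtain E where E: "\<forall>h y. P (h ^ (p ^ E) * y) = h ^ (p ^ E) * P y"
    using D_Rt_power[OF P] by blast
  let ?h = "[:f:] ^ k"
  let ?s = "?h ^ (p ^ E)"
  have "tfrac ?s 1 * y = tfrac (?s * g) ?h"
    by (simp add: y tfrac_mult nonzerodivisor_1 nzd_F)
  also have "\<dots> = tfrac (?h ^ (p ^ E - 1) * g) 1"
    using nzd_F[of k] power_pred[of ?h E] by (simp add: tfrac_eq_iff nonzerodivisor_1 mult_ac)
  finally have "tfrac ?s 1 * \<rho> P y = tfrac (P (?h ^ (p ^ E - 1) * g)) 1"
    using \<rho>_commute[OF P B_subset_A[OF \<open>y \<in> B\<close>], of ?s] E \<rho>_const[OF P] by metis
  then have "\<rho> P y = tfrac (P (?h ^ (p ^ E - 1) * g)) ?s"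
    by (simp add: tfrac_scale_eq_iff nonzerodivisor_power nzd_F)
  then show ?thesis
    unfolding power_mult[symmetric] by (simp only: B_I)
qed

abbreviation "hc \<equiv> add_coset B"

lemma hc_eq_iff: "hc y = hc z \<longleftrightarrow> y - z \<in> B"
  by (rule add_coset_subgroup_eq) (auto intro: B_0 B_add B_minus)

lemma hc_plus: "hc y + hc z = hc (y + z)"
proof
  show "hc y + hc z \<subseteq> hc (y + z)"
  proof
    fix w assume "w \<in> hc y + hc z"
    then obtain a b where ab: "a \<in> B" "b \<in> B" "w = (y + a) + (z + b)"
      by (auto simp: set_plus_def add_coset_def)
    then have "w = (y + z) + (a + b)" by (simp add: algebra_simps)
    with B_add[OF ab(1,2)] show "w \<in> hc (y + z)"
      unfolding add_coset_def by blast
  qed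
  show "hc (y + z) \<subseteq> hc y + hc z"
  proof
    fix w assume "w \<in> hc (y + z)"
    then obtain b where b: "b \<in> B" "w = (y + 0) + (z + b)"
      by (auto simp: add_coset_def algebra_simps)
    have "y + 0 \<in> hc y" "z + b \<in> hc z"
      unfolding add_coset_def using B_0 b(1) by blast+
    with b(2) show "w \<in> hc y + hc z"
      by (auto simp: set_plus_def)
  qed
qed

text \<open>All members of the coset have images in one coset, so the union in
  \<open>add_coset_map\<close> is that coset.\<close>

lemma H_act_hc:
  assumes "P \<in> D_Rt c" "z \<in> A"
  shows "H_act c f P (hc z) = hc (\<rho> P z)"
proof -
  have "hc (\<rho> P (z + b)) = hc (\<rho> P z)" if "b \<in> B" for b
    using \<rho>_add[OF assms B_subset_A[OF that]] \<rho>_B[OF assms(1) that] by (simp add: hc_eq_iff)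
  then show ?thesis
    unfolding H_act_def add_coset_map_def add_coset_def[of _ z] using B_0 by auto
qed

text \<open>Representatives in \<open>A\<close> of the submodule D_0 f \<delta>;
  \<open>N_denom\<close> is its image in H_f.\<close>

definition Z :: "'r poly tfrac set" where "Z = {\<rho> Q f\<delta> | Q. Q \<in> D_Rt_0 c}"

lemma Z_I: "Q \<in> D_Rt_0 c \<Longrightarrow> \<rho> Q f\<delta> \<in> Z"
  unfolding Z_def by blast

lemma Z_A: "y \<in> Z \<Longrightarrow> y \<in> A"
  unfolding Z_def using \<rho>_mem[OF D_Rt_0D f\<delta>_A] by blast

lemma Z_0: "0 \<in> Z"
  using Z_I[OF D_Rt_0_const[of 0]] \<rho>_times[OF f\<delta>_A, of 0] by (simp add: tfrac_0)

lemma Z_add: "y \<in> Z \<Longrightarrow> z \<in> Z \<Longrightarrow> y + z \<in> Z"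
  unfolding Z_def using D_Rt_0_plus \<rho>_plus[OF D_Rt_0D D_Rt_0D f\<delta>_A, symmetric] by blast

lemma Z_act: "P \<in> D_Rt_0 c \<Longrightarrow> y \<in> Z \<Longrightarrow> \<rho> P y \<in> Z"
  unfolding Z_def using D_Rt_0_comp(1) \<rho>_comp[OF D_Rt_0D D_Rt_0D f\<delta>_A, symmetric] by blast

lemma Z_minus: "y \<in> Z \<Longrightarrow> - y \<in> Z"
proof -
  assume y: "y \<in> Z"
  have "tfrac [:- 1:] 1 = (- 1 :: 'r poly tfrac)"
  proof -
    have "[:- 1:] = (- 1 :: 'r poly)"
      by (simp add: one_pCons)
    then show ?thesis
      using tfrac_minus[OF nonzerodivisor_1, of "1 :: 'r poly"] by (simp only: tfrac_1)
  qed
  then show ?thesis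
    using Z_act[OF D_Rt_0_const[of "- 1"] y] \<rho>_times[OF Z_A[OF y], of "[:- 1:]"] by simp
qed

lemma delta0_eq: "delta0 f = hc \<delta>"
  by (simp add: delta0_def \<delta>_def)

lemma N_denom_eq: "N_denom c f = hc ` Z"
proof -
  have "H_act c f ((*) [:f:]) (delta0 f) = hc f\<delta>"
    by (simp add: delta0_eq H_act_hc[OF D_Rt_times \<delta>_A] \<rho>_times[OF \<delta>_A] f\<delta>_def)
  then show ?thesis
    unfolding N_denom_def D0_span_def Z_def using H_act_hc[OF D_Rt_0D f\<delta>_A] by auto
qed

definition nc :: "'r poly tfrac \<Rightarrow> 'r poly tfrac set set" where
  "nc z = add_coset (N_denom c f) (hc z)"

lemma nc_eq: "nc z = hc ` add_coset Z z"
  unfolding nc_def N_denom_eq add_coset_def[of _ "hc z"] add_coset_def[of Z]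
  by (simp add: image_image hc_plus)

lemma nc_eqI: "y - z \<in> Z \<Longrightarrow> nc y = nc z"
  unfolding nc_eq using add_coset_subgroup_eq[of Z y z] Z_0 Z_add Z_minus by auto

lemma nc_0: "nc 0 = N_denom c f"
  by (simp add: nc_eq N_denom_eq add_coset_def)

lemma nc_eq_zero_iff: "nc z = N_denom c f \<longleftrightarrow> (\<exists>Q\<in>D_Rt_0 c. z - \<rho> Q f\<delta> \<in> B)"
proof
  assume "nc z = N_denom c f"
  moreover have "z \<in> add_coset Z z"
    using Z_0 unfolding add_coset_def by force
  ultimately have "hc z \<in> hc ` Z"
    unfolding nc_eq N_denom_eq by blast
  then show "\<exists>Q\<in>D_Rt_0 c. z - \<rho> Q f\<delta> \<in> B"
    by (auto simp: Z_def hc_eq_iff)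
next
  assume "\<exists>Q\<in>D_Rt_0 c. z - \<rho> Q f\<delta> \<in> B"
  then obtain Q where Q: "Q \<in> D_Rt_0 c" "hc z = hc (\<rho> Q f\<delta>)"
    by (auto simp: hc_eq_iff)
  then have "nc z = nc (\<rho> Q f\<delta>)"
    by (simp add: nc_def)
  also have "\<dots> = nc 0"
    by (rule nc_eqI) (simp add: Z_I Q)
  finally show "nc z = N_denom c f"
    by (simp add: nc_0)
qed

lemma N_module_eq: "N_module c f = {nc (\<rho> P \<delta>) | P. P \<in> D_Rt_0 c}"
proof -
  have "N_numer c f = {hc (\<rho> P \<delta>) | P. P \<in> D_Rt_0 c}"
    unfolding N_numer_def D0_span_def delta0_eq using H_act_hc[OF D_Rt_0D \<delta>_A] by auto
  then show ?thesis
    by (auto simp: N_module_def nc_def)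
qed

lemma N_act_nc:
  assumes P: "C_Zp_op p c \<phi> \<in> D_Rt_0 c" and z: "z \<in> A"
  shows "N_act p c f \<phi> (nc z) = nc (\<rho> (C_Zp_op p c \<phi>) z)"
proof -
  let ?P = "C_Zp_op p c \<phi>"
  have "add_coset (N_denom c f) (H_act c f ?P (hc (z + y))) = nc (\<rho> ?P z)" if y: "y \<in> Z" for y
  proof -
    have "H_act c f ?P (hc (z + y)) = hc (\<rho> ?P z + \<rho> ?P y)"
      using H_act_hc[OF D_Rt_0D[OF P] A_add[OF z Z_A[OF y]]] \<rho>_add[OF D_Rt_0D[OF P] z Z_A[OF y]] by simp
    moreover have "nc (\<rho> ?P z + \<rho> ?P y) = nc (\<rho> ?P z)"
      by (rule nc_eqI) (simp add: Z_act[OF P y])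
    ultimately show ?thesis
      by (simp add: nc_def)
  qed
  then show ?thesis
    unfolding N_act_def add_coset_map_def nc_eq[of z] add_coset_def[of Z] using Z_0 by auto
qed

text \<open>Since \<open>(f - t) \<Sum>\<^bsub>a<q\<^esub> f\<^bsup>q-1-a\<^esup> t\<^sup>a = f\<^sup>q - t\<^sup>q\<close> and operators of level \<open>q\<close> commute with \<open>f\<^sup>q - t\<^sup>q\<close>,
  \<open>P \<delta>\<close> has numerator \<open>\<Sum>\<^bsub>a<q\<^esub> P\<^sub>a(f\<^bsup>q-1-a\<^esup>) t\<^sup>a\<close> over \<open>f\<^sup>q - t\<^sup>q\<close>; for reasons of degree such a fraction
  lies in \<open>R[t, f\<^bsup>-1\<^esup>]\<close> only if it vanishes.\<close>
lemma difference_in_B_iff: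
  assumes P: "P \<in> D_Rt_0 c" and Q: "Q \<in> D_Rt_0 c"
  shows "\<exists>E0. \<forall>E\<ge>E0. \<rho> P \<delta> - \<rho> Q f\<delta> \<in> B \<longleftrightarrow>
    (\<forall>a<p ^ E. component P a (f ^ (p ^ E - Suc a)) = component Q a (f ^ (p ^ E - a)))"
proof -
  obtain E0 where E0: "\<forall>E\<ge>E0. \<forall>h y. P (h ^ (p ^ E) * y) = h ^ (p ^ E) * P y \<and>
      Q (h ^ (p ^ E) * y) = h ^ (p ^ E) * Q y"
    using D_Rt_power_common[OF D_Rt_0D[OF P] D_Rt_0D[OF Q]] by blast
  have "\<rho> P \<delta> - \<rho> Q f\<delta> \<in> B \<longleftrightarrow>
    (\<forall>a<p ^ E. component P a (f ^ (p ^ E - Suc a)) = component Q a (f ^ (p ^ E - a)))"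
    if E: "E0 \<le> E" for E
  proof -
    define q where "q = p ^ E"
    have q: "0 < q" using p_gt_0 by (simp add: q_def)
    have Pq: "P (h ^ q * y) = h ^ q * P y" and Qq: "Q (h ^ q * y) = h ^ q * Q y" for h y
      using E0[rule_format, OF E] by (auto simp: q_def)
    have linP: "linear_op (\<lambda>v. [:c v:]) P" and linQ: "linear_op (\<lambda>v. [:c v:]) Q"
      using D_Rt_linear D_Rt_0D P Q by blast+
    define U where "U = [:f:] ^ q - [:0, 1:] ^ q"
    define W where "W = (\<Sum>a<q. monom (f ^ (q - Suc a)) a)"
    have U: "U = [:f ^ q:] - monom 1 q"
      unfolding U_def t_power by (simp add: const_power)
    have nzU: "nonzerodivisor U"
      unfolding U by (rule nonzerodivisor_const_minus_t_power[OF q])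
    have PU: "P (U * y) = U * P y" for y
      by (simp only: U_def left_diff_distrib linear_op_diff[OF linP] Pq)
    have QU: "Q (U * y) = U * Q y" for y
      by (simp only: U_def left_diff_distrib linear_op_diff[OF linQ] Qq)
    have "U = ([:f:] - [:0, 1:]) * (\<Sum>a<q. [:0, 1:] ^ (q - Suc a) * [:f:] ^ a)"
      unfolding U_def by (rule power_diff_sumr2)
    also have "(\<Sum>a<q. [:0, 1:] ^ (q - Suc a) * [:f:] ^ a) = (\<Sum>a<q. [:0, 1:] ^ a * [:f:] ^ (q - Suc a))"
      by (subst sum.nat_diff_reindex[symmetric]) (auto intro!: sum.cong)
    also have "\<dots> = W"
      unfolding W_def t_power const_power by (intro sum.cong) (simp_all add: smult_monom mult.commute)
    finally have UW: "U = [:f, -1:] * W" by simp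
    have "tfrac U 1 * \<delta> = tfrac W 1"
      by (simp add: \<delta>_def tfrac_mult tfrac_eq_iff nonzerodivisor_1 nonzerodivisor_f_minus_t UW mult.commute
          del: mult_pCons_left mult_pCons_right)
    then have P\<delta>: "tfrac U 1 * \<rho> P \<delta> = tfrac (P W) 1"
      using \<rho>_commute[OF D_Rt_0D[OF P] \<delta>_A PU] \<rho>_const[OF D_Rt_0D[OF P]] by simp
    have "tfrac U 1 * f\<delta> = tfrac [:f:] 1 * tfrac W 1"
      using \<open>tfrac U 1 * \<delta> = tfrac W 1\<close> unfolding f\<delta>_def by (metis mult.left_commute)
    then have "tfrac U 1 * f\<delta> = tfrac ([:f:] * W) 1"
      by (simp add: tfrac_mult nonzerodivisor_1)
    then have Q\<delta>: "tfrac U 1 * \<rho> Q f\<delta> = tfrac (Q ([:f:] * W)) 1"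
      using \<rho>_commute[OF D_Rt_0D[OF Q] f\<delta>_A QU] \<rho>_const[OF D_Rt_0D[OF Q]] by simp
    define G where "G = P W - Q ([:f:] * W)"
    have "tfrac U 1 * (\<rho> P \<delta> - \<rho> Q f\<delta>) = tfrac (P W) 1 + - tfrac (Q ([:f:] * W)) 1"
      by (simp add: right_diff_distrib P\<delta> Q\<delta>)
    also have "\<dots> = tfrac G 1"
      by (simp add: tfrac_minus tfrac_add nonzerodivisor_1 G_def)
    finally have eq: "\<rho> P \<delta> - \<rho> Q f\<delta> = tfrac G U"
      by (simp add: tfrac_scale_eq_iff[OF nzU])
    have coeff_W: "coeff W a = (if a < q then f ^ (q - Suc a) else 0)" for a
      by (simp add: W_def coeff_sum)
    have coeff_G: "coeff G a = (if a < q then component P a (f ^ (q - Suc a)) - component Q a (f ^ (q - a)) else 0)" for a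
    proof -
      have "f * f ^ (q - Suc a) = f ^ (q - a)" if "a < q"
        using that by (simp add: power_Suc[symmetric] Suc_diff_Suc del: power_Suc)
      then show ?thesis
        by (simp add: G_def D_Rt_0_coeff P Q coeff_W component_0 D_Rt_0D)
    qed
    have "tfrac G U \<in> B \<longleftrightarrow> G = 0"
    proof
      assume "tfrac G U \<in> B"
      then obtain g k where "tfrac G U = tfrac g ([:f:] ^ k)"
        unfolding loc_f_def by blast
      then have *: "U * g = [:f:] ^ k * G"
        by (simp add: tfrac_eq_iff nzU nzd_F mult.commute)
      \<comment> \<open>The right side of \<open>*\<close> has t-degree below q, as f^k contributes
        none, while a nonzero multiple of \<open>U\<close> has degree at least q.\<close>
      have "g = 0"
        by (rule const_minus_t_power_mult[OF q *[unfolded U]]) (simp add: const_power coeff_G)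
      with * show "G = 0"
        using nzd_F[of k] by (simp add: nonzerodivisor_def)
    next
      assume "G = 0"
      then show "tfrac G U \<in> B"
        using B_0 by (simp add: tfrac_zero_num[OF nzU])
    qed
    also have "\<dots> \<longleftrightarrow> (\<forall>a<q. component P a (f ^ (q - Suc a)) = component Q a (f ^ (q - a)))"
      by (auto simp: poly_eq_iff coeff_G)
    finally show ?thesis
      by (simp add: eq q_def)
  qed
  then show ?thesis by blast
qed

end

section \<open>Vanishing of the localization and the functional equation\<close>

context bs_setting
begin

lemma C_Zp_op_graded: "C_Zp_op p c \<phi> = graded_op (\<lambda>a r. c (\<phi> (Zp_of_int p (- 1 - int a))) * r)"
  by (simp add: C_Zp_op_def graded_op_def fun_eq_iff)

lemma component_C_Zp_op: "component (C_Zp_op p c \<phi>) a r = c (\<phi> (Zp_of_int p (- 1 - int a))) * r"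
  unfolding C_Zp_op_graded by (simp add: component_graded_op)

lemma mod_periodic: "(- 1 - int (a + p ^ e)) mod int p ^ e = (- 1 - int a) mod int p ^ e"
proof -
  have eq: "- 1 - int (a + p ^ e) = (- 1 - int a) + - 1 * int p ^ e" by simp
  show ?thesis
    unfolding eq by (rule mod_mult_self1)
qed

text \<open>At level \<open>e\<close> the scalars \<phi>(-1-a) are periodic in a modulo p^e.\<close>

lemma C_Zp_op_D:
  assumes "has_level p e \<phi>"
  shows "C_Zp_op p c \<phi> \<in> D_Rt_0 c"
  unfolding C_Zp_op_graded
proof (rule graded_op_D_Rt_0[where e = e])
  fix a
  have "\<phi> (Zp_of_int p (- 1 - int (a + p ^ e))) = \<phi> (Zp_of_int p (- 1 - int a))"
    using mod_periodic[of a e]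
    by (intro has_levelD[OF assms] Zp_of_int_Zp p_gt_0) (simp add: Zp_of_int_def)
  then show "(\<lambda>r. c (\<phi> (Zp_of_int p (- 1 - int (a + p ^ e)))) * r) =
      (\<lambda>r. c (\<phi> (Zp_of_int p (- 1 - int a))) * r)"
    by simp
qed (simp_all add: linear_op_times mult.left_commute)

text \<open>The indicator function w of a small ball around \<alpha> lies outside the maximal ideal
  and annihilates N_f. It acts by a scalar in each degree, so it commutes with degree-zero P, and w
  P \<delta> = P w \<delta> = P K f \<delta> in H_f, where K is Q in the degrees selected by the
  ball and zero elsewhere.\<close>

lemma localized_zero_if_functional_eq:
  assumes m: "1 \<notin> m" "0 \<in> m" and \<alpha>: "\<alpha> \<in> Zp p" and eq: "has_functional_eq p c f \<alpha>"
    and \<xi>: "\<xi> \<in> N_localized p m c f \<alpha>"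
  shows "\<xi> = N_localized_zero p m c f \<alpha>"
proof -
  obtain Q e where Q: "Q \<in> diff_ops c" "\<forall>\<nu>. int \<nu> mod int p ^ e = \<alpha> e \<longrightarrow> Q (f ^ Suc \<nu>) = f ^ \<nu>"
    using eq by (auto simp: has_functional_eq_def)
  obtain E0 where E0: "\<forall>E\<ge>E0. \<forall>h y. Q (h ^ (p ^ E) * y) = h ^ (p ^ E) * Q y"
    using RD.diff_op_power[OF Q(1)] by blast
  define e' where "e' = max e E0"
  have Q_power: "Q (h ^ (p ^ e') * y) = h ^ (p ^ e') * Q y" for h y
    using E0 by (simp add: e'_def)
  have linQ: "linear_op c Q"
    by (rule RD.diff_opD[OF Q(1)])
  define w where "w = restrict (\<lambda>\<beta>. if \<beta> e' = \<alpha> e' then 1 else 0 :: 'v) (Zp p)"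
  have level: "has_level p e' w"
    by (auto simp: has_level_def w_def)
  have w_C: "w \<in> C_Zp p"
    by (rule has_level_C_Zp[OF level]) (simp add: w_def)
  have w_\<alpha>: "w \<alpha> \<notin> m"
    using m \<alpha> by (simp add: w_def)
  define S where "S = C_Zp p - C_Zp_maximal p m \<alpha>"
  have w_S: "w \<in> S"
    using w_C w_\<alpha> by (simp add: S_def C_Zp_maximal_def)
  define K where "K = graded_op (\<lambda>a r. if (- 1 - int a) mod int p ^ e' = \<alpha> e' then Q r else 0)"
  have comp_K: "component K a r = (if (- 1 - int a) mod int p ^ e' = \<alpha> e' then Q r else 0)" for a r
    unfolding K_def by (simp add: component_graded_op linear_op_0[OF linQ])
  have K: "K \<in> D_Rt_0 c"
    unfolding K_def
  proof (rule graded_op_D_Rt_0[where e = e'])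
    fix a
    show "linear_op c (\<lambda>r. if (- 1 - int a) mod int p ^ e' = \<alpha> e' then Q r else 0)"
      using linQ by (simp add: linear_op_def)
    show "(\<lambda>r. if (- 1 - int (a + p ^ e')) mod int p ^ e' = \<alpha> e' then Q r else 0) =
        (\<lambda>r. if (- 1 - int a) mod int p ^ e' = \<alpha> e' then Q r else 0)"
      by (simp only: mod_periodic)
  qed (simp add: Q_power)
  have w_D: "C_Zp_op p c w \<in> D_Rt_0 c"
    by (rule C_Zp_op_D[OF level])
  have kill: "N_act p c f w (nc (\<rho> P \<delta>)) = N_denom c f" if P: "P \<in> D_Rt_0 c" for P
  proof -
    let ?L = "C_Zp_op p c w \<circ> P" and ?R = "P \<circ> K"
    obtain E1 where E1: "\<forall>E\<ge>E1. \<rho> ?L \<delta> - \<rho> ?R f\<delta> \<in> B \<longleftrightarrow>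
        (\<forall>a<p ^ E. component ?L a (f ^ (p ^ E - Suc a)) = component ?R a (f ^ (p ^ E - a)))"
      using difference_in_B_iff[OF D_Rt_0_comp(1)[OF w_D P] D_Rt_0_comp(1)[OF P K]] by blast
    define E where "E = max E1 e'"
    have "component ?L a (f ^ (p ^ E - Suc a)) = component ?R a (f ^ (p ^ E - a))" if a: "a < p ^ E" for a
    proof -
      have w_a: "w (Zp_of_int p (- 1 - int a)) = (if (- 1 - int a) mod int p ^ e' = \<alpha> e' then 1 else 0)"
        using Zp_of_int_Zp[OF p_gt_0] by (simp add: w_def Zp_of_int_def)
      show ?thesis
      proof (cases "(- 1 - int a) mod int p ^ e' = \<alpha> e'")
        case True
        \<comment> \<open>The exponent of f in degree \<open>a\<close> is congruent to -1-a modulo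
          p^e', hence to \<alpha>.\<close>
        have "int (p ^ E - Suc a) = - 1 - int a + int p ^ e' * int p ^ (E - e')"
          using a by (simp add: of_nat_diff Suc_le_eq power_add[symmetric] E_def)
        then have "int (p ^ E - Suc a) mod int p ^ e' = \<alpha> e'"
          using True by simp
        then have "int (p ^ E - Suc a) mod int p ^ e = \<alpha> e"
          by (rule Zp_cong_le[OF \<alpha>, rotated]) (simp add: e'_def)
        then have "Q (f ^ Suc (p ^ E - Suc a)) = f ^ (p ^ E - Suc a)"
          using Q(2) by blast
        moreover have "Suc (p ^ E - Suc a) = p ^ E - a"
          using a by simp
        ultimately show ?thesis
          using True by (simp add: D_Rt_0_comp(2)[OF w_D P] D_Rt_0_comp(2)[OF P K] component_C_Zp_op
              comp_K w_a c_simps)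
      next
        case False
        then show ?thesis
          by (simp add: D_Rt_0_comp(2)[OF w_D P] D_Rt_0_comp(2)[OF P K] component_C_Zp_op
              comp_K w_a c_simps component_0[OF D_Rt_0D[OF P]])
      qed
    qed
    moreover have "E1 \<le> E" by (simp add: E_def)
    ultimately have "\<rho> ?L \<delta> - \<rho> ?R f\<delta> \<in> B"
      using E1 by blast
    then have "nc (\<rho> ?L \<delta>) = N_denom c f"
      using nc_eq_zero_iff D_Rt_0_comp(1)[OF P K] by blast
    then show ?thesis
      using N_act_nc[OF w_D \<rho>_mem[OF D_Rt_0D[OF P] \<delta>_A]] \<rho>_comp[OF D_Rt_0D[OF w_D] D_Rt_0D[OF P] \<delta>_A]
      by simp
  qed
  have act_M: "N_act p c f t u \<in> N_module c f" if "t \<in> S" "u \<in> N_module c f" for t u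
  proof -
    obtain l where "has_level p l t"
      using C_Zp_has_level[OF p_gt_0, of t] \<open>t \<in> S\<close> by (auto simp: S_def)
    then have t: "C_Zp_op p c t \<in> D_Rt_0 c"
      by (rule C_Zp_op_D)
    obtain P where P: "P \<in> D_Rt_0 c" "u = nc (\<rho> P \<delta>)"
      using \<open>u \<in> N_module c f\<close> by (auto simp: N_module_eq)
    have "N_act p c f t u = nc (\<rho> (C_Zp_op p c t \<circ> P) \<delta>)"
      using N_act_nc[OF t \<rho>_mem[OF D_Rt_0D[OF P(1)] \<delta>_A]]
        \<rho>_comp[OF D_Rt_0D[OF t] D_Rt_0D[OF P(1)] \<delta>_A] P(2) by simp
    then show ?thesis
      using D_Rt_0_comp(1)[OF t P(1)] by (auto simp: N_module_eq)
  qed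
  have kill_M: "N_act p c f w u = N_denom c f" if "u \<in> N_module c f" for u
    using that kill by (auto simp: N_module_eq)
  \<comment> \<open>Multiplication by \<open>w\<close> makes both sides zero, so any two fractions
    are equal.\<close>
  have rel: "((u, s), (v, t)) \<in> module_loc_rel S (N_act p c f) (N_module c f)"
    if "u \<in> N_module c f" "s \<in> S" "v \<in> N_module c f" "t \<in> S" for u s v t
    unfolding module_loc_rel_def using that w_S kill_M[OF act_M] by (auto intro!: bexI[of _ w])
  have rel_eq: "module_loc_rel S (N_act p c f) (N_module c f) `` {(u, s)} = N_module c f \<times> S"
    if "u \<in> N_module c f" "s \<in> S" for u s
    using rel[OF that] by (auto simp: module_loc_rel_def)
  have "nc (\<rho> ((*) [:0:]) \<delta>) = N_denom c f"
    using nc_0 \<rho>_times[OF \<delta>_A, of 0] by (simp add: tfrac_0)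
  then have zero_M: "N_denom c f \<in> N_module c f"
    unfolding N_module_eq using D_Rt_0_const[of 0] by blast
  have "has_level p 0 (C_Zp_one p :: _ \<Rightarrow> 'v)"
    by (simp add: has_level_def C_Zp_one_def)
  then have "(C_Zp_one p :: _ \<Rightarrow> 'v) \<in> C_Zp p"
    by (rule has_level_C_Zp) (simp add: C_Zp_one_def)
  then have one_S: "C_Zp_one p \<in> S"
    using m(1) \<alpha> by (simp add: S_def C_Zp_maximal_def C_Zp_one_def)
  obtain u s where "u \<in> N_module c f" "s \<in> S"
    "\<xi> = module_loc_rel S (N_act p c f) (N_module c f) `` {(u, s)}"
    using \<xi> unfolding N_localized_def module_loc_def quotient_def S_def by blast
  then show ?thesis
    unfolding N_localized_zero_def S_def[symmetric] by (simp add: rel_eq zero_M one_S)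
qed

text \<open>Vanishing of \<delta>/1 gives w with w(\<alpha>) a unit and w \<delta> = K f \<delta> in
  H_f. In degrees a with -1-a near \<alpha> this reads w(\<alpha>) f^\<nu> = K_a(f^(\<nu>+1)), and
  by periodicity one component of K serves them all.\<close>

lemma functional_eq_if_localized_zero:
  assumes unit: "\<And>u. u \<notin> m \<Longrightarrow> \<exists>w. u * w = 1" and m: "1 \<notin> m" and \<alpha>: "\<alpha> \<in> Zp p"
    and zero: "\<And>\<xi>. \<xi> \<in> N_localized p m c f \<alpha> \<Longrightarrow> \<xi> = N_localized_zero p m c f \<alpha>"
  shows "has_functional_eq p c f \<alpha>"
proof -
  define S where "S = C_Zp p - C_Zp_maximal p m \<alpha>"
  let ?rel = "module_loc_rel S (N_act p c f) (N_module c f)"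
  have one_level: "has_level p 0 (C_Zp_one p :: _ \<Rightarrow> 'v)"
    by (simp add: has_level_def C_Zp_one_def)
  then have "(C_Zp_one p :: _ \<Rightarrow> 'v) \<in> C_Zp p"
    by (rule has_level_C_Zp) (simp add: C_Zp_one_def)
  then have one_S: "C_Zp_one p \<in> S"
    using m \<alpha> by (simp add: S_def C_Zp_maximal_def C_Zp_one_def)
  have one_D: "(*) 1 \<in> D_Rt_0 c"
    using D_Rt_0_const[of 1] by (simp add: one_pCons)
  have one_op: "C_Zp_op p c (C_Zp_one p) = (*) 1"
    using Zp_of_int_Zp[OF p_gt_0]
    by (auto simp: C_Zp_op_def C_Zp_one_def c_simps poly_as_sum_of_monoms fun_eq_iff)
  have one_act: "N_act p c f (C_Zp_one p) (nc z) = nc z" if "z \<in> A" for z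
    using N_act_nc[of "C_Zp_one p" z] that \<rho>_times[OF that, of 1]
    by (simp add: one_op one_D tfrac_1)
  have "\<rho> ((*) 1) \<delta> = \<delta>"
    using \<rho>_times[OF \<delta>_A, of 1] by (simp add: tfrac_1)
  then have \<delta>_M: "nc \<delta> \<in> N_module c f"
    unfolding N_module_eq using one_D by force
  let ?u = "(nc \<delta>, C_Zp_one p)"
  have "?rel `` {?u} \<in> N_localized p m c f \<alpha>"
    unfolding N_localized_def module_loc_def S_def[symmetric]
    using \<delta>_M one_S by (intro quotientI) simp
  then have "?rel `` {?u} = ?rel `` {(N_denom c f, C_Zp_one p)}"
    using zero by (simp add: N_localized_zero_def S_def)
  moreover have "?u \<in> ?rel `` {?u}"
    using \<delta>_M one_S by (auto simp: module_loc_rel_def)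
  ultimately have "((N_denom c f, C_Zp_one p), ?u) \<in> ?rel"
    by blast
  then obtain w where w: "w \<in> S" "N_act p c f w (N_act p c f (C_Zp_one p) (nc 0)) =
      N_act p c f w (N_act p c f (C_Zp_one p) (nc \<delta>))"
    by (auto simp: module_loc_rel_def nc_0)
  obtain e where e: "has_level p e w"
    using C_Zp_has_level[OF p_gt_0, of w] w(1) by (auto simp: S_def)
  have w_D: "C_Zp_op p c w \<in> D_Rt_0 c"
    by (rule C_Zp_op_D[OF e])
  have "0 \<in> A"
    using const_A[of 0] by (simp add: tfrac_0)
  have "\<rho> (C_Zp_op p c w) 0 = 0"
    using \<rho>_const[OF D_Rt_0D[OF w_D], of 0] linear_op_0[OF D_Rt_linear[OF D_Rt_0D[OF w_D]]]
    by (simp add: tfrac_0)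
  then have "nc (\<rho> (C_Zp_op p c w) \<delta>) = N_denom c f"
    using w(2) unfolding one_act[OF \<open>0 \<in> A\<close>] one_act[OF \<delta>_A]
      N_act_nc[OF w_D \<open>0 \<in> A\<close>] N_act_nc[OF w_D \<delta>_A] by (simp add: nc_0)
  then obtain K where K: "K \<in> D_Rt_0 c" "\<rho> (C_Zp_op p c w) \<delta> - \<rho> K f\<delta> \<in> B"
    unfolding nc_eq_zero_iff by blast
  obtain E0 where E0: "\<forall>E\<ge>E0. \<forall>a<p ^ E.
      component (C_Zp_op p c w) a (f ^ (p ^ E - Suc a)) = component K a (f ^ (p ^ E - a))"
    using difference_in_B_iff[OF w_D K(1)] K(2) by blast
  obtain E1 where E1: "\<forall>E\<ge>E1. \<forall>a. component K (a + p ^ E) = component K a"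
    using component_power[OF K(1)] by blast
  have "w \<alpha> \<notin> m"
    using w(1) by (simp add: S_def C_Zp_maximal_def)
  then obtain v where v: "w \<alpha> * v = 1"
    using unit by blast
  define e1 where "e1 = max e E1"
  \<comment> \<open>The degree below p^e1 for which -1-a0 is congruent to \<alpha>; it is
    nonnegative because \<alpha> e1 <= p^e1 - 1.\<close>
  define a0 where "a0 = nat (int p ^ e1 - 1 - \<alpha> e1)"
  have a0: "int a0 = int p ^ e1 - 1 - \<alpha> e1"
    using Zp_range(2)[OF \<alpha>, of e1] by (simp add: a0_def)
  have periodic: "component K (a0 + p ^ e1 * b) = component K a0" for b
  proof (induction b)
    case (Suc b)
    have "component K (a0 + p ^ e1 * Suc b) = component K (a0 + p ^ e1 * b + p ^ e1)"
      by (simp add: algebra_simps)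
    also have "\<dots> = component K (a0 + p ^ e1 * b)"
      using E1 by (simp add: e1_def)
    finally show ?case using Suc by simp
  qed simp
  define Q where "Q r = c v * component K a0 r" for r
  have "Q \<in> diff_ops c"
    unfolding Q_def by (rule RD.diff_op_comp[OF RD.diff_op_times component_diff_op[OF K(1)]])
  moreover have "Q (f ^ Suc \<nu>) = f ^ \<nu>" if \<nu>: "int \<nu> mod int p ^ e1 = \<alpha> e1" for \<nu>
  proof -
    \<comment> \<open>Large enough to compare coefficients at level \<open>E\<close>, for p^e1 to
      divide p^E, and for the degree p^E - 1 - \<nu> to be nonnegative.\<close>
    define E where "E = max (max E0 e1) (Suc \<nu>)"
    have "Suc \<nu> < p ^ Suc \<nu>"
      using prime by (intro power_gt_expt prime_gt_Suc_0_nat)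
    also have "\<dots> \<le> p ^ E"
      using p_gt_0 by (intro power_increasing) (auto simp: E_def)
    finally have lt: "Suc \<nu> < p ^ E" .
    define a where "a = p ^ E - Suc \<nu>"
    have a: "a < p ^ E" "p ^ E - Suc a = \<nu>" "p ^ E - a = Suc \<nu>"
      using lt by (auto simp: a_def)
    have int_a: "int a = int p ^ e1 * int p ^ (E - e1) - 1 - int \<nu>"
      using lt by (simp add: a_def of_nat_diff power_add[symmetric] E_def)
    obtain b where b: "a = a0 + p ^ e1 * b"
    proof -
      define j where "j = int \<nu> div int p ^ e1"
      have "int \<nu> = \<alpha> e1 + int p ^ e1 * j"
        using \<nu> mult_div_mod_eq[of "int p ^ e1" "int \<nu>"] by (simp add: j_def)
      then have eq: "int a = int a0 + int p ^ e1 * (int p ^ (E - e1) - 1 - j)"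
        unfolding int_a a0 by (simp add: algebra_simps)
      \<comment> \<open>A negative quotient would give a <= a0 - p^e1 < 0.\<close>
      have "0 \<le> int p ^ (E - e1) - 1 - j"
      proof (rule ccontr)
        assume "\<not> ?thesis"
        then have "int p ^ e1 * (int p ^ (E - e1) - 1 - j) \<le> int p ^ e1 * (- 1)"
          using p_gt_0 by (intro mult_left_mono) auto
        then have "int a < 0"
          using eq a0 Zp_range(1)[OF \<alpha>, of e1] by simp
        then show False by simp
      qed
      then obtain b where "int p ^ (E - e1) - 1 - j = int b"
        using nonneg_int_cases by blast
      with eq have "int a = int (a0 + p ^ e1 * b)" by simp
      then have "a = a0 + p ^ e1 * b"
        by (simp only: of_nat_eq_iff)
      then show thesis by (rule that)
    qed
    have "(- 1 - int a) mod int p ^ e1 = \<alpha> e1"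
    proof -
      have eq: "- 1 - int a = int \<nu> + int p ^ e1 * (- (int p ^ (E - e1)))"
        by (simp add: int_a)
      show ?thesis
        using \<nu> unfolding eq by (simp only: mod_mult_self2)
    qed
    then have "(- 1 - int a) mod int p ^ e = \<alpha> e"
      by (rule Zp_cong_le[OF \<alpha>, rotated]) (simp add: e1_def)
    then have "w (Zp_of_int p (- 1 - int a)) = w \<alpha>"
      by (intro has_levelD[OF e] Zp_of_int_Zp p_gt_0 \<alpha>) (simp add: Zp_of_int_def)
    moreover have "component (C_Zp_op p c w) a (f ^ \<nu>) = component K a (f ^ Suc \<nu>)"
    proof -
      have "E0 \<le> E" by (simp add: E_def)
      from E0[rule_format, OF this a(1)] show ?thesis
        unfolding a(2,3) .
    qed
    ultimately have "c (w \<alpha>) * f ^ \<nu> = component K a0 (f ^ Suc \<nu>)"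
      using periodic[of b] by (simp add: component_C_Zp_op b)
    then have "Q (f ^ Suc \<nu>) = c (w \<alpha> * v) * f ^ \<nu>"
      unfolding Q_def by (simp add: c_simps mult_ac)
    then show ?thesis
      by (simp add: v c_simps)
  qed
  ultimately show ?thesis
    unfolding has_functional_eq_def by blast
qed

lemma bernstein_sato_root_iff:
  assumes "\<And>u. u \<notin> m \<Longrightarrow> \<exists>w. u * w = 1" "1 \<notin> m" "0 \<in> m" "\<alpha> \<in> Zp p"
  shows "bernstein_sato_root p m c f \<alpha> \<longleftrightarrow> \<not> has_functional_eq p c f \<alpha>"
  using localized_zero_if_functional_eq[OF assms(2-4)] functional_eq_if_localized_zero[OF assms(1,2,4)] assms(4)
  unfolding bernstein_sato_root_def by blast

end

section \<open>Negative rational \<open>p\<close>-adic integers\<close>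

text \<open>The denominator is invertible modulo p^k, so the residue in the definition is
  unique.\<close>

lemma Zp_of_rat_eq:
  assumes "coprime (snd (quotient_of q)) (int p)" "0 < p"
    and y: "(y * snd (quotient_of q)) mod int p ^ k = fst (quotient_of q) mod int p ^ k"
  shows "Zp_of_rat p q k = y mod int p ^ k"
  unfolding Zp_of_rat_def
proof (rule the_equality)
  let ?d = "snd (quotient_of q)"
  show "y mod int p ^ k \<in> {0..<int p ^ k} \<and>
      y mod int p ^ k * ?d mod int p ^ k = fst (quotient_of q) mod int p ^ k"
    using assms(2) y by (simp add: mod_mult_left_eq)
  fix z assume z: "z \<in> {0..<int p ^ k} \<and> z * ?d mod int p ^ k = fst (quotient_of q) mod int p ^ k"
  then have "int p ^ k dvd z * ?d - y * ?d"
    using y by (simp add: mod_eq_dvd_iff[symmetric])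
  then have "int p ^ k dvd (z - y) * ?d"
    by (simp add: left_diff_distrib)
  moreover have "coprime (int p ^ k) ?d"
    using assms(1) by (simp add: coprime_commute)
  ultimately have "int p ^ k dvd z - y"
    by (simp add: coprime_dvd_mult_left_iff)
  then have "z mod int p ^ k = y mod int p ^ k"
    by (simp add: mod_eq_dvd_iff)
  with z show "z = y mod int p ^ k" by simp
qed

text \<open>Two powers of \<open>p\<close> agree modulo \<open>d\<close> by pigeonhole, and the
  smaller one cancels.\<close>

lemma power_minus_one_divisible:
  fixes d p :: int
  assumes "coprime d p" "0 < d"
  shows "\<exists>k>0. d dvd p ^ k - 1"
proof -
  have "\<not> inj (\<lambda>i. p ^ i mod d)"
  proof
    assume "inj (\<lambda>i. p ^ i mod d)"
    moreover have "range (\<lambda>i. p ^ i mod d) \<subseteq> {0..<d}"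
      using assms(2) by auto
    ultimately have "finite (UNIV :: nat set)"
      by (meson finite_atLeastLessThan_int finite_imageD finite_subset)
    then show False by simp
  qed
  then obtain i j where "i \<noteq> j" "p ^ i mod d = p ^ j mod d"
    by (auto simp: inj_def)
  then obtain i k where ik: "0 < k" "p ^ (i + k) mod d = p ^ i mod d"
    by (metis less_imp_add_positive linorder_neqE_nat)
  then have "d dvd p ^ (i + k) - p ^ i"
    by (simp add: mod_eq_dvd_iff)
  then have "d dvd p ^ i * (p ^ k - 1)"
    by (simp add: power_add right_diff_distrib)
  moreover have "coprime d (p ^ i)"
    using assms(1) by simp
  ultimately have "d dvd p ^ k - 1"
    by (simp add: coprime_dvd_mult_right_iff)
  with ik(1) show ?thesis by blast
qed

text \<open>The denominator divides p^k - 1 for some k > 0, so q = -a/(p^k - 1) = a + a p^k + a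
  p^(2k) + ... p-adically, and N e is the sum of the first e terms. As a may exceed p^k, N e need
  not be a reduced residue.\<close>

lemma negative_rat_expansion:
  assumes p: "prime p" and q: "q < 0" "\<not> int p dvd snd (quotient_of q)"
  shows "Zp_of_rat p q \<in> Zp p"
    and "\<exists>a k N. 0 < a \<and> 0 < k \<and> N 0 = 0 \<and> (\<forall>e. N (Suc e) = p ^ k * N e + a) \<and>
      (\<forall>e. int (N e) mod int p ^ (k * e) = Zp_of_rat p q (k * e))"
proof -
  define d where "d = snd (quotient_of q)"
  define b where "b = fst (quotient_of q)"
  have d: "0 < d"
    unfolding d_def by (rule quotient_of_denom_pos')
  have "q = of_int b / of_int d"
    unfolding b_def d_def by (rule quotient_of_div) simp
  with q(1) d have b: "b < 0"
    by (simp add: divide_less_0_iff)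
  have p0: "0 < p" using p by (rule prime_gt_0_nat)
  have cop: "coprime d (int p)"
    using prime_imp_coprime[of "int p" d] p q(2) by (simp add: d_def coprime_commute)
  obtain k where k: "0 < k" "d dvd int p ^ k - 1"
    using power_minus_one_divisible[OF cop d] by blast
  \<comment> \<open>q = b/d is rewritten over the denominator p^k - 1; b < 0 makes \<open>a\<close>
    positive.\<close>
  define a where "a = nat (- b * ((int p ^ k - 1) div d))"
  have "1 < int p ^ k"
    using prime_gt_1_nat[OF p] k(1) by (simp add: one_less_power)
  then have pos: "0 < (int p ^ k - 1) div d"
    using zdvd_imp_le[OF k(2)] d by (simp add: pos_imp_zdiv_pos_iff)
  then have a_pos: "0 < - b * ((int p ^ k - 1) div d)"
    using b by (simp add: mult_pos_pos mult_neg_pos)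
  then have a: "0 < a" and "int a = - b * ((int p ^ k - 1) div d)"
    by (simp_all add: a_def)
  then have ad: "int a * d = - b * (int p ^ k - 1)"
    using k(2) by (simp add: mult.assoc)
  define N where "N = rec_nat 0 (\<lambda>_ y. p ^ k * y + a)"
  have N: "N 0 = 0" "N (Suc e) = p ^ k * N e + a" for e
    by (simp_all add: N_def)
  \<comment> \<open>The geometric sum cleared of denominators: modulo p^(k e), N e times d is the
    numerator b.\<close>
  have Nd: "int (N e) * d = b - b * int p ^ (k * e)" for e
  proof (induction e)
    case (Suc e)
    have "int (N (Suc e)) * d = int p ^ k * (int (N e) * d) + int a * d"
      by (simp add: N algebra_simps)
    also have "\<dots> = b - b * int p ^ (k * Suc e)"
      unfolding Suc ad by (simp add: power_add algebra_simps)
    finally show ?case .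
  qed (simp add: N)
  have eq: "Zp_of_rat p q l = int (N e) mod int p ^ l" if "l \<le> k * e" for l e
  proof (rule Zp_of_rat_eq)
    have "int p ^ l dvd b * int p ^ (k * e)"
      using that by (simp add: le_imp_power_dvd)
    then show "int (N e) * snd (quotient_of q) mod int p ^ l = fst (quotient_of q) mod int p ^ l"
      unfolding d_def[symmetric] b_def[symmetric] Nd by (simp add: mod_eq_dvd_iff)
  qed (use cop p0 d_def in auto)
  have le: "l \<le> k * l" for l
    using k(1) by (cases k) auto
  show "Zp_of_rat p q \<in> Zp p"
    unfolding Zp_def
  proof (intro CollectI allI conjI)
    fix l
    show "Zp_of_rat p q l \<in> {0..<int p ^ l}"
      using eq[OF le] p0 by simp
    have "Zp_of_rat p q (Suc l) mod int p ^ l = int (N (Suc l)) mod int p ^ l"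
      unfolding eq[OF le[of "Suc l"]] by (simp only: mod_mod_cancel le_imp_power_dvd le_SucI order_refl)
    also have "\<dots> = Zp_of_rat p q l"
      using eq[of l "Suc l"] le[of "Suc l"] by simp
    finally show "Zp_of_rat p q (Suc l) mod int p ^ l = Zp_of_rat p q l" .
  qed
  have "\<forall>e. int (N e) mod int p ^ (k * e) = Zp_of_rat p q (k * e)"
    using eq[OF order_refl] by simp
  with a k(1) N show "\<exists>a k N. 0 < a \<and> 0 < k \<and> N 0 = 0 \<and> (\<forall>e. N (Suc e) = p ^ k * N e + a) \<and>
      (\<forall>e. int (N e) mod int p ^ (k * e) = Zp_of_rat p q (k * e))"
    by blast
qed

theorem theorem4p12:
  fixes p n :: nat
    and m :: "'v::comm_ring_1 set"
    and \<pi> :: "'v \<Rightarrow> 'k::field"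
    and F :: "'v \<Rightarrow> 'v"
    and c :: "'v \<Rightarrow> 'r::comm_ring_1" and x :: "nat \<Rightarrow> 'r"
    and c\<^sub>0 :: "'k \<Rightarrow> 's::comm_ring_1" and x\<^sub>0 :: "nat \<Rightarrow> 's"
    and red :: "'r \<Rightarrow> 's"
    and f :: 'r
    and \<alpha> :: rat
  assumes V: "artinian_ring TYPE('v)" "local_ring m"
    and residue_field: "is_ring_hom \<pi>" "surj \<pi>" "{v. \<pi> v = 0} = m"
    and char: "CHAR('k) = p" "p > 0"
    and F: "is_ring_hom F" "bij F" "\<And>v. \<pi> (F v) = \<pi> v ^ p"
    and R: "polynomial_ring c n x"
    and R\<^sub>0: "polynomial_ring c\<^sub>0 n x\<^sub>0"
    and reduction: "is_ring_hom red" "\<And>v. red (c v) = c\<^sub>0 (\<pi> v)"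
      "\<And>i. i < n \<Longrightarrow> red (x i) = x\<^sub>0 i"
    and f: "nonzerodivisor f"
    and \<alpha>: "\<alpha> < 0" "\<not> int p dvd snd (quotient_of \<alpha>)"
  shows "bernstein_sato_root p m c f (Zp_of_rat p \<alpha>) \<longleftrightarrow>
    bernstein_sato_root p {0} c\<^sub>0 (red f) (Zp_of_rat p \<alpha>)"
proof -
  have prime: "prime p"
    using prime_CHAR_semidom[where 'a = 'k] char by simp
  have char_p: "of_nat p = (0 :: 'k)"
    using char(1) of_nat_CHAR[where 'a = 'k] by simp
  \<comment> \<open>A p-th root of k: lift k to V, apply the inverse of F, reduce.\<close>
  have perfect: "surj (\<lambda>k :: 'k. k ^ p)"
  proof (rule surjI)
    fix k :: 'k
    show "\<pi> (inv F (inv \<pi> k)) ^ p = k"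
      using F(2,3) residue_field(2) by (metis bij_inv_eq_iff surj_f_inv_f)
  qed
  interpret reduction m c n x c\<^sub>0 x\<^sub>0 p \<pi> red
    by unfold_locales (fact V R R\<^sub>0 prime char_p residue_field reduction)+
  interpret K: perfect_poly_ring c\<^sub>0 n x\<^sub>0 p
    by unfold_locales (fact prime char_p perfect)+
  interpret BS: bs_setting c n x p nilpotency f
    by unfold_locales (fact prime RD.nilpotent f)+
  have f0: "nonzerodivisor (red f)"
    by (rule nonzerodivisor_red[OF f])
  interpret BS0: bs_setting c\<^sub>0 n x\<^sub>0 p 1 "red f"
    by unfold_locales (fact prime SD.nilpotent f0)+
  obtain a k N where N: "0 < a" "0 < k" "N 0 = 0" "\<And>e. N (Suc e) = p ^ k * N e + a"
    "\<And>e. int (N e) mod int p ^ (k * e) = Zp_of_rat p \<alpha> (k * e)"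
    using negative_rat_expansion(2)[OF prime \<alpha>] by blast
  have Zp: "Zp_of_rat p \<alpha> \<in> Zp p"
    by (rule negative_rat_expansion(1)[OF prime \<alpha>])
  have "has_functional_eq p c f (Zp_of_rat p \<alpha>)" if eq: "has_functional_eq p c\<^sub>0 (red f) (Zp_of_rat p \<alpha>)"
  proof (rule lift_functional_eq[OF Zp])
    fix j
    obtain Q e where Q: "Q \<in> diff_ops c\<^sub>0"
      "\<forall>\<nu>. int \<nu> mod int p ^ e = Zp_of_rat p \<alpha> e \<longrightarrow> Q (red f ^ Suc \<nu>) = red f ^ \<nu>"
      using eq by (auto simp: has_functional_eq_def)
    obtain P E where P: "P \<in> diff_ops c\<^sub>0"
      "\<forall>\<nu>. j \<le> \<nu> \<and> int \<nu> mod int p ^ E = Zp_of_rat p \<alpha> E \<longrightarrow> P (red f ^ \<nu>) = red f ^ (\<nu> - j)"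
      using K.left_continuity[OF f0 N(1,3,4,2,5), of j] by blast
    \<comment> \<open>Q lowers the exponent \<nu> + 1 by one and P lowers \<nu> by j; the larger of
      the two levels serves both.\<close>
    have "P (Q (red f ^ Suc \<nu>)) = red f ^ (\<nu> - j)"
      if \<nu>: "j \<le> \<nu>" "int \<nu> mod int p ^ max e E = Zp_of_rat p \<alpha> (max e E)" for \<nu>
    proof -
      have "int \<nu> mod int p ^ e = Zp_of_rat p \<alpha> e" "int \<nu> mod int p ^ E = Zp_of_rat p \<alpha> E"
        by (rule Zp_cong_le[OF Zp _ \<nu>(2)]; simp)+
      with Q(2) P(2) \<nu>(1) show ?thesis by metis
    qed
    then show "\<exists>P\<^sub>0\<in>diff_ops c\<^sub>0. \<exists>e. \<forall>\<nu>. j \<le> \<nu> \<and>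
        int \<nu> mod int p ^ e = Zp_of_rat p \<alpha> e \<longrightarrow> P\<^sub>0 (red f ^ Suc \<nu>) = red f ^ (\<nu> - j)"
      by (intro bexI[OF _ SD.diff_op_comp[OF P(1) Q(1)]] exI[of _ "max e E"]) simp
  qed
  then have "has_functional_eq p c f (Zp_of_rat p \<alpha>) \<longleftrightarrow> has_functional_eq p c\<^sub>0 (red f) (Zp_of_rat p \<alpha>)"
    using has_functional_eq_red by blast
  moreover have "bernstein_sato_root p m c f (Zp_of_rat p \<alpha>) \<longleftrightarrow>
      \<not> has_functional_eq p c f (Zp_of_rat p \<alpha>)"
    by (rule BS.bernstein_sato_root_iff[OF unit one_notin m_zero Zp])
  moreover have "bernstein_sato_root p {0} c\<^sub>0 (red f) (Zp_of_rat p \<alpha>) \<longleftrightarrow>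
      \<not> has_functional_eq p c\<^sub>0 (red f) (Zp_of_rat p \<alpha>)"
    by (rule BS0.bernstein_sato_root_iff[OF _ _ _ Zp]) (auto intro: right_inverse)
  ultimately show ?thesis
    by blast
qed

end
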